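(* Let $k\ge3$ and consider a Poisson random hypergraph on $N$ vertices with parameters $(\beta_j)_{j\ge2}$ satisfying $\beta_j=1/(j(j-1))$ for $2\le j\le k-1$ and $\beta_k>1/(k(k-1))$. Let $(Z_N(i))_{0\le i\le N}$ be its breadth-first walk and, for $R>0$, let $S_N^R=\inf\{i\ge N^{\alpha(k)}R^2: Z_N(i)\le0\}$. Then there exists $\delta>0$ such that $$\lim_{R\to\infty}\lim_{N\to\infty}\mathbb{P}(S_N^R\le N\delta)=0 .$$
   Context: Poisson random hypergraph: vertex set $\{1,\dots,N\}$; $(\beta_j)_{j\ge2}$ nonnegative reals, $\beta(t)=\sum_{j\ge2}\beta_jt^j$ with $\beta'(1)<\infty$; for each $A$ with $|A|=j\ge2$, the number of hyperedges on $A$ is Poisson with mean $N\beta_j/\binom{N}{j}$, independently over $A$. A 1-edge is a patch; deleting a patched vertex $v$ removes it and replaces each other hyperedge containing $v$ by the hyperedge on its remaining vertices. Breadth-first walk: put a patch on the lowest-labelled vertex, call it $v(1)$. Having processed $v(1),\dots,v(i-1)$, the children of $v(i)$ are the not-yet-numbered vertices $w$ such that some original hyperedge consists of $v(i)$, $w$ and a subset of $\{v(1),\dots,v(i-1)\}$; they get the next numbers in order of original label, then $v(i)$ is deleted with collapse; if no numbered-but-undeleted vertex remains, a patch is placed on the lowest-labelled un-numbered vertex, which becomes the next numbered vertex. With $c(i)$ the number of children of $v(i)$: $Z_N(0)=0$, $Z_N(i)=Z_N(i-1)+c(i)-1$. Also $\alpha(k)=(2k-4)/(2k-3)$. *)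

theory Defs
  imports "HOL-Probability.Probability"
begin

text \<open>Poisson law with mean m >= 0 (the library version needs m > 0; mean 0 is the point mass at 0).\<close>
definition poisson_mean :: "real \<Rightarrow> nat pmf" where
  "poisson_mean m = (if m \<le> 0 then return_pmf 0 else poisson_pmf m)"

text \<open>Poisson random hypergraph on {1..N}: H A is the number of hyperedges on A.
  For |A| = j >= 2, H A ~ Poisson(N beta_j / (N choose j)), independently; H A = 0 otherwise.\<close>
definition hyp_pmf :: "(nat \<Rightarrow> real) \<Rightarrow> nat \<Rightarrow> (nat set \<Rightarrow> nat) pmf" where
  "hyp_pmf \<beta> N = Pi_pmf {A. A \<subseteq> {1..N} \<and> 2 \<le> card A} 0
      (\<lambda>A. poisson_mean (real N * \<beta> (card A) / real (N choose card A)))"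

text \<open>vs = list of numbered vertices when v(i) is processed (i >= 1), v(i) = vs!(i-1).
  Children of v(i): un-numbered w with an original hyperedge consisting of v(i), w and
  a subset of {v(1),...,v(i-1)}.\<close>
definition bfw_children :: "(nat set \<Rightarrow> nat) \<Rightarrow> nat \<Rightarrow> nat list \<Rightarrow> nat \<Rightarrow> nat set" where
  "bfw_children H N vs i = {w \<in> {1..N}. w \<notin> set vs \<and>
      (\<exists>A. 0 < H A \<and> vs ! (i - 1) \<in> A \<and> w \<in> A \<and> A - {vs ! (i - 1), w} \<subseteq> set (take (i - 1) vs))}"

definition bfw_step :: "(nat set \<Rightarrow> nat) \<Rightarrow> nat \<Rightarrow> nat \<Rightarrow> nat list \<Rightarrow> nat list" where
  "bfw_step H N i vs =
     (let vs' = vs @ sorted_list_of_set (bfw_children H N vs i) in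
      if length vs' = i \<and> {1..N} - set vs' \<noteq> {} then vs' @ [Min ({1..N} - set vs')] else vs')"

text \<open>bfw_numbered H N i: numbered vertices (in order) after v(1),...,v(i) have been processed
  (including a new patched vertex if the walk restarted).\<close>
fun bfw_numbered :: "(nat set \<Rightarrow> nat) \<Rightarrow> nat \<Rightarrow> nat \<Rightarrow> nat list" where
  "bfw_numbered H N 0 = (if 1 \<le> N then [1] else [])"
| "bfw_numbered H N (Suc i) = bfw_step H N (Suc i) (bfw_numbered H N i)"

definition bfw_c :: "(nat set \<Rightarrow> nat) \<Rightarrow> nat \<Rightarrow> nat \<Rightarrow> nat" where
  "bfw_c H N i = card (bfw_children H N (bfw_numbered H N (i - 1)) i)"

definition bfw_Z :: "(nat set \<Rightarrow> nat) \<Rightarrow> nat \<Rightarrow> nat \<Rightarrow> int" where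
  "bfw_Z H N i = (\<Sum>m = 1..i. int (bfw_c H N m) - 1)"

definition alpha :: "nat \<Rightarrow> real" where
  "alpha k = (2 * real k - 4) / (2 * real k - 3)"

definition bfw_S :: "nat \<Rightarrow> (nat set \<Rightarrow> nat) \<Rightarrow> nat \<Rightarrow> real \<Rightarrow> ereal" where
  "bfw_S k H N R = Inf ((\<lambda>i. ereal (real i)) `
      {i. i \<le> N \<and> real N powr alpha k * R\<^sup>2 \<le> real i \<and> bfw_Z H N i \<le> 0})"

end

(* Revealing the hyperedges step by step shows that, given the past, the number of children of v(i)
   is binomial with N - i - q trials, q being the current queue, and a success probability p depending
   only on i. For the critical weights N p = 1 + x + ... + x^(k-2) + c x^(k-2) + O(x^(k-1)) with
   x = i/N and c > 0, so that the walk has drift c x^(k-2) up to errors caused by the queue.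

   Times of order larger than N^alpha: a Hajek--Renyi bound with the weights i (i/N)^(k-2) keeps the
   compensated walk below the drift except with probability O(T^-(2k-3)), uniformly over
   T N^alpha <= i <= delta N.

   Times of order N^alpha: the limit in N must be shown to exist. The walk is sandwiched
   between walks with independent increments; along a grid of times these converge to a Gaussian walk
   (Levy continuity for each block, Skorohod's theorem to iterate over the blocks), and the hitting
   probability changes by a small amount when the walk is only observed on the grid. Hence the
   probabilities form a Cauchy sequence. *)
theory Submission
  imports Defs
begin

section \<open>Chains on histories and their hitting probabilities\<close>

text \<open>That the inner limit in N exists is part of the claim, so bounds uniform in N are not
  enough and the window of order N^alpha has to be analysed too. The exponent balances two effects:
  at time N^alpha the accumulated drift N^alpha (N^alpha / N)^(k-2) equals the fluctuation
  N^(alpha/2). The drift is small because (1 - x)(1 + x + ... + x^(k-2)) = 1 - x^(k-1): the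
  shrinking number of un-numbered vertices cancels the growing critical edge rate, and only the
  surplus of k-edges survives. The queue is harmless: in the window it is naturally of order
  N^(alpha/2), well below sqrt N, while even overestimating it by sqrt N moves the walk by only
  o(N^(alpha/2)). The limit is never identified. Hitting probabilities are monotone in the starting
  level, so pointwise limits pass through each block and no convergence on path space is invoked.
  The stretch before the first grid time is unguarded; its Gaussian limit has a bounded density,
  which makes the hitting probability insensitive to small shifts of the level.\<close>

text \<open>Histories are stored newest entry first, so that the earlier states of a chain are the suffixes
  \<open>drop j ys\<close> of its current one.\<close>

primrec walk :: "('a list \<Rightarrow> 'a pmf) \<Rightarrow> nat \<Rightarrow> 'a list \<Rightarrow> 'a list pmf" where
  "walk K 0 xs = return_pmf xs"
| "walk K (Suc n) xs = bind_pmf (K xs) (\<lambda>x. walk K n (x # xs))"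

text \<open>Written as a first-step recursion so that bounds become inductions on the number of
  steps; \<open>hit_eq_prob\<close> recovers the probability that some history along the path
  satisfies \<open>P\<close>.\<close>

primrec hit :: "('a list \<Rightarrow> 'a pmf) \<Rightarrow> ('a list \<Rightarrow> bool) \<Rightarrow> nat \<Rightarrow> 'a list \<Rightarrow> real" where
  "hit K P 0 xs = of_bool (P xs)"
| "hit K P (Suc n) xs =
     (if P xs then 1 else measure_pmf.expectation (K xs) (\<lambda>x. hit K P n (x # xs)))"

lemma integrable_pmf_bounded:
  fixes f :: "'a \<Rightarrow> real"
  assumes "\<And>x. \<bar>f x\<bar> \<le> B"
  shows "integrable (measure_pmf p) f"
  by (rule measure_pmf.integrable_const_bound[where B = B]) (use assms in auto)

lemma expectation_pmf_mono:
  fixes f g :: "'a \<Rightarrow> real"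
  assumes "finite (set_pmf p)" "\<And>x. x \<in> set_pmf p \<Longrightarrow> f x \<le> g x"
  shows "measure_pmf.expectation p f \<le> measure_pmf.expectation p g"
  using assms by (intro integral_mono_AE integrable_measure_pmf_finite) (auto simp: AE_measure_pmf_iff)

lemma expectation_pmf_mono_bounded:
  fixes f g :: "'a \<Rightarrow> real"
  assumes "\<And>x. 0 \<le> f x" "\<And>x. f x \<le> 1" "\<And>x. 0 \<le> g x" "\<And>x. g x \<le> 1"
    and "\<And>x. x \<in> set_pmf p \<Longrightarrow> f x \<le> g x"
  shows "measure_pmf.expectation p f \<le> measure_pmf.expectation p g"
proof -
  have "integrable (measure_pmf p) f" "integrable (measure_pmf p) g"
    by (intro integrable_pmf_bounded[where B = 1]; simp add: assms(1-4))+
  then show ?thesis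
    using assms(5) by (intro integral_mono_AE) (auto simp: AE_measure_pmf_iff)
qed

lemma expectation_pmf_ge_0_le_1:
  fixes f :: "'a \<Rightarrow> real"
  assumes "\<And>x. 0 \<le> f x" "\<And>x. f x \<le> 1"
  shows "0 \<le> measure_pmf.expectation p f" "measure_pmf.expectation p f \<le> 1"
proof -
  show "0 \<le> measure_pmf.expectation p f"
    using assms by (intro integral_nonneg_AE) auto
  show "measure_pmf.expectation p f \<le> 1"
    using expectation_pmf_mono_bounded[of f "\<lambda>_. 1" p] assms by simp
qed

lemma measure_bind_pmf:
  "measure_pmf.prob (bind_pmf p f) A = measure_pmf.expectation p (\<lambda>x. measure_pmf.prob (f x) A)"
proof -
  have "ennreal (measure_pmf.prob (bind_pmf p f) A) = emeasure (bind_pmf p f) A"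
    by (simp add: measure_pmf.emeasure_eq_measure del: emeasure_bind_pmf)
  also have "\<dots> = (\<integral>\<^sup>+x. ennreal (measure_pmf.prob (f x) A) \<partial>p)"
    unfolding emeasure_bind_pmf by (simp only: measure_pmf.emeasure_eq_measure)
  also have "\<dots> = ennreal (measure_pmf.expectation p (\<lambda>x. measure_pmf.prob (f x) A))"
    by (intro nn_integral_eq_integral integrable_pmf_bounded[where B = 1]) auto
  finally show ?thesis
    by (simp add: integral_nonneg_AE)
qed

lemma hit_bounds: "0 \<le> hit K P n xs" "hit K P n xs \<le> 1"
proof -
  have "0 \<le> hit K P n xs \<and> hit K P n xs \<le> 1"
    by (induction n arbitrary: xs) (auto simp: expectation_pmf_ge_0_le_1)
  then show "0 \<le> hit K P n xs" "hit K P n xs \<le> 1" by auto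
qed

lemma walk_length: "ys \<in> set_pmf (walk K n xs) \<Longrightarrow> length ys = n + length xs \<and> drop n ys = xs"
proof (induction n arbitrary: xs)
  case (Suc n)
  then obtain x where "length ys = n + length (x # xs)" "drop n ys = x # xs" by auto
  moreover from this have "drop (Suc n) ys = xs" by (metis drop_Suc list.sel(3) tl_drop)
  ultimately show ?case by simp
qed auto

text \<open>In a path \<open>ys\<close> of n further steps, \<open>drop n ys\<close> is the starting
  history. If \<open>P\<close> holds there the event is certain; otherwise that index can be
  discarded, and conditioning on the first step gives the recursion of \<open>hit\<close>.\<close>

lemma hit_eq_prob:
  "hit K P n xs = measure_pmf.prob (walk K n xs) {ys. \<exists>j\<le>n. P (drop j ys)}"
proof (induction n arbitrary: xs)
  case 0
  show ?case by (simp add: measure_return)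
next
  case (Suc n)
  show ?case
  proof (cases "P xs")
    case True
    have "measure_pmf.prob (walk K (Suc n) xs) {ys. \<exists>j\<le>Suc n. P (drop j ys)} = 1"
    proof (subst measure_pmf.prob_eq_1)
      show "AE ys in walk K (Suc n) xs. ys \<in> {ys. \<exists>j\<le>Suc n. P (drop j ys)}"
        unfolding AE_measure_pmf_iff
      proof
        fix ys assume "ys \<in> set_pmf (walk K (Suc n) xs)"
        then have "drop (Suc n) ys = xs" using walk_length by blast
        then show "ys \<in> {ys. \<exists>j\<le>Suc n. P (drop j ys)}" using True
            by (intro CollectI exI[of _ "Suc n"]) simp
      qed
    qed simp
    then show ?thesis using True by (simp del: walk.simps)
  next
    case False
    have "measure_pmf.prob (walk K n (x # xs)) {ys. \<exists>j\<le>n. P (drop j ys)} =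
        measure_pmf.prob (walk K n (x # xs)) {ys. \<exists>j\<le>Suc n. P (drop j ys)}" for x
    proof (intro measure_pmf.finite_measure_eq_AE)
      show "AE ys in walk K n (x # xs). (ys \<in> {ys. \<exists>j\<le>n. P (drop j ys)}) =
          (ys \<in> {ys. \<exists>j\<le>Suc n. P (drop j ys)})"
        unfolding AE_measure_pmf_iff
      proof
        fix ys assume "ys \<in> set_pmf (walk K n (x # xs))"
        then have "drop (Suc n) ys = xs"
          using walk_length[of ys K n "x # xs"] by (metis drop_Suc list.sel(3) tl_drop)
        then show "(ys \<in> {ys. \<exists>j\<le>n. P (drop j ys)}) = (ys \<in> {ys. \<exists>j\<le>Suc n. P (drop j ys)})"
          using False by (auto simp: le_Suc_eq)
      qed
    qed auto
    then show ?thesis using False by (simp add: measure_bind_pmf Suc.IH)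
  qed
qed

text \<open>\<open>walk\<close> peels off the first step, whereas the law of the child counts is
  built by adding the newest one; associativity of bind passes between the two.\<close>

lemma walk_Suc_last:
  "walk K (Suc n) xs = bind_pmf (walk K n xs) (\<lambda>ys. map_pmf (\<lambda>y. y # ys) (K ys))"
proof (induction n arbitrary: xs)
  case 0
  show ?case by (simp add: bind_return_pmf map_pmf_def)
next
  case (Suc n)
  have "walk K (Suc (Suc n)) xs = bind_pmf (K xs) (\<lambda>x. walk K (Suc n) (x # xs))"
    by (rule walk.simps)
  also have "\<dots> = bind_pmf (K xs) (\<lambda>x. bind_pmf (walk K n (x # xs)) (\<lambda>ys. map_pmf (\<lambda>y. y # ys) (K ys)))"
    by (simp only: Suc.IH)
  also have "\<dots> = bind_pmf (walk K (Suc n) xs) (\<lambda>ys. map_pmf (\<lambda>y. y # ys) (K ys))"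
    by (simp only: walk.simps bind_assoc_pmf)
  finally show ?case .
qed

text \<open>Optional stopping for a nonnegative supermartingale, by backward induction: up to the
  hitting time the mean of \<open>f\<close> cannot rise, and at the hitting time \<open>f\<close> is
  at least 1. The bound \<open>L\<close> confines the hypotheses to the times actually
  reached.\<close>

lemma hit_le_supersolution:
  assumes "\<And>ys. length ys \<le> L \<Longrightarrow> 0 \<le> f ys" "\<And>ys. length ys \<le> L \<Longrightarrow> P ys \<Longrightarrow> 1 \<le> f ys"
    and "\<And>ys. finite (set_pmf (K ys))"
    and "\<And>ys. length ys < L \<Longrightarrow> \<not> P ys \<Longrightarrow> measure_pmf.expectation (K ys) (\<lambda>y. f (y # ys)) \<le> f ys"
  shows "n + length xs \<le> L \<Longrightarrow> hit K P n xs \<le> f xs"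
proof (induction n arbitrary: xs)
  case 0
  then show ?case using assms(1,2)[of xs] by auto
next
  case (Suc n)
  show ?case
  proof (cases "P xs")
    case True
    then show ?thesis using assms(2)[of xs] Suc.prems by simp
  next
    case False
    have "hit K P (Suc n) xs = measure_pmf.expectation (K xs) (\<lambda>x. hit K P n (x # xs))"
      using False by simp
    also have "\<dots> \<le> measure_pmf.expectation (K xs) (\<lambda>x. f (x # xs))"
      using assms(3) Suc by (intro expectation_pmf_mono) auto
    also have "\<dots> \<le> f xs" using assms(4) False Suc.prems by simp
    finally show ?thesis .
  qed
qed

text \<open>Paths are compared under one and the same kernel: whenever \<open>P\<close> holds at a
  history, \<open>Q\<close> has held there or earlier, but not before the start. Deterministic
  estimates along a path enter the probability bounds through this lemma.\<close>

lemma hit_mono_path: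
  assumes "\<And>ys. length ys \<le> n + length xs \<Longrightarrow> length xs \<le> length ys \<Longrightarrow>
      drop (length ys - length xs) ys = xs \<Longrightarrow> P ys \<Longrightarrow>
     \<exists>j\<le>length ys - length xs. Q (drop j ys)"
  shows "hit K P n xs \<le> hit K Q n xs"
  unfolding hit_eq_prob
proof (rule measure_pmf.finite_measure_mono_AE)
  show "AE ys in walk K n xs. ys \<in> {ys. \<exists>j\<le>n. P (drop j ys)} \<longrightarrow> ys \<in> {ys. \<exists>j\<le>n. Q (drop j ys)}"
    unfolding AE_measure_pmf_iff
  proof (intro ballI impI)
    fix ys assume ys: "ys \<in> set_pmf (walk K n xs)" and "ys \<in> {ys. \<exists>j\<le>n. P (drop j ys)}"
    then obtain j where j: "j \<le> n" "P (drop j ys)" by auto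
    have l: "length ys = n + length xs" "drop n ys = xs" using walk_length[OF ys] by auto
    have len: "length (drop j ys) - length xs = n - j" using l(1) j(1) by simp
    have "drop (n - j) (drop j ys) = xs" using l(2) j(1) by simp
    moreover have "length (drop j ys) \<le> n + length xs" "length xs \<le> length (drop j ys)"
      using l(1) j(1) by simp_all
    ultimately obtain i where i: "i \<le> n - j" "Q (drop i (drop j ys))"
      using assms[of "drop j ys"] j(2) unfolding len by blast
    have "i + j \<le> n" "Q (drop (i + j) ys)" using i j(1) by (simp_all add: add.commute)
    then show "ys \<in> {ys. \<exists>j\<le>n. Q (drop j ys)}" by blast
  qed
qed auto

lemma hit_disj_le: "hit K (\<lambda>xs. P xs \<or> Q xs) n xs \<le> hit K P n xs + hit K Q n xs"
proof -
  have "{ys. \<exists>j\<le>n. P (drop j ys) \<or> Q (drop j ys)} =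
    {ys. \<exists>j\<le>n. P (drop j ys)} \<union> {ys. \<exists>j\<le>n. Q (drop j ys)}" by auto
  then show ?thesis unfolding hit_eq_prob by (simp add: measure_Un_le)
qed

section \<open>The child counts as a Markov chain\<close>

lemma measure_pair_pmf_Times:
  "measure_pmf.prob (pair_pmf p q) (A \<times> B) = measure_pmf.prob p A * measure_pmf.prob q B"
proof -
  have "measure_pmf.prob (map_pmf (Pair x) q) (A \<times> B) = indicator A x * measure_pmf.prob q B" for x
  proof -
    have "Pair x -` (A \<times> B) = (if x \<in> A then B else {})" by auto
    then show ?thesis by (simp add: measure_map_pmf)
  qed
  moreover have "pair_pmf p q = bind_pmf p (\<lambda>x. map_pmf (Pair x) q)"
    by (simp add: pair_pmf_def map_pmf_def)
  ultimately show ?thesis by (simp add: measure_bind_pmf)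
qed

text \<open>The product law over S is obtained by gluing independent families on E and S - E, and
  each predicate reads only one of the two.\<close>

lemma Pi_pmf_indep_disjoint:
  assumes "finite S" "E \<subseteq> S"
    and Q1: "\<And>H H'. (\<And>x. x \<in> E \<Longrightarrow> H x = H' x) \<Longrightarrow> Q1 H \<longleftrightarrow> Q1 H'"
    and Q2: "\<And>H H'. (\<And>x. x \<in> S - E \<Longrightarrow> H x = H' x) \<Longrightarrow> Q2 H \<longleftrightarrow> Q2 H'"
  shows "measure_pmf.prob (Pi_pmf S d p) {H. Q1 H \<and> Q2 H} =
    measure_pmf.prob (Pi_pmf S d p) {H. Q1 H} * measure_pmf.prob (Pi_pmf S d p) {H. Q2 H}"
proof -
  let ?A = "Pi_pmf E d p" and ?B = "Pi_pmf (S - E) d p"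
  let ?h = "\<lambda>(f, g) x. if x \<in> E then f x else g x"
  have fin: "finite E" "finite (S - E)" using assms(1,2) finite_subset by auto
  have S: "Pi_pmf S d p = map_pmf ?h (pair_pmf ?A ?B)"
    using Pi_pmf_union[OF fin, of d p] assms(2) by (simp add: Un_absorb1)
  have q: "Q1 (?h (f, g)) = Q1 f" "Q2 (?h (f, g)) = Q2 g" for f g
    by (rule Q1, simp, rule Q2, simp)
  have prod: "measure_pmf.prob (Pi_pmf S d p) {H. R1 H \<and> R2 H} =
      measure_pmf.prob ?A {H. R1 H} * measure_pmf.prob ?B {H. R2 H}"
    if "\<And>f g. R1 (?h (f, g)) = R1 f" "\<And>f g. R2 (?h (f, g)) = R2 g" for R1 R2
  proof -
    have "?h -` {H. R1 H \<and> R2 H} = {f. R1 f} \<times> {g. R2 g}" using that by auto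
    then show ?thesis unfolding S by (simp only: measure_map_pmf measure_pair_pmf_Times)
  qed
  show ?thesis
    using prod[of Q1 Q2, OF q] prod[of Q1 "\<lambda>_. True", OF q(1) refl]
      prod[of "\<lambda>_. True" Q2, OF refl q(2)] by simp
qed

text \<open>Disintegration in product form: multiplying by the probability of f = a, instead of
  conditioning on it, keeps values of probability 0 harmless.\<close>

lemma map_pmf_pair_eq_bind:
  fixes f :: "'x \<Rightarrow> 'b" and g :: "'x \<Rightarrow> 'c"
  assumes "\<And>a b. measure_pmf.prob M {x. f x = a \<and>
      g x = b} = measure_pmf.prob M {x. f x = a} * pmf (K a) b"
  shows "map_pmf (\<lambda>x. (f x, g x)) M = bind_pmf (map_pmf f M) (\<lambda>a. map_pmf (Pair a) (K a))"
proof (rule pmf_eqI)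
  fix ab :: "'b \<times> 'c"
  obtain a b where ab: "ab = (a, b)" by force
  have "(\<lambda>x. (f x, g x)) -` {(a, b)} = {x. f x = a \<and> g x = b}" by auto
  then have l: "pmf (map_pmf (\<lambda>x. (f x, g x)) M) (a, b) = measure_pmf.prob M {x. f x = a} * pmf (K a) b"
    by (simp add: pmf_map assms)
  have *: "pmf (map_pmf (Pair a') (K a')) (a, b) = indicator {a} a' * pmf (K a) b" for a'
  proof (cases "a' = a")
    case True
    have "Pair a -` {(a, b)} = {b}" by auto
    then show ?thesis using True by (simp add: pmf_map measure_pmf_single)
  next
    case False
    then have "Pair a' -` {(a, b)} = {}" by auto
    then show ?thesis using False by (simp add: pmf_map)
  qed
  have "f -` {a} = {x. f x = a}" by auto
  then have "pmf (bind_pmf (map_pmf f M) (\<lambda>a. map_pmf (Pair a) (K a))) (a, b) =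
      measure_pmf.prob M {x. f x = a} * pmf (K a) b"
    by (simp add: pmf_bind * measure_map_pmf)
  then show "pmf (map_pmf (\<lambda>x. (f x, g x)) M) ab =
      pmf (bind_pmf (map_pmf f M) (\<lambda>a. map_pmf (Pair a) (K a))) ab"
    using l ab by simp
qed

text \<open>Here \<open>G w\<close> is the block of coordinates whose vanishing decides whether \<open>w\<close> is counted.\<close>

lemma Pi_pmf_count_blocks_binomial:
  fixes p :: "'a \<Rightarrow> nat pmf"
  assumes S: "finite S" and U: "finite U" and G: "\<And>w. w \<in> U \<Longrightarrow> G w \<subseteq> S"
    and disj: "\<And>w w'. w \<in> U \<Longrightarrow> w' \<in> U \<Longrightarrow> w \<noteq> w' \<Longrightarrow> G w \<inter> G w' = {}"
    and q: "\<And>w. w \<in> U \<Longrightarrow> (\<Prod>x\<in>G w. pmf (p x) 0) = 1 - q" and q01: "q \<in> {0..1}"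
  shows "map_pmf (\<lambda>H. card {w \<in> U. \<exists>x\<in>G w. 0 < H x}) (Pi_pmf S 0 p) = binomial_pmf (card U) q"
  using U G disj q
proof (induction U rule: finite_induct)
  case empty
  show ?case using q01 by (simp add: map_pmf_const binomial_pmf_0)
next
  case (insert u U)
  let ?b = "\<lambda>H :: 'a \<Rightarrow> nat. \<exists>x\<in>G u. 0 < H x" and ?c = "\<lambda>H. card {w \<in> U. \<exists>x\<in>G w. 0 < (H x :: nat)}"
  have Gu: "G u \<subseteq> S" using insert.prems by auto
  have pb0: "measure_pmf.prob (Pi_pmf S 0 p) {H. \<not> ?b H} = 1 - q"
  proof -
    have "measure_pmf.prob (Pi_pmf S 0 p) {H. \<not> ?b H} =
        measure_pmf.prob (Pi_pmf S 0 p) (Pi S (\<lambda>x. if x \<in> G u then {0} else UNIV))"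
      using Gu by (intro arg_cong2[where f = measure]) (auto simp: Pi_def subset_eq split: if_splits)
    also have "\<dots> = (\<Prod>x\<in>S. if x \<in> G u then pmf (p x) 0 else 1)"
      using S by (subst measure_Pi_pmf_Pi) (auto intro!: prod.cong simp: measure_pmf_single)
    also have "\<dots> = (\<Prod>x\<in>G u. pmf (p x) 0)"
      using S Gu by (simp add: prod.If_cases Int_absorb1)
    also have "\<dots> = 1 - q" using insert.prems(3) by auto
    finally show ?thesis .
  qed
  have pb: "measure_pmf.prob (Pi_pmf S 0 p) {H. ?b H = b} = pmf (bernoulli_pmf q) b" for b
  proof (cases b)
    case False
    then show ?thesis using pb0 q01 by simp
  next
    case True
    have "{H. ?b H} = space (measure_pmf (Pi_pmf S 0 p)) - {H. \<not> ?b H}" by auto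
    then have "measure_pmf.prob (Pi_pmf S 0 p) {H. ?b H} =
        1 - measure_pmf.prob (Pi_pmf S 0 p) {H. \<not> ?b H}"
      by (simp only: measure_pmf.prob_compl sets_measure_pmf UNIV_I)
    then show ?thesis using True pb0 q01 by simp
  qed
  have mb: "map_pmf ?b (Pi_pmf S 0 p) = bernoulli_pmf q"
    by (rule pmf_eqI) (simp add: pmf_map vimage_def pb)
  have IH: "map_pmf ?c (Pi_pmf S 0 p) = binomial_pmf (card U) q"
    using insert by auto
  have ind: "measure_pmf.prob (Pi_pmf S 0 p) {H. ?b H = b \<and> ?c H = n} =
     measure_pmf.prob (Pi_pmf S 0 p) {H. ?b H = b} * pmf (binomial_pmf (card U) q) n" for b n
  proof -
    have "measure_pmf.prob (Pi_pmf S 0 p) {H. ?b H = b \<and> ?c H = n} =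
     measure_pmf.prob (Pi_pmf S 0 p) {H. ?b H = b} * measure_pmf.prob (Pi_pmf S 0 p) {H. ?c H = n}"
    proof (rule Pi_pmf_indep_disjoint[OF S Gu])
      fix H H' :: "'a \<Rightarrow> nat"
      show "(?b H = b) = (?b H' = b)" if "\<And>x. x \<in> G u \<Longrightarrow> H x = H' x"
        using that by (simp cong: bex_cong)
      assume a: "\<And>x. x \<in> S - G u \<Longrightarrow> H x = H' x"
      have "H x = H' x" if "w \<in> U" "x \<in> G w" for w x
      proof -
        have "w \<noteq> u" using insert.hyps that by auto
        then have "G w \<inter> G u = {}" using insert.prems(2)[of w u] that by auto
        then show ?thesis using a insert.prems(1)[of w] that by blast
      qed
      then have "{w \<in> U. \<exists>x\<in>G w. 0 < H x} = {w \<in> U. \<exists>x\<in>G w. 0 < H' x}" by auto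
      then show "(?c H = n) = (?c H' = n)" by simp
    qed
    also have "measure_pmf.prob (Pi_pmf S 0 p) {H. ?c H = n} = pmf (map_pmf ?c (Pi_pmf S 0 p)) n"
      by (simp add: pmf_map vimage_def)
    finally show ?thesis using IH by simp
  qed
  have "map_pmf (\<lambda>H. card {w \<in> insert u U. \<exists>x\<in>G w. 0 < H x}) (Pi_pmf S 0 p) =
    map_pmf (\<lambda>(b, c). (if b then 1 else 0) + c) (map_pmf (\<lambda>H. (?b H, ?c H)) (Pi_pmf S 0 p))"
    unfolding map_pmf_comp
  proof (rule map_pmf_cong[OF refl])
    fix H :: "'a \<Rightarrow> nat"
    have "{w \<in> insert u U. \<exists>x\<in>G w. 0 < H x} = (if ?b H then {u} else {}) \<union> {w \<in> U. \<exists>x\<in>G w. 0 < H x}"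
      by auto
    then show "card {w \<in> insert u U. \<exists>x\<in>G w. 0 < H x} =
       (case (?b H, ?c H) of (b, c) \<Rightarrow> (if b then 1 else 0) + c)"
      using insert.hyps by auto
  qed
  also have "map_pmf (\<lambda>H. (?b H, ?c H)) (Pi_pmf S 0 p) =
     bind_pmf (bernoulli_pmf q) (\<lambda>b. map_pmf (Pair b) (binomial_pmf (card U) q))"
    using map_pmf_pair_eq_bind[of "Pi_pmf S 0 p" ?b ?c "\<lambda>_. binomial_pmf (card U) q", OF ind]
    unfolding mb .
  also have "map_pmf (\<lambda>(b, c). (if b then 1 else 0) + c) \<dots> = binomial_pmf (card (insert u U)) q"
    using q01 insert.hyps
    by (simp add: binomial_pmf_Suc map_bind_pmf map_pmf_comp) (simp add: map_pmf_def)
  finally show ?case .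
qed

text \<open>\<open>queue cs\<close> is the number of numbered, undeleted vertices other than the one being processed;
  the truncated subtraction accounts for the patch placed when a component is exhausted.\<close>

primrec queue :: "nat list \<Rightarrow> nat" where
  "queue [] = 0"
| "queue (c # cs) = queue cs + c - 1"

text \<open>Total Poisson mean of the hyperedges that would make a given un-numbered vertex a child
  of the vertex processed after i deletions: such an edge consists of these two vertices and d of
  the i deleted ones.\<close>

definition edge_rate :: "(nat \<Rightarrow> real) \<Rightarrow> nat \<Rightarrow> nat \<Rightarrow> real" where
  "edge_rate \<beta> N i =
     (\<Sum>d\<le>i. real (i choose d) * (real N * \<beta> (d + 2) / real (N choose (d + 2))))"

definition link_prob :: "(nat \<Rightarrow> real) \<Rightarrow> nat \<Rightarrow> nat \<Rightarrow> real" where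
  "link_prob \<beta> N i = 1 - exp (- edge_rate \<beta> N i)"

text \<open>The trials are the un-numbered vertices: besides the deleted ones, the vertex being
  processed and the queue are already numbered.\<close>

definition child_kernel :: "(nat \<Rightarrow> real) \<Rightarrow> nat \<Rightarrow> nat list \<Rightarrow> nat pmf" where
  "child_kernel \<beta> N cs =
     binomial_pmf (N - Suc (length cs) - queue cs) (link_prob \<beta> N (length cs))"

primrec child_counts :: "(nat set \<Rightarrow> nat) \<Rightarrow> nat \<Rightarrow> nat \<Rightarrow> nat list" where
  "child_counts H N 0 = []"
| "child_counts H N (Suc i) = bfw_c H N (Suc i) # child_counts H N i"

lemma length_child_counts [simp]: "length (child_counts H N i) = i"
  by (induction i) auto

lemma link_prob_01:
  assumes "\<And>j. 2 \<le> j \<Longrightarrow> 0 \<le> \<beta> j"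
  shows "link_prob \<beta> N i \<in> {0..1}"
proof -
  have "0 \<le> edge_rate \<beta> N i" unfolding edge_rate_def
    using assms by (intro sum_nonneg mult_nonneg_nonneg divide_nonneg_nonneg) auto
  then show ?thesis by (simp add: link_prob_def)
qed

section \<open>Numbered vertices and the edges inspected at each step\<close>

lemma bfw_children_subset: "bfw_children H N vs i \<subseteq> {1..N} - set vs"
  by (auto simp: bfw_children_def)

lemma finite_bfw_children [simp]: "finite (bfw_children H N vs i)"
  by (rule finite_subset[OF bfw_children_subset]) simp

text \<open>The numbered vertices are the i deleted ones, the one to be processed next and the
  queue. The bound i < N guarantees that a restart always finds a fresh vertex.\<close>

lemma bfw_numbered_invariant:
  assumes "i < N"
  shows "distinct (bfw_numbered H N i) \<and> set (bfw_numbered H N i) \<subseteq> {1..N} \<and>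
    length (bfw_numbered H N i) = Suc i + queue (child_counts H N i)"
  using assms
proof (induction i)
  case 0
  then show ?case by auto
next
  case (Suc i)
  define vs where "vs = bfw_numbered H N i"
  define C where "C = bfw_children H N vs (Suc i)"
  have IH: "distinct vs" "set vs \<subseteq> {1..N}" "length vs = Suc i + queue (child_counts H N i)"
    using Suc unfolding vs_def by auto
  have C: "C \<subseteq> {1..N} - set vs" "finite C" unfolding C_def by (rule bfw_children_subset) simp
  have c: "bfw_c H N (Suc i) = card C" by (simp add: bfw_c_def C_def vs_def)
  define vs' where "vs' = vs @ sorted_list_of_set C"
  have vs': "distinct vs'" "set vs' \<subseteq> {1..N}" "length vs' = Suc i + queue (child_counts H N i) + card C"
    using IH C unfolding vs'_def by auto
  have step: "bfw_numbered H N (Suc i) =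
     (if length vs' = Suc i \<and> {1..N} - set vs' \<noteq> {} then vs' @ [Min ({1..N} - set vs')] else vs')"
    by (simp add: bfw_step_def Let_def vs'_def C_def vs_def)
  show ?case
  proof (cases "length vs' = Suc i")
    \<comment> \<open>The queue is exhausted: the patch supplies one more numbered vertex, while the
      truncated recursion of \<open>queue\<close> returns 0.\<close>
    case True
    have "card (set vs') = Suc i" using True vs'(1) by (simp add: distinct_card)
    then have ne: "{1..N} - set vs' \<noteq> {}"
      using Suc.prems vs'(2) by (metis Diff_eq_empty_iff card_atLeastAtMost diff_Suc_1
          nat_neq_iff subset_antisym)
    have "Min ({1..N} - set vs') \<in> {1..N} - set vs'" using ne by (intro Min_in) auto
    then show ?thesis using True ne vs' c unfolding step by auto
  next
    case False
    then show ?thesis using vs' c unfolding step by auto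
  qed
qed

lemma bfw_numbered_prefix:
  "\<exists>ws. bfw_numbered H N (Suc i) = bfw_numbered H N i @ ws"
  by (auto simp: bfw_step_def Let_def)

text \<open>The walk itself, without truncation: a step that exhausts a component lowers it by 1
  while \<open>queue\<close> stays at 0.\<close>

primrec net :: "nat list \<Rightarrow> real" where
  "net [] = 0"
| "net (c # cs) = net cs + real c - 1"

lemma bfw_children_eqI:
  assumes "\<And>w A. w \<in> {1..N} \<Longrightarrow> w \<notin> set vs \<Longrightarrow> vs ! i \<in> A \<Longrightarrow> w \<in> A \<Longrightarrow>
      A - {vs ! i, w} \<subseteq> set (take i vs) \<Longrightarrow> H A = H' A"
  shows "bfw_children H N vs (Suc i) = bfw_children H' N vs (Suc i)"
proof (rule set_eqI)
  fix w
  show "w \<in> bfw_children H N vs (Suc i) \<longleftrightarrow> w \<in> bfw_children H' N vs (Suc i)"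
  proof (cases "w \<in> {1..N} \<and> w \<notin> set vs")
    case True
    have "(0 < H A \<and> vs ! i \<in> A \<and> w \<in> A \<and> A - {vs ! i, w} \<subseteq> set (take i vs)) =
        (0 < H' A \<and> vs ! i \<in> A \<and> w \<in> A \<and> A - {vs ! i, w} \<subseteq> set (take i vs))" for A
      using assms[of w A] True by (cases "vs ! i \<in> A \<and> w \<in> A \<and> A - {vs ! i, w} \<subseteq> set (take i vs)") auto
    then show ?thesis using True by (simp add: bfw_children_def)
  next
    case False
    then show ?thesis by (auto simp: bfw_children_def)
  qed
qed

text \<open>An edge tested at step i + 1 is contained in the first i + 1 numbered vertices together
  with the candidate w, so removing the former leaves at most one vertex.\<close>

lemma bfw_children_cong:
  assumes vs: "i < length vs" "set vs \<subseteq> {1..N}"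
    and agree: "\<And>A. A \<subseteq> {1..N} \<Longrightarrow> 2 \<le> card A \<Longrightarrow> card (A - set (take (Suc i) vs)) \<le> 1 \<Longrightarrow> H A = H' A"
  shows "bfw_children H N vs (Suc i) = bfw_children H' N vs (Suc i)"
proof -
  have "H A = H' A" if w: "w \<in> {1..N}" "w \<notin> set vs" and A: "vs ! i \<in> A" "w \<in> A"
      "A - {vs ! i, w} \<subseteq> set (take i vs)" for w A
  proof (rule agree)
    have v: "vs ! i \<in> set vs" using vs by simp
    show sub: "A \<subseteq> {1..N}" using A(3) w(1) v vs(2) set_take_subset[of i vs] by blast
    then have fin: "finite A" by (rule finite_subset) simp
    have "vs ! i \<noteq> w" using v w by metis
    then have "card {vs ! i, w} = 2" by simp
    then show "2 \<le> card A" using card_mono[OF fin, of "{vs ! i, w}"] A by auto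
    have "A - set (take (Suc i) vs) \<subseteq> {w}" using A(3) vs(1) by (auto simp: take_Suc_conv_app_nth)
    then show "card (A - set (take (Suc i) vs)) \<le> 1"
      using card_mono[of "{w}" "A - set (take (Suc i) vs)"] by simp
  qed
  then show ?thesis by (rule bfw_children_eqI)
qed

text \<open>The first \<open>i\<close> steps only inspect sets with at most one vertex outside \<open>{v(1),\<dots>,v(i)}\<close>,
  whereas step \<open>i + 1\<close> inspects sets with two such vertices. This disjointness is what makes the child
  counts Markovian.\<close>

lemma bfw_history_cong:
  assumes "i < N"
    and "\<And>A. A \<subseteq> {1..N} \<Longrightarrow> 2 \<le> card A \<Longrightarrow>
      card (A - set (take i (bfw_numbered H N i))) \<le> 1 \<Longrightarrow> H A = H' A"
  shows "bfw_numbered H' N i = bfw_numbered H N i \<and> child_counts H' N i = child_counts H N i"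
  using assms
proof (induction i)
  case 0
  then show ?case by simp
next
  case (Suc i)
  define vs where "vs = bfw_numbered H N i"
  have inv: "set vs \<subseteq> {1..N}" "i < length vs"
    using bfw_numbered_invariant[of i N H] Suc.prems(1) unfolding vs_def by auto
  \<comment> \<open>Steps only append, and v(i+1) is in the list before it is processed, so the
    processed prefix is the same before and after this step.\<close>
  have tk: "take (Suc i) (bfw_numbered H N (Suc i)) = take (Suc i) vs"
    using bfw_numbered_prefix[of H N i] inv(2) unfolding vs_def by auto
  have agree: "H A = H' A" if "A \<subseteq> {1..N}" "2 \<le> card A" "card (A - set (take (Suc i) vs)) \<le> 1" for A
    using Suc.prems(2)[OF that(1,2)] that(3) unfolding tk by simp
  have IH: "bfw_numbered H' N i = vs" "child_counts H' N i = child_counts H N i"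
  proof -
    have "H A = H' A" if A: "A \<subseteq> {1..N}" "2 \<le> card A" "card (A - set (take i vs)) \<le> 1" for A
    proof (rule agree[OF A(1,2)])
      have "finite A" using A(1) by (rule finite_subset) simp
      then have "card (A - set (take (Suc i) vs)) \<le> card (A - set (take i vs))"
        using set_take_subset_set_take[of i "Suc i" vs] by (intro card_mono) auto
      then show "card (A - set (take (Suc i) vs)) \<le> 1" using A(3) by simp
    qed
    then have "bfw_numbered H' N i = bfw_numbered H N i \<and> child_counts H' N i = child_counts H N i"
      using Suc.IH Suc.prems(1) unfolding vs_def by (meson Suc_lessD)
    then show "bfw_numbered H' N i = vs" "child_counts H' N i = child_counts H N i"
      unfolding vs_def by auto
  qed
  have "bfw_children H N vs (Suc i) = bfw_children H' N vs (Suc i)"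
    by (rule bfw_children_cong[OF inv(2,1) agree])
  then show ?case using IH by (simp add: bfw_step_def bfw_c_def vs_def[symmetric])
qed

lemma sum_Pow_card:
  fixes f :: "nat \<Rightarrow> real"
  assumes "finite T"
  shows "(\<Sum>D\<in>Pow T. f (card D)) = (\<Sum>d\<le>card T. real (card T choose d) * f d)"
proof -
  have "(\<Sum>D\<in>Pow T. f (card D)) = (\<Sum>d\<le>card T. \<Sum>D\<in>{D \<in> Pow T. card D = d}. f (card D))"
    using assms by (intro sum.group[symmetric]) (auto intro: card_mono)
  also have "\<dots> = (\<Sum>d\<le>card T. real (card T choose d) * f d)"
    using n_subsets[OF assms] by (intro sum.cong) simp_all
  finally show ?thesis .
qed

lemma pmf_poisson_mean_0: "0 \<le> m \<Longrightarrow> pmf (poisson_mean m) 0 = exp (- m)"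
  by (auto simp: poisson_mean_def)

section \<open>Law of one step and of the whole sequence of child counts\<close>

text \<open>For a fixed list the edge sets tested for different w are disjoint, since w is their
  only member outside the list. A candidate is missed when all its Poisson counts vanish, and these
  probabilities multiply to the exponential of minus \<open>edge_rate\<close>.\<close>

lemma card_children_law:
  assumes \<beta>: "\<And>j. 2 \<le> j \<Longrightarrow> 0 \<le> \<beta> j"
    and vs: "i < length vs" "set vs \<subseteq> {1..N}" "distinct vs"
  shows "map_pmf (\<lambda>H. card (bfw_children H N vs (Suc i))) (hyp_pmf \<beta> N) =
    binomial_pmf (N - length vs) (link_prob \<beta> N i)"
proof -
  define S where "S = {A. A \<subseteq> {1..N} \<and> 2 \<le> card A}"
  define p where "p = (\<lambda>A :: nat set. poisson_mean (real N * \<beta> (card A) / real (N choose card A)))"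
  define v where "v = vs ! i"
  define T where "T = set (take i vs)"
  define U where "U = {1..N} - set vs"
  define G where "G = (\<lambda>w. (\<lambda>D. insert v (insert w D)) ` Pow T)"
  have T: "finite T" "card T = i" "T \<subseteq> set vs"
    using vs by (auto simp: T_def distinct_card distinct_take dest: in_set_takeD)
  have v: "v \<in> set vs" "v \<notin> T"
    using vs by (auto simp: v_def T_def in_set_conv_nth nth_eq_iff_index_eq)
  have cardI: "card (insert v (insert w D)) = card D + 2" if "w \<in> U" "D \<subseteq> T" for w D
  proof -
    have "finite D" "w \<notin> D" "v \<notin> insert w D"
      using that T v finite_subset unfolding U_def by auto
    then show ?thesis by simp
  qed
  have fS: "finite S" unfolding S_def by (rule finite_subset[of _ "Pow {1..N}"]) auto
  have "card U = N - length vs"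
    unfolding U_def using vs by (subst card_Diff_subset) (auto simp: distinct_card)
  moreover have "bfw_children H N vs (Suc i) = {w \<in> U. \<exists>A\<in>G w. 0 < H A}" for H
  proof -
    have "(\<exists>A. 0 < H A \<and> v \<in> A \<and> w \<in> A \<and> A - {v, w} \<subseteq> T) \<longleftrightarrow> (\<exists>A\<in>G w. 0 < H A)" for w
    proof
      assume "\<exists>A. 0 < H A \<and> v \<in> A \<and> w \<in> A \<and> A - {v, w} \<subseteq> T"
      then obtain A where A: "0 < H A" "v \<in> A" "w \<in> A" "A - {v, w} \<subseteq> T" by auto
      then have "A = insert v (insert w (A - {v, w}))" by auto
      then have "A \<in> G w" unfolding G_def using A(4) by blast
      then show "\<exists>A\<in>G w. 0 < H A" using A(1) by auto
    qed (auto simp: G_def)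
    then show ?thesis unfolding bfw_children_def U_def by (auto simp: v_def T_def)
  qed
  moreover have "map_pmf (\<lambda>H. card {w \<in> U. \<exists>A\<in>G w. 0 < H A}) (Pi_pmf S 0 p) =
      binomial_pmf (card U) (link_prob \<beta> N i)"
  proof (rule Pi_pmf_count_blocks_binomial[OF fS])
    show "finite U" unfolding U_def by simp
    show "link_prob \<beta> N i \<in> {0..1}" by (rule link_prob_01[OF \<beta>])
    show "G w \<subseteq> S" if "w \<in> U" for w
      using cardI[OF that] that v(1) T(3) vs(2) unfolding G_def S_def by (auto simp: U_def)
    show "G w \<inter> G w' = {}" if "w \<in> U" "w' \<in> U" "w \<noteq> w'" for w w'
    proof (rule ccontr)
      assume "G w \<inter> G w' \<noteq> {}"
      then obtain D D' where D: "D \<subseteq> T" "D' \<subseteq> T" "insert v (insert w D) = insert v (insert w' D')"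
        unfolding G_def by auto
      then have "w' \<in> insert v (insert w D)" by auto
      then show False using that D(1) T(3) v(1) unfolding U_def by auto
    qed
    show "(\<Prod>x\<in>G w. pmf (p x) 0) = 1 - link_prob \<beta> N i" if w: "w \<in> U" for w
    proof -
      have inj: "inj_on (\<lambda>D. insert v (insert w D)) (Pow T)"
      proof (rule inj_onI)
        fix D D' assume D: "D \<in> Pow T" "D' \<in> Pow T" "insert v (insert w D) = insert v (insert w D')"
        have "w \<notin> T" using w T(3) unfolding U_def by auto
        then have "D = insert v (insert w D) - {v, w}" "D' = insert v (insert w D') - {v, w}"
          using D v(2) by auto
        then show "D = D'" using D(3) by simp
      qed
      have "(\<Prod>x\<in>G w. pmf (p x) 0) = (\<Prod>D\<in>Pow T. pmf (p (insert v (insert w D))) 0)"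
        unfolding G_def by (subst prod.reindex[OF inj]) simp
      also have "\<dots> = (\<Prod>D\<in>Pow T. exp (- (real N * \<beta> (card D + 2) / real (N choose (card D + 2)))))"
      proof (rule prod.cong[OF refl])
        fix D assume "D \<in> Pow T"
        then have c: "card (insert v (insert w D)) = card D + 2" using cardI[OF w] by simp
        have "0 \<le> real N * \<beta> (card D + 2) / real (N choose (card D + 2))" using \<beta> by simp
        then show "pmf (p (insert v (insert w D))) 0 =
            exp (- (real N * \<beta> (card D + 2) / real (N choose (card D + 2))))"
          unfolding p_def c by (rule pmf_poisson_mean_0)
      qed
      also have "\<dots> = exp (- (\<Sum>D\<in>Pow T. real N * \<beta> (card D + 2) / real (N choose (card D + 2))))"
        using T(1) by (simp add: exp_sum sum_negf[symmetric])
      also have "\<dots> = exp (- edge_rate \<beta> N i)"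
        unfolding sum_Pow_card[OF T(1), of "\<lambda>d. real N * \<beta> (d + 2) / real (N choose (d +
            2))"] edge_rate_def T(2) ..
      finally show ?thesis by (simp add: link_prob_def)
    qed
  qed
  ultimately show ?thesis unfolding hyp_pmf_def S_def p_def by simp
qed

text \<open>The numbered list is carried along because the counts alone do not tell which edges have
  been inspected. For a fixed value of the past, a deterministic family E of edges decides whether
  it occurs, and the next step reads only edges outside E; hence the next count is independent of
  that past.\<close>

lemma child_count_step_law:
  assumes \<beta>: "\<And>j. 2 \<le> j \<Longrightarrow> 0 \<le> \<beta> j" and i: "i < N"
  shows "map_pmf (\<lambda>H. ((bfw_numbered H N i, child_counts H N i), bfw_c H N (Suc i))) (hyp_pmf \<beta> N) =
    bind_pmf (map_pmf (\<lambda>H. (bfw_numbered H N i, child_counts H N i)) (hyp_pmf \<beta> N))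
      (\<lambda>a. map_pmf (Pair a) (binomial_pmf (N - length (fst a)) (link_prob \<beta> N i)))"
proof (rule map_pmf_pair_eq_bind)
  fix a :: "nat list \<times> nat list" and c :: nat
  let ?st = "\<lambda>H. (bfw_numbered H N i, child_counts H N i)"
  define vs where "vs = fst a"
  define S where "S = {A. A \<subseteq> {1..N} \<and> 2 \<le> card A}"
  define E where "E = {A \<in> S. card (A - set (take i vs)) \<le> 1}"
  have fS: "finite S" unfolding S_def by (rule finite_subset[of _ "Pow {1..N}"]) auto
  show "measure_pmf.prob (hyp_pmf \<beta> N) {H. ?st H = a \<and> bfw_c H N (Suc i) = c} =
      measure_pmf.prob (hyp_pmf \<beta> N) {H. ?st H =
          a} * pmf (binomial_pmf (N - length (fst a)) (link_prob \<beta> N i)) c"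
  \<comment> \<open>If no hypergraph produces the pair a, its list need not be a valid numbering;
    both sides are then 0.\<close>
  proof (cases "\<exists>H. ?st H = a")
    case False
    then show ?thesis by simp
  next
    case True
    then obtain H0 where "?st H0 = a" ..
    then have vs: "i < length vs" "set vs \<subseteq> {1..N}" "distinct vs"
      using bfw_numbered_invariant[OF i, of H0] unfolding vs_def by auto
    let ?ch = "\<lambda>H. card (bfw_children H N vs (Suc i))"
    \<comment> \<open>On the event that the past equals a, the random list may be replaced by the
      fixed \<open>vs\<close>.\<close>
    have eq: "{H. ?st H = a \<and> bfw_c H N (Suc i) = c} = {H. ?st H = a \<and> ?ch H = c}"
      unfolding vs_def bfw_c_def by auto
    have "measure_pmf.prob (hyp_pmf \<beta> N) {H. ?st H = a \<and> ?ch H = c} =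
        measure_pmf.prob (hyp_pmf \<beta> N) {H. ?st H = a} * measure_pmf.prob (hyp_pmf \<beta> N) {H. ?ch H = c}"
      unfolding hyp_pmf_def S_def[symmetric]
    proof (rule Pi_pmf_indep_disjoint[OF fS])
      show "E \<subseteq> S" unfolding E_def by auto
    next
      have imp: "?st H' = a" if ag: "\<And>A. A \<in> E \<Longrightarrow> H A = H' A" and "?st H = a" for H H'
      proof -
        have "bfw_numbered H N i = vs" using \<open>?st H = a\<close> unfolding vs_def by auto
        then have "bfw_numbered H' N i = bfw_numbered H N i \<and> child_counts H' N i = child_counts H N i"
          using ag by (intro bfw_history_cong[OF i]) (auto simp: E_def S_def)
        then show ?thesis using \<open>?st H = a\<close> by simp
      qed
      fix H H' :: "nat set \<Rightarrow> nat" assume "\<And>A. A \<in> E \<Longrightarrow> H A = H' A"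
      then show "(?st H = a) = (?st H' = a)" using imp[of H H'] imp[of H' H] by metis
    next
      fix H H' :: "nat set \<Rightarrow> nat" assume ag: "\<And>A. A \<in> S - E \<Longrightarrow> H A = H' A"
      have "H A = H' A" if w: "w \<in> {1..N}" "w \<notin> set vs" and A: "vs ! i \<in> A" "w \<in> A"
        "A - {vs ! i, w} \<subseteq> set (take i vs)" for w A
      proof (rule ag)
        have v: "vs ! i \<in> set vs" "vs ! i \<notin> set (take i vs)"
          using vs by (auto simp: in_set_conv_nth nth_eq_iff_index_eq)
        have sub: "A \<subseteq> {1..N}" using A(3) w(1) v vs(2) set_take_subset[of i vs] by blast
        then have fin: "finite A" by (rule finite_subset) simp
        have "vs ! i \<noteq> w" using v w by metis
        then have c2: "card {vs ! i, w} = 2" by simp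
        then have "2 \<le> card A" using card_mono[OF fin, of "{vs ! i, w}"] A by auto
        moreover have "{vs ! i, w} \<subseteq> A - set (take i vs)" using v w A by (auto dest: in_set_takeD)
        then have "card {vs ! i, w} \<le> card (A - set (take i vs))" using fin by (intro card_mono) simp_all
        then have "2 \<le> card (A - set (take i vs))" using c2 by simp
        ultimately show "A \<in> S - E" unfolding S_def E_def using sub by auto
      qed
      then have "bfw_children H N vs (Suc i) = bfw_children H' N vs (Suc i)"
        by (rule bfw_children_eqI)
      then show "(?ch H = c) = (?ch H' = c)" by simp
    qed
    moreover have "measure_pmf.prob (hyp_pmf \<beta> N) {H. ?ch H = c} = pmf (map_pmf ?ch (hyp_pmf \<beta> N)) c"
      by (simp add: pmf_map vimage_def)
    moreover have "map_pmf ?ch (hyp_pmf \<beta> N) = binomial_pmf (N - length vs) (link_prob \<beta> N i)"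
      by (rule card_children_law[OF \<beta> vs])
    ultimately show ?thesis unfolding eq by (simp add: vs_def)
  qed
qed

text \<open>The numbered list drops out of the transition: the binomial law sees it only through its
  length, which the child counts determine.\<close>

lemma child_counts_law:
  assumes \<beta>: "\<And>j. 2 \<le> j \<Longrightarrow> 0 \<le> \<beta> j"
  shows "i \<le> N \<Longrightarrow> map_pmf (\<lambda>H. child_counts H N i) (hyp_pmf \<beta> N) = walk (child_kernel \<beta> N) i []"
proof (induction i)
  case 0
  show ?case by (simp add: map_pmf_const)
next
  case (Suc i)
  let ?M = "hyp_pmf \<beta> N"
  let ?st = "\<lambda>H. (bfw_numbered H N i, child_counts H N i)"
  have "map_pmf (\<lambda>H. child_counts H N (Suc i)) ?M =
     map_pmf (\<lambda>((vs, cs), c). c # cs) (map_pmf (\<lambda>H. (?st H, bfw_c H N (Suc i))) ?M)"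
    by (simp add: map_pmf_comp)
  also have "\<dots> = bind_pmf (map_pmf ?st ?M)
     (\<lambda>a. map_pmf (\<lambda>c. c # snd a) (binomial_pmf (N - length (fst a)) (link_prob \<beta> N i)))"
    using Suc.prems by (subst child_count_step_law[OF \<beta>]) (simp_all add: map_bind_pmf map_pmf_comp
        case_prod_beta)
  also have "\<dots> = bind_pmf ?M (\<lambda>H. map_pmf (\<lambda>c. c # child_counts H N i)
       (binomial_pmf (N - length (bfw_numbered H N i)) (link_prob \<beta> N i)))"
    by (simp add: bind_map_pmf)
  also have "\<dots> = bind_pmf ?M (\<lambda>H. map_pmf (\<lambda>c. c # child_counts H N i) (child_kernel \<beta> N (child_counts H
      N i)))"
    using Suc.prems bfw_numbered_invariant[of i N] by (simp add: child_kernel_def)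
  also have "\<dots> = bind_pmf (map_pmf (\<lambda>H. child_counts H N i) ?M) (\<lambda>cs. map_pmf (\<lambda>c. c # cs) (child_kernel
      \<beta> N cs))"
    by (simp only: bind_map_pmf)
  also have "\<dots> = bind_pmf (walk (child_kernel \<beta> N) i []) (\<lambda>cs. map_pmf (\<lambda>c. c # cs) (child_kernel \<beta> N
      cs))"
    using Suc by (simp only: Suc_leD)
  also have "\<dots> = walk (child_kernel \<beta> N) (Suc i) []"
    by (simp only: walk_Suc_last)
  finally show ?case .
qed

section \<open>From the stopping time to a hitting probability of the chain\<close>

lemma net_child_counts: "net (child_counts H N i) = real_of_int (bfw_Z H N i)"
  by (induction i) (auto simp: bfw_Z_def)

lemma drop_child_counts: "j \<le> n \<Longrightarrow> drop j (child_counts H N n) = child_counts H N (n - j)"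
proof (induction j arbitrary: n)
  case (Suc j)
  then show ?case by (cases n) auto
qed simp

text \<open>The infimum runs over a finite set of times, so it is attained unless that set is empty.
  The histories \<open>drop j\<close> of the full list run through the times N - j.\<close>

lemma prob_bfw_S_eq_hit:
  assumes \<beta>: "\<And>j. 2 \<le> j \<Longrightarrow> 0 \<le> \<beta> j"
  shows "measure_pmf.prob (hyp_pmf \<beta> N) {H. bfw_S k H N R \<le> ereal x} =
    hit (child_kernel \<beta> N)
      (\<lambda>cs. real N powr alpha k * R\<^sup>2 \<le> real (length cs) \<and> real (length cs) \<le> x \<and> net cs \<le> 0) N []"
proof -
  let ?P = "\<lambda>cs. real N powr alpha k * R\<^sup>2 \<le> real (length cs) \<and> real (length cs) \<le> x \<and> net cs \<le> 0"
  have "bfw_S k H N R \<le> ereal x \<longleftrightarrow> (\<exists>j\<le>N. ?P (drop j (child_counts H N N)))" for H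
  proof -
    let ?I = "{i. i \<le> N \<and> real N powr alpha k * R\<^sup>2 \<le> real i \<and> bfw_Z H N i \<le> 0}"
    have "finite ?I" by simp
    then have fin: "finite ((\<lambda>i. ereal (real i)) ` ?I)" by (rule finite_imageI)
    have "bfw_S k H N R \<le> ereal x \<longleftrightarrow> (\<exists>i\<in>?I. real i \<le> x)"
    proof
      assume S: "bfw_S k H N R \<le> ereal x"
      \<comment> \<open>An empty set of times has infimum infinity and cannot satisfy the
        bound.\<close>
      have ne: "(\<lambda>i. ereal (real i)) ` ?I \<noteq> {}"
      proof
        assume "(\<lambda>i. ereal (real i)) ` ?I = {}"
        then have "bfw_S k H N R = \<infinity>" unfolding bfw_S_def by (simp only: Inf_empty top_ereal_def)
        then show False using S by simp
      qed
      have "bfw_S k H N R \<in> (\<lambda>i. ereal (real i)) ` ?I"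
        unfolding bfw_S_def Min_Inf[OF fin ne, symmetric] by (rule Min_in[OF fin ne])
      then show "\<exists>i\<in>?I. real i \<le> x" using S by auto
    next
      assume "\<exists>i\<in>?I. real i \<le> x"
      then obtain i where i: "i \<in> ?I" "real i \<le> x" ..
      have "bfw_S k H N R \<le> ereal (real i)" unfolding bfw_S_def using i(1) by (intro Inf_lower) auto
      also have "\<dots> \<le> ereal x" using i by simp
      finally show "bfw_S k H N R \<le> ereal x" .
    qed
    also have "\<dots> \<longleftrightarrow> (\<exists>i\<le>N. ?P (child_counts H N i))"
      by (auto simp: net_child_counts)
    also have "\<dots> \<longleftrightarrow> (\<exists>j\<le>N. ?P (child_counts H N (N - j)))"
      by (metis diff_diff_cancel diff_le_self)
    finally show ?thesis by (simp add: drop_child_counts cong: conj_cong)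
  qed
  then have "{H. bfw_S k H N R \<le> ereal x} =
      (\<lambda>H. child_counts H N N) -` {ys. \<exists>j\<le>N. ?P (drop j ys)}" by auto
  then have "measure_pmf.prob (hyp_pmf \<beta> N) {H. bfw_S k H N R \<le> ereal x} =
      measure_pmf.prob (map_pmf (\<lambda>H. child_counts H N N) (hyp_pmf \<beta> N)) {ys. \<exists>j\<le>N. ?P (drop j ys)}"
    by (simp only: measure_map_pmf)
  also have "\<dots> = hit (child_kernel \<beta> N) ?P N []"
    unfolding hit_eq_prob by (simp only: child_counts_law[OF \<beta> order_refl])
  finally show ?thesis .
qed

section \<open>Asymptotics of the drift\<close>

text \<open>With both binomial coefficients written as falling factorials, N (N - 1) cancels and the
  factorials leave (d + 2)(d + 1). The remaining product is a perturbation of (i/N)^d.\<close>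

lemma mult_edge_rate_term:
  assumes "2 \<le> N"
  shows "(real N - 1) * (real (i choose d) * (real N * b / real (N choose (d + 2)))) =
    (real d + 2) * (real d + 1) * b * (\<Prod>l<d. (real i - real l) / (real N - 2 - real l))"
proof -
  let ?P = "\<Prod>l<d. real i - real l" and ?Q = "\<Prod>l<d. real N - 2 - real l"
  have i: "real (i choose d) = ?P / fact d"
    by (simp add: binomial_gbinomial gbinomial_prod_rev atLeast0LessThan)
  have "real (N choose (d + 2)) = (\<Prod>l<Suc (Suc d). real N - real l) / fact (d + 2)"
    by (simp only: binomial_gbinomial gbinomial_prod_rev atLeast0LessThan add_2_eq_Suc')
  also have "(\<Prod>l<Suc (Suc d). real N - real l) = real N * (real N - 1) * ?Q"
    by (simp only: prod.lessThan_Suc_shift) (simp add: algebra_simps)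
  also have "fact (d + 2) = (real d + 2) * (real d + 1) * fact d"
    by (simp add: algebra_simps)
  finally have n: "real (N choose (d + 2)) =
      real N * (real N - 1) * ?Q / ((real d + 2) * (real d + 1) * fact d)" .
  have q: "(\<Prod>l<d. (real i - real l) / (real N - 2 - real l)) = ?P / ?Q"
    by (rule prod_dividef)
  \<comment> \<open>Q may vanish: for d + 2 > N the coefficient \<open>N choose (d + 2)\<close> is 0
    as well, and division by zero makes both sides 0.\<close>
  have "(m - 1) * (P / F * (m * b / (m * (m - 1) * Q / (A * F)))) = A * b * (P / Q)"
    if "m \<noteq> 0" "m - 1 \<noteq> 0" "F \<noteq> 0" for m P Q F A :: real
    using that by simp
  from this[of "real N" "fact d" ?P ?Q "(real d + 2) * (real d + 1)"] show ?thesis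
    unfolding i n q using assms by simp
qed

lemma exp_minus_bounds:
  fixes x :: real
  assumes "0 \<le> x"
  shows "1 - exp (- x) \<le> x" "x - x\<^sup>2 \<le> 1 - exp (- x)"
proof -
  show "1 - exp (- x) \<le> x" using exp_ge_add_one_self[of "- x"] by simp
  show "x - x\<^sup>2 \<le> 1 - exp (- x)"
  proof (cases "x \<le> 1")
    case True
    have "exp (- x) = 1 / exp x" by (simp add: exp_minus inverse_eq_divide)
    also have "\<dots> \<le> 1 / (1 + x)" using exp_ge_add_one_self[of x] assms by (intro divide_left_mono) auto
    also have "\<dots> \<le> 1 - x + x\<^sup>2"
      using assms by (simp add: field_simps power2_eq_square)
    finally show ?thesis by simp
  next
    case False
    then have "x - x\<^sup>2 \<le> 0" by (simp add: power2_eq_square)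
    moreover have "exp (- x) \<le> 1" using assms by simp
    ultimately show ?thesis by linarith
  qed
qed

text \<open>For i at most N/2 each factor is at most i/(N - 2), and N at least 8 gives N/(N - 2) at
  most 4/3. The base is then at most 2/3, which means geometric decay in d.\<close>

lemma prod_shifted_ratio_bounds:
  fixes i d N :: nat
  assumes "d \<le> i" "2 * i \<le> N" "8 \<le> N"
  shows "0 \<le> (\<Prod>l<d. (real i - real l) / (real N - 2 - real l))"
    and "(\<Prod>l<d. (real i - real l) / (real N - 2 - real l)) \<le> (4 / 3 * (real i / real N)) ^ d"
proof -
  have f: "0 \<le> (real i - real l) / (real N - 2 - real l)"
    "(real i - real l) / (real N - 2 - real l) \<le> 4 / 3 * (real i / real N)" if "l < d" for l
  proof -
    have l: "real l + 1 \<le> real i" using that assms(1) by simp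
    have i: "2 * real i \<le> real N" using assms(2) by linarith
    have N: "8 \<le> real N" using assms(3) by simp
    have pos: "0 < real N - 2 - real l" using l i N by linarith
    show "0 \<le> (real i - real l) / (real N - 2 - real l)" using l pos by simp
    have "(real i - real l) / (real N - 2 - real l) \<le> real i / (real N - 2)"
    proof -
      have "(real i - real l) * (real N - 2) \<le> real i * (real N - 2 - real l)"
        using l i N mult_left_mono[of "real i" "real N - 2" "real l"] by (simp add: algebra_simps)
      then show ?thesis using pos N by (simp add: field_simps)
    qed
    also have "\<dots> \<le> 4 / 3 * (real i / real N)"
      using N l by (simp add: field_simps)
    finally show "(real i - real l) / (real N - 2 - real l) \<le> 4 / 3 * (real i / real N)" .
  qed
  show "0 \<le> (\<Prod>l<d. (real i - real l) / (real N - 2 - real l))"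
    by (rule prod_nonneg) (use f in auto)
  have "(\<Prod>l<d. (real i - real l) / (real N - 2 - real l)) \<le> (\<Prod>l<d. 4 / 3 * (real i / real N))"
    by (rule prod_mono) (use f in auto)
  then show "(\<Prod>l<d. (real i - real l) / (real N - 2 - real l)) \<le> (4 / 3 * (real i / real N)) ^ d"
    by simp
qed

text \<open>Products of factors of modulus at most 1 differ by no more than the sum of the
  differences of their factors, here O(k/N) each. Nothing orders d and i, so factors may be
  negative.\<close>

lemma prod_shifted_ratio_approx:
  fixes i d k N :: nat
  assumes "d + 2 \<le> k" "2 * i \<le> N" "2 * k \<le> N"
  shows "\<bar>(\<Prod>l<d. (real i - real l) / (real N - 2 - real l)) - (real i / real N) ^ d\<bar> \<le>
      2 * (real k)\<^sup>2 / real N"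
proof -
  have f: "\<bar>(real i - real l) / (real N - 2 - real l)\<bar> \<le> 1"
     "\<bar>(real i - real l) / (real N - 2 - real l) - real i / real N\<bar> \<le> 2 * real k / real N"
    if "l < d" for l
  proof -
    have l: "real l + 3 \<le> real k" using that assms(1) by simp
    have i: "2 * real i \<le> real N" and k: "2 * real k \<le> real N" using assms(2,3) by linarith+
    have half: "real N / 2 \<le> real N - 2 - real l" using l k by linarith
    have N: "0 < real N" using l k by linarith
    have pos: "0 < real N - 2 - real l" using half N by linarith
    show "\<bar>(real i - real l) / (real N - 2 - real l)\<bar> \<le> 1"
      using pos l i k by (simp add: abs_divide divide_le_eq abs_le_iff)
    have "(real i - real l) / (real N - 2 - real l) - real i / real N =
       (real i * (2 + real l) - real N * real l) / (real N * (real N - 2 - real l))"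
      using N pos by (simp add: field_simps)
    also have "\<bar>\<dots>\<bar> = \<bar>real i * (2 + real l) - real N * real l\<bar> / (real N * (real N - 2 - real l))"
      using N pos by (simp add: abs_divide abs_mult)
    also have "\<dots> \<le> (real N * real k) / (real N * (real N - 2 - real l))"
    proof (rule divide_right_mono)
      have "real i * (2 + real l) \<le> real N * (2 + real l)" using i by (intro mult_right_mono) auto
      also have "\<dots> \<le> real N * real k" using l N by (intro mult_left_mono) auto
      finally have 1: "real i * (2 + real l) \<le> real N * real k" .
      have 2: "real N * real l \<le> real N * real k" using l N by (intro mult_left_mono) auto
      have "0 \<le> real i * (2 + real l)" "0 \<le> real N * real l" by auto
      then show "\<bar>real i * (2 + real l) - real N * real l\<bar> \<le> real N * real k" using 1 2 by linarith
      show "0 \<le> real N * (real N - 2 - real l)" using N pos by simp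
    qed
    also have "\<dots> = real k / (real N - 2 - real l)" using N by simp
    also have "\<dots> \<le> real k / (real N / 2)" using half N by (intro divide_left_mono) auto
    finally show "\<bar>(real i - real l) / (real N - 2 - real l) - real i / real N\<bar> \<le> 2 * real k / real N"
      by (simp add: field_simps)
  qed
  have "\<bar>(\<Prod>l<d. (real i - real l) / (real N - 2 - real l)) - (\<Prod>l<d. real i / real N)\<bar> \<le>
     (\<Sum>l<d. \<bar>(real i - real l) / (real N - 2 - real l) - real i / real N\<bar>)"
    using norm_prod_diff[of "{..<d}" "\<lambda>l. (real i - real l) / (real N - 2 -
        real l)" "\<lambda>l. real i / real N"]
      f(1) assms by (auto simp: divide_le_eq)
  also have "\<dots> \<le> (\<Sum>l<d. 2 * real k / real N)" by (intro sum_mono) (use f in auto)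
  also have "\<dots> \<le> real k * (2 * real k / real N)"
    using assms by (simp add: mult_right_mono divide_right_mono)
  finally show ?thesis by (simp add: power2_eq_square mult_ac)
qed

text \<open>The conditional mean step of the walk when the queue is empty; a queue of length q
  lowers it by at most q times \<open>link_prob\<close>.\<close>

definition drift :: "(nat \<Rightarrow> real) \<Rightarrow> nat \<Rightarrow> nat \<Rightarrow> real" where
  "drift \<beta> N i = real (N - Suc i) * link_prob \<beta> N i - 1"

locale critical_weights =
  fixes k :: nat and \<beta> :: "nat \<Rightarrow> real"
  assumes k3: "3 \<le> k"
    and nonneg: "\<And>j. 2 \<le> j \<Longrightarrow> 0 \<le> \<beta> j"
    and summ: "summable (\<lambda>j. real j * \<beta> j)"
    and crit: "\<And>j. 2 \<le> j \<Longrightarrow> j \<le> k - 1 \<Longrightarrow> \<beta> j = 1 / (real j * (real j - 1))"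
    and supercrit: "\<beta> k > 1 / (real k * (real k - 1))"
begin

text \<open>The relative surplus of k-edges over their critical weight; it is the c in the drift c
  x^(k-2).\<close>

definition excess :: real where "excess = real k * (real k - 1) * \<beta> k - 1"

lemma excess_pos: "0 < excess"
proof -
  have "0 < real k * (real k - 1)" using k3 by simp
  then show ?thesis using supercrit by (simp add: excess_def divide_less_eq mult.commute)
qed

lemma edge_rate_nonneg: "0 \<le> edge_rate \<beta> N i"
  unfolding edge_rate_def using nonneg by (intro sum_nonneg mult_nonneg_nonneg divide_nonneg_nonneg) auto

lemma link_prob_in_01: "link_prob \<beta> N i \<in> {0..1}"
  by (rule link_prob_01[OF nonneg])

text \<open>Taylor coefficients at 0 of the second derivative of beta(t). Criticality up to j = k -
  1 says that they agree with those of 1/(1 - x) up to d = k - 3.\<close>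

abbreviation \<gamma> :: "nat \<Rightarrow> real" where
  "\<gamma> d \<equiv> (real d + 2) * (real d + 1) * \<beta> (d + 2)"

text \<open>Summability of j beta_j is one factor d + 1 short of summing these coefficients; the
  geometric weight absorbs it because (d + 1)(2/3)^d is bounded.\<close>

lemma sum_gamma_geometric_bounded:
  "\<exists>C\<ge>0. \<forall>F. finite F \<longrightarrow> (\<Sum>d\<in>F. \<gamma> d * (2 / 3) ^ d) \<le> C"
proof -
  have "(\<lambda>d. (real d + 1) * (2 / 3) ^ d :: real) \<longlonglongrightarrow> 0" by real_asymp
  then have "Bseq (\<lambda>d. (real d + 1) * (2 / 3) ^ d :: real)"
    using Bseq_eq_bounded convergent_imp_Bseq convergentI by blast
  then obtain B where B: "0 < B" "\<And>d. norm ((real d + 1) * (2 / 3) ^ d :: real) \<le> B"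
    by (auto simp: Bseq_def)
  have s: "summable (\<lambda>d. (real d + 2) * \<beta> (d + 2))"
    using summable_ignore_initial_segment[OF summ, of 2] by (simp add: add_ac)
  let ?G = "\<Sum>d. (real d + 2) * \<beta> (d + 2)"
  have nn: "0 \<le> (real d + 2) * \<beta> (d + 2)" for d using nonneg by simp
  show ?thesis
  proof (intro exI conjI allI impI)
    show "0 \<le> B * ?G" using B(1) suminf_nonneg[OF s nn] by simp
    fix F :: "nat set" assume F: "finite F"
    have "(\<Sum>d\<in>F. \<gamma> d * (2 / 3) ^ d) \<le> (\<Sum>d\<in>F. B * ((real d + 2) * \<beta> (d + 2)))"
    proof (rule sum_mono)
      fix d
      have "\<gamma> d * (2 / 3) ^ d = ((real d + 1) * (2 / 3) ^ d) * ((real d + 2) * \<beta> (d + 2))"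
          by (simp add: algebra_simps)
      also have "\<dots> \<le> B * ((real d + 2) * \<beta> (d + 2))"
        using B(2)[of d] nn by (intro mult_right_mono) auto
      finally show "\<gamma> d * (2 / 3) ^ d \<le> B * ((real d + 2) * \<beta> (d + 2))" .
    qed
    also have "\<dots> = B * (\<Sum>d\<in>F. (real d + 2) * \<beta> (d + 2))" by (simp add: sum_distrib_left)
    also have "\<dots> \<le> B * ?G" using B(1) sum_le_suminf[OF s F] nn by (intro mult_left_mono) auto
    finally show "(\<Sum>d\<in>F. \<gamma> d * (2 / 3) ^ d) \<le> B * ?G" .
  qed
qed

lemma gamma_crit:
  assumes "d + 3 \<le> k"
  shows "\<gamma> d = 1"
proof -
  have "d + 2 \<le> k - 1" using assms by simp
  then have "\<beta> (d + 2) = 1 / (real (d + 2) * (real (d + 2) - 1))" by (intro crit) simp_all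
  also have "real (d + 2) = real d + 2" by simp
  also have "real d + 2 - 1 = real d + 1" by simp
  finally have "\<beta> (d + 2) = 1 / ((real d + 2) * (real d + 1))" .
  moreover have "(real d + 2) * (real d + 1) > 0" by (intro mult_pos_pos) auto
  ultimately show ?thesis by simp
qed

lemma gamma_supercrit: "\<gamma> (k - 2) = 1 + excess"
proof -
  have "k - 2 + 2 = k" "real (k - 2) = real k - 2" using k3 by auto
  then show ?thesis by (simp only: excess_def) (simp add: algebra_simps)
qed

text \<open>Up to d = k - 2 the products are replaced by powers of x at a cost O(1/N), and there all
  coefficients but the last equal 1. The tail from k - 1 on is O(x^(k-1)) by geometric
  decay.\<close>

lemma edge_rate_expansion:
  "\<exists>C\<ge>0. \<forall>N i. 2 * k + 8 \<le> N \<longrightarrow> 2 * i \<le> N \<longrightarrow>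
     \<bar>(real N - 1) * edge_rate \<beta> N i - ((\<Sum>d\<le>k - 2. (real i / real N) ^ d) + excess *
         (real i / real N) ^ (k - 2))\<bar>
       \<le> C * ((real i / real N) ^ (k - 1) + 1 / real N)"
proof -
  obtain C0 where C0: "C0 \<ge> 0" "\<And>F. finite F \<Longrightarrow> (\<Sum>d\<in>F. \<gamma> d * (2 / 3) ^ d) \<le> C0"
    using sum_gamma_geometric_bounded by blast
  define C1 where "C1 = (\<Sum>d\<le>k - 2. \<gamma> d) * (2 * (real k)\<^sup>2)"
  define C where "C = C0 * 2 ^ (k - 1) + C1"
  have \<gamma>0: "0 \<le> \<gamma> d" for d using nonneg by simp
  have C1: "0 \<le> C1" unfolding C1_def by (intro mult_nonneg_nonneg sum_nonneg \<gamma>0) auto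
  show ?thesis
  proof (intro exI[of _ C] conjI allI impI)
    show "0 \<le> C" unfolding C_def using C0 C1 by simp
    fix N i :: nat assume N: "2 * k + 8 \<le> N" and i: "2 * i \<le> N"
    define x where "x = real i / real N"
    define r where "r = (\<lambda>d. \<Prod>l<d. (real i - real l) / (real N - 2 - real l))"
    have x: "0 \<le> x" "x \<le> 1 / 2" using N i by (auto simp: x_def field_simps)
    have r0: "r d = 0" if "i < d" for d
      unfolding r_def using that by (intro prod_zero) auto
    have "(real N - 1) * edge_rate \<beta> N i = (\<Sum>d\<le>i. \<gamma> d * r d)"
      unfolding edge_rate_def sum_distrib_left r_def using N
          by (intro sum.cong refl mult_edge_rate_term) auto
    \<comment> \<open>Terms with d > i vanish; the longer range makes the split at k - 2 available
      also when i is small.\<close>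
    also have "\<dots> = (\<Sum>d\<le>max i (k - 2). \<gamma> d * r d)"
      by (intro sum.mono_neutral_left) (auto simp: r0)
    also have "\<dots> = (\<Sum>d\<le>k - 2. \<gamma> d * r d) + (\<Sum>d\<in>{k - 1..max i (k - 2)}. \<gamma> d * r d)"
    proof -
      have "{..max i (k - 2)} = {..k - 2} \<union> {k - 1..max i (k - 2)}" using k3 by auto
      moreover have "{..k - 2} \<inter> {k - 1..max i (k - 2)} = {}" using k3 by auto
      ultimately show ?thesis by (simp add: sum.union_disjoint)
    qed
    finally have split: "(real N - 1) * edge_rate \<beta> N i =
       (\<Sum>d\<le>k - 2. \<gamma> d * r d) + (\<Sum>d\<in>{k - 1..max i (k - 2)}. \<gamma> d * r d)" .
    have rb: "0 \<le> r d" "r d \<le> (4 / 3 * x) ^ d" if "d \<le> i" for d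
      using prod_shifted_ratio_bounds[OF that i] N unfolding r_def x_def by auto
    have hi: "0 \<le> (\<Sum>d\<in>{k - 1..max i (k - 2)}. \<gamma> d * r d)"
      "(\<Sum>d\<in>{k - 1..max i (k - 2)}. \<gamma> d * r d) \<le> C0 * 2 ^ (k - 1) * x ^ (k - 1)"
    proof -
      have b: "0 \<le> \<gamma> d * r d \<and> \<gamma> d * r d \<le> 2 ^ (k - 1) * x ^ (k - 1) * (\<gamma> d * (2 / 3) ^ d)"
        if d: "d \<in> {k - 1..max i (k - 2)}" for d
      proof -
        have "d \<le> i" "k - 1 \<le> d" using d k3 by auto
        \<comment> \<open>Since 4/3 is twice 2/3, the first k - 1 factors give 2^(k-1) x^(k-1)
          (2/3)^(k-1); each of the others is at most 2/3 because x is at most 1/2.\<close>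
        have "(4 / 3 * x) ^ d = (4 / 3 * x) ^ (k - 1) * (4 / 3 * x) ^ (d - (k - 1))"
          using \<open>k - 1 \<le> d\<close> by (simp flip: power_add)
        also have "\<dots> \<le> (4 / 3 * x) ^ (k - 1) * (2 / 3) ^ (d - (k - 1))"
          using x by (intro mult_left_mono power_mono) auto
        also have "\<dots> = 2 ^ (k - 1) * x ^ (k - 1) * ((2 / 3) ^ (k - 1) * (2 / 3) ^ (d - (k - 1)))"
        proof -
          have "4 / 3 * x = 2 * x * (2 / 3)" by simp
          then have "(4 / 3 * x) ^ (k - 1) = 2 ^ (k - 1) * x ^ (k - 1) * (2 / 3) ^ (k - 1)"
            by (simp only: power_mult_distrib)
          then show ?thesis by (simp only: mult.assoc)
        qed
        also have "(2 / 3 :: real) ^ (k - 1) * (2 / 3) ^ (d - (k - 1)) = (2 / 3) ^ d"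
          using \<open>k - 1 \<le> d\<close> by (simp flip: power_add)
        finally have "r d \<le> 2 ^ (k - 1) * x ^ (k - 1) * (2 / 3) ^ d" using rb(2)[OF \<open>d \<le> i\<close>] by simp
        then have "\<gamma> d * r d \<le> \<gamma> d * (2 ^ (k - 1) * x ^ (k - 1) * (2 / 3) ^ d)"
          by (rule mult_left_mono[OF _ \<gamma>0])
        moreover have "0 \<le> \<gamma> d * r d" by (rule mult_nonneg_nonneg[OF \<gamma>0 rb(1)[OF \<open>d \<le> i\<close>]])
        ultimately show ?thesis by (simp add: mult_ac)
      qed
      show "0 \<le> (\<Sum>d\<in>{k - 1..max i (k - 2)}. \<gamma> d * r d)" using b by (intro sum_nonneg) auto
      have "(\<Sum>d\<in>{k - 1..max i (k - 2)}. \<gamma> d * r d) \<le>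
          (\<Sum>d\<in>{k - 1..max i (k - 2)}. 2 ^ (k - 1) * x ^ (k - 1) * (\<gamma> d * (2 / 3) ^ d))"
        using b by (intro sum_mono) auto
      also have "\<dots> = 2 ^ (k - 1) * x ^ (k - 1) * (\<Sum>d\<in>{k - 1..max i (k - 2)}. \<gamma> d * (2 / 3) ^ d)"
        by (simp add: sum_distrib_left)
      also have "\<dots> \<le> 2 ^ (k - 1) * x ^ (k - 1) * C0"
        using x C0 by (intro mult_left_mono) auto
      finally show "(\<Sum>d\<in>{k - 1..max i (k - 2)}. \<gamma> d * r d) \<le> C0 * 2 ^ (k - 1) * x ^ (k - 1)"
        by (simp add: mult_ac)
    qed
    have main: "(\<Sum>d\<le>k - 2. x ^ d) + excess * x ^ (k - 2) = (\<Sum>d\<le>k - 2. \<gamma> d * x ^ d)"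
    proof -
      obtain m where m: "k = m + 3" using k3 by (metis add.commute le_Suc_ex)
      have "(\<Sum>d\<le>k - 2. \<gamma> d * x ^ d) = (\<Sum>d\<le>m. \<gamma> d * x ^ d) + \<gamma> (k - 2) * x ^ (k - 2)"
        unfolding m by (simp add: numeral_3_eq_3)
      also have "(\<Sum>d\<le>m. \<gamma> d * x ^ d) = (\<Sum>d\<le>m. x ^ d)"
      proof (intro sum.cong refl)
        fix d assume "d \<in> {..m}"
        then have "d + 3 \<le> k" using m by simp
        then show "\<gamma> d * x ^ d = x ^ d" by (simp only: gamma_crit mult_1_left)
      qed
      finally show ?thesis
        unfolding gamma_supercrit unfolding m by (simp add: numeral_3_eq_3 algebra_simps)
    qed
    have lo: "\<bar>(\<Sum>d\<le>k - 2. \<gamma> d * r d) - (\<Sum>d\<le>k - 2. \<gamma> d * x ^ d)\<bar> \<le> C1 / real N"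
    proof -
      have "\<bar>(\<Sum>d\<le>k - 2. \<gamma> d * r d) - (\<Sum>d\<le>k - 2. \<gamma> d * x ^ d)\<bar> \<le> (\<Sum>d\<le>k - 2. \<bar>\<gamma> d * r d - \<gamma> d * x ^ d\<bar>)"
        by (simp add: sum_subtractf[symmetric] sum_abs)
      also have "\<dots> \<le> (\<Sum>d\<le>k - 2. \<gamma> d * (2 * (real k)\<^sup>2 / real N))"
      proof (rule sum_mono)
        fix d assume "d \<in> {..k - 2}"
        then have "\<bar>r d - x ^ d\<bar> \<le> 2 * (real k)\<^sup>2 / real N"
          unfolding r_def x_def using i N k3 by (intro prod_shifted_ratio_approx) auto
        then have "\<gamma> d * \<bar>r d - x ^ d\<bar> \<le> \<gamma> d * (2 * (real k)\<^sup>2 / real N)"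
            by (rule mult_left_mono[OF _ \<gamma>0])
        moreover have "\<bar>\<gamma> d * r d - \<gamma> d * x ^ d\<bar> = \<gamma> d * \<bar>r d - x ^ d\<bar>"
          by (simp only: right_diff_distrib[symmetric] abs_mult[of "\<gamma> d"] abs_of_nonneg[OF \<gamma>0])
        ultimately show "\<bar>\<gamma> d * r d - \<gamma> d * x ^ d\<bar> \<le> \<gamma> d * (2 * (real k)\<^sup>2 / real N)" by simp
      qed
      finally show ?thesis by (simp add: C1_def sum_distrib_right sum_divide_distrib)
    qed
    have "\<bar>(real N - 1) * edge_rate \<beta> N i - ((\<Sum>d\<le>k - 2. x ^ d) + excess * x ^ (k - 2))\<bar>
       \<le> C1 / real N + C0 * 2 ^ (k - 1) * x ^ (k - 1)"
      unfolding main split using lo hi by linarith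
    also have "\<dots> \<le> C * (x ^ (k - 1) + 1 / real N)"
    proof -
      have "0 \<le> C1 * x ^ (k - 1)" "0 \<le> C0 * 2 ^ (k - 1) * (1 / real N)" using C0 C1 x by simp_all
      then show ?thesis unfolding C_def by (simp add: algebra_simps)
    qed
    finally show "\<bar>(real N - 1) * edge_rate \<beta> N i - ((\<Sum>d\<le>k - 2. (real i / real N) ^ d) +
       excess * (real i / real N) ^ (k - 2))\<bar> \<le> C * ((real i / real N) ^ (k - 1) + 1 / real N)"
      unfolding x_def .
  qed
qed

text \<open>The un-numbered vertices contribute a factor 1 - x, which turns the geometric sum of the
  critical part into 1 - x^(k-1). So the mean number of children is 1 plus the surplus term, up to
  O(x^(k-1) + 1/N).\<close>

lemma drift_estimate:
  "\<exists>C>0. \<exists>N0. \<forall>N i. N0 \<le> N \<longrightarrow> 2 * i \<le> N \<longrightarrow>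
     \<bar>drift \<beta> N i - excess * (real i / real N) ^ (k - 2)\<bar> \<le>
         C * ((real i / real N) ^ (k - 1) + 1 / real N) \<and>
     real N * link_prob \<beta> N i \<le> C"
proof -
  obtain C1 where C1: "0 \<le> C1" "\<And>N i. 2 * k + 8 \<le> N \<Longrightarrow> 2 * i \<le> N \<Longrightarrow>
     \<bar>(real N - 1) * edge_rate \<beta> N i - ((\<Sum>d\<le>k - 2. (real i / real N) ^ d) + excess *
         (real i / real N) ^ (k - 2))\<bar>
       \<le> C1 * ((real i / real N) ^ (k - 1) + 1 / real N)"
    using edge_rate_expansion by blast
  \<comment> \<open>\<open>C2\<close> bounds N - 1 times \<open>edge_rate\<close>: the geometric sum
    has k - 1 terms, each at most 1, and the error factor x^(k-1) + 1/N is at most 2.\<close>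
  define C2 where "C2 = 2 * C1 + real k + excess"
  define C where "C = C1 + 1 + excess + 2 * C2 + 2 * C2\<^sup>2"
  have C2: "0 < C2" unfolding C2_def using C1(1) excess_pos k3 by simp
  show ?thesis
  proof (intro exI[of _ C] exI[of _ "2 * k + 8"] conjI allI impI)
    show "0 < C" unfolding C_def using C1(1) excess_pos C2 by (simp add: add_pos_nonneg)
  next
    fix N i :: nat assume N: "2 * k + 8 \<le> N" and i: "2 * i \<le> N"
    define x where "x = real i / real N"
    define D where "D = (real N - 1) * edge_rate \<beta> N i"
    define l where "l = edge_rate \<beta> N i"
    define p where "p = link_prob \<beta> N i"
    define G where "G = (\<Sum>d\<le>k - 2. x ^ d)"
    have N': "8 \<le> real N" using N by simp
    have ix: "real i = x * real N" using N' by (simp add: x_def)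
    have x: "0 \<le> x" "x \<le> 1 / 2" using N i by (auto simp: x_def field_simps)
    have xp: "0 \<le> x ^ m" "x ^ m \<le> 1" for m using x by (auto intro: power_le_one)
    have D: "\<bar>D - (G + excess * x ^ (k - 2))\<bar> \<le> C1 * (x ^ (k - 1) + 1 / real N)"
      using C1(2)[OF N i] unfolding D_def G_def x_def .
    have l0: "0 \<le> l" unfolding l_def by (rule edge_rate_nonneg)
    have Dl: "D = (real N - 1) * l" by (simp add: D_def l_def)
    have D0: "0 \<le> D" using l0 N' by (simp add: Dl)
    have D2: "D \<le> C2"
    proof -
      have "G \<le> (\<Sum>d\<le>k - 2. 1)" unfolding G_def by (intro sum_mono xp)
      also have "\<dots> \<le> real k" using k3 by simp
      finally have "G \<le> real k" .
      moreover have "excess * x ^ (k - 2) \<le> excess" using xp excess_pos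
          by (simp add: mult_le_cancel_left1)
      moreover have "1 / real N \<le> 1" using N' by simp
      then have "x ^ (k - 1) + 1 / real N \<le> 2" using xp(2)[of "k - 1"] by linarith
      then have "C1 * (x ^ (k - 1) + 1 / real N) \<le> C1 * 2" by (rule mult_left_mono[OF _ C1(1)])
      ultimately show ?thesis using D unfolding C2_def by linarith
    qed
    have p: "p \<le> l" "l - l\<^sup>2 \<le> p" "0 \<le> p"
      using exp_minus_bounds[OF l0] link_prob_in_01[of N i] unfolding p_def link_prob_def l_def by auto
    have G1: "(1 - x) * G = 1 - x ^ (k - 1)"
    proof -
      have "Suc (k - 2) = k - 1" using k3 by simp
      then show ?thesis
        using sum_gp_basic[of x "k - 2"] unfolding G_def by simp
    qed
    have lN: "l * real N \<le> 2 * C2"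
    proof -
      have "l * real N \<le> l * (2 * (real N - 1))" using l0 N' by (intro mult_left_mono) auto
      also have "\<dots> = 2 * D" by (simp add: Dl)
      finally show ?thesis using D2 by simp
    qed
    have n: "real (N - Suc i) = real N - 1 - real i" using N i by (simp add: of_nat_diff)
    \<comment> \<open>Since i = x N, the number N - 1 - i falls short of (N - 1)(1 - x) by x
      only.\<close>
    have a1: "\<bar>(real N - 1 - real i) * l - D * (1 - x)\<bar> \<le> C2 / real N"
    proof -
      have eq: "(real N - 1 - real i) * l - D * (1 - x) = - (x * l)"
        unfolding Dl ix by (simp add: algebra_simps)
      have "x * l \<le> (1 / 2) * l" using x l0 by (intro mult_right_mono) auto
      moreover have "l \<le> 2 * C2 / real N" using lN N' by (simp add: pos_le_divide_eq)
      ultimately have "x * l \<le> C2 / real N" by linarith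
      moreover have "0 \<le> x * l" using x l0 by simp
      ultimately show ?thesis unfolding eq by simp
    qed
    \<comment> \<open>Replacing the rate l by the probability 1 - exp(-l) costs at most l^2 per
      vertex, and l is O(1/N).\<close>
    have a2: "(real N - 1 - real i) * l - (real N - 1 - real i) * p \<le> 2 * C2\<^sup>2 / real N"
      "0 \<le> (real N - 1 - real i) * l - (real N - 1 - real i) * p"
    proof -
      have pos: "0 \<le> real N - 1 - real i" using ix x N i by linarith
      have "(real N - 1 - real i) * (l - p) \<le> (real N - 1 - real i) * l\<^sup>2"
        using p pos by (intro mult_left_mono) auto
      also have "\<dots> \<le> (real N - 1) * l\<^sup>2" by (intro mult_right_mono) auto
      also have "\<dots> = D * l" by (simp add: Dl power2_eq_square)
      also have "\<dots> \<le> C2 * l" using D2 l0 by (intro mult_right_mono) auto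
      also have "\<dots> \<le> C2 * (2 * C2 / real N)"
        using lN N' C2 by (intro mult_left_mono) (auto simp: field_simps)
      finally show "(real N - 1 - real i) * l - (real N - 1 - real i) * p \<le> 2 * C2\<^sup>2 / real N"
        by (simp add: algebra_simps power2_eq_square)
      have "0 \<le> (real N - 1 - real i) * (l - p)" using p pos by simp
      then show "0 \<le> (real N - 1 - real i) * l - (real N - 1 - real i) * p" by (simp add: algebra_simps)
    qed
    have a3: "\<bar>D * (1 - x) - (1 + excess * x ^ (k - 2))\<bar> \<le>
        (C1 + 1 + excess) * (x ^ (k - 1) + 1 / real N)"
    proof -
      have Sk: "x * x ^ (k - 2) = x ^ (k - 1)" 
      proof -
        have "Suc (k - 2) = k - 1" using k3 by simp
        then show ?thesis by (simp only: power_Suc[symmetric])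
      qed
      have "D * (1 - x) - (1 + excess * x ^ (k - 2)) =
        (D - (G + excess * x ^ (k - 2))) * (1 - x) - (1 + excess) * x ^ (k - 1)"
        using G1 unfolding Sk[symmetric] by (simp add: algebra_simps)
      moreover have "\<bar>(D - (G + excess * x ^ (k - 2))) * (1 - x)\<bar> \<le> C1 * (x ^ (k - 1) + 1 / real N)"
      proof -
        have "\<bar>(D - (G + excess * x ^ (k - 2))) * (1 - x)\<bar> \<le> \<bar>D - (G + excess * x ^ (k - 2))\<bar> * 1"
          unfolding abs_mult using x by (intro mult_left_mono) auto
        then show ?thesis using D by simp
      qed
      moreover have "0 \<le> (1 + excess) * x ^ (k - 1)" "0 \<le> (1 + excess) * (1 / real N)"
        using excess_pos xp[of "k - 1"] by simp_all
      ultimately have "\<bar>D * (1 - x) - (1 + excess * x ^ (k - 2))\<bar> \<le>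
         C1 * (x ^ (k - 1) + 1 / real N) + (1 + excess) * x ^ (k - 1) + (1 + excess) * (1 / real N)"
        by linarith
      also have "\<dots> = (C1 + 1 + excess) * (x ^ (k - 1) + 1 / real N)" by (simp add: algebra_simps)
      finally show ?thesis .
    qed
    have "\<bar>drift \<beta> N i - excess * x ^ (k - 2)\<bar> \<le>
        (C1 + 1 + excess) * (x ^ (k - 1) + 1 / real N) + C2 / real N + 2 * C2\<^sup>2 / real N"
      using a1 a2 a3 unfolding drift_def n p_def[symmetric] by linarith
    also have "\<dots> \<le> C * (x ^ (k - 1) + 1 / real N)"
    proof -
      have "C * (x ^ (k - 1) + 1 / real N) = (C1 + 1 + excess) * (x ^ (k - 1) + 1 / real N) + C2 / real N
         + 2 * C2\<^sup>2 / real N + (2 * C2 + 2 * C2\<^sup>2) * x ^ (k - 1) + C2 / real N"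
        unfolding C_def by (simp add: algebra_simps)
      moreover have "0 \<le> (2 * C2 + 2 * C2\<^sup>2) * x ^ (k - 1)" "0 \<le> C2 / real N"
        using C2 xp[of "k - 1"] by simp_all
      ultimately show ?thesis by linarith
    qed
    finally show "\<bar>drift \<beta> N i - excess * (real i / real N) ^ (k - 2)\<bar> \<le>
        C * ((real i / real N) ^ (k - 1) + 1 / real N)"
      unfolding x_def .
    have "real N * p \<le> real N * l" using p by (intro mult_left_mono) auto
    also have "\<dots> \<le> 2 * C2" using lN by (simp add: mult.commute)
    also have "\<dots> \<le> C" unfolding C_def using C1(1) excess_pos by (simp add: add_nonneg_nonneg)
    finally show "real N * link_prob \<beta> N i \<le> C" unfolding p_def .
  qed
qed

text \<open>The difference (m + 1)^(p+1) - m^(p+1) lies between (p + 1) m^p and (p + 1)(m + 1)^p,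
  and it telescopes.\<close>

lemma sum_power_approx:
  "\<bar>(\<Sum>m<i. real m ^ p) - real i ^ (p + 1) / (real p + 1)\<bar> \<le> real i ^ p"
proof -
  have diff: "real m ^ p \<le> (real (Suc m) ^ (p + 1) - real m ^ (p + 1)) / (real p + 1) \<and>
     (real (Suc m) ^ (p + 1) - real m ^ (p + 1)) / (real p + 1) \<le> real (Suc m) ^ p" for m
  proof -
    have "real (Suc m) ^ Suc p - real m ^ Suc p =
        (real (Suc m) - real m) * (\<Sum>j<Suc p. real (Suc m) ^ j * real m ^ (p - j))"
      using power_diff_sumr2[of "real (Suc m)" "Suc p" "real m"] by (simp add: mult.commute)
    then have e: "real (Suc m) ^ (p + 1) - real m ^ (p + 1) =
        (\<Sum>j<Suc p. real (Suc m) ^ j * real m ^ (p - j))"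
      by simp
    have b: "real m ^ p \<le> real (Suc m) ^ j * real m ^ (p - j)" "real (Suc m) ^ j * real m ^ (p - j) \<le>
        real (Suc m) ^ p"
      if "j < Suc p" for j
    proof -
      have p: "p = j + (p - j)" using that by simp
      have "real m ^ p = real m ^ j * real m ^ (p - j)" by (subst p) (rule power_add)
      also have "\<dots> \<le> real (Suc m) ^ j * real m ^ (p - j)" by (intro mult_right_mono power_mono) auto
      finally show "real m ^ p \<le> real (Suc m) ^ j * real m ^ (p - j)" .
      have "real (Suc m) ^ j * real m ^ (p - j) \<le> real (Suc m) ^ j * real (Suc m) ^ (p - j)"
        by (intro mult_left_mono power_mono) auto
      also have "\<dots> = real (Suc m) ^ p" by (subst power_add[symmetric]) (use that in simp)
      finally show "real (Suc m) ^ j * real m ^ (p - j) \<le> real (Suc m) ^ p" .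
    qed
    have "(\<Sum>j<Suc p. real m ^ p) \<le> (\<Sum>j<Suc p. real (Suc m) ^ j * real m ^ (p - j))"
      "(\<Sum>j<Suc p. real (Suc m) ^ j * real m ^ (p - j)) \<le> (\<Sum>j<Suc p. real (Suc m) ^ p)"
      by (intro sum_mono b; simp)+
    then show ?thesis unfolding e by (simp add: field_simps)
  qed
  have tel: "(\<Sum>m<i. (real (Suc m) ^ (p + 1) - real m ^ (p + 1)) / (real p + 1)) =
      real i ^ (p + 1) / (real p + 1)"
    unfolding sum_divide_distrib[symmetric] sum_lessThan_telescope[of "\<lambda>m. real m ^ (p + 1)"] by simp
  have 1: "(\<Sum>m<i. real m ^ p) \<le> real i ^ (p + 1) / (real p + 1)"
    unfolding tel[symmetric] by (intro sum_mono) (use diff in auto)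
  have "real i ^ (p + 1) / (real p + 1) \<le> (\<Sum>m<i. real (Suc m) ^ p)"
    unfolding tel[symmetric] by (intro sum_mono) (use diff in auto)
  also have "(\<Sum>m<i. real (Suc m) ^ p) = (\<Sum>m<Suc i. real m ^ p) - 0 ^ p"
    by (subst sum.lessThan_Suc_shift) simp
  also have "\<dots> \<le> (\<Sum>m<i. real m ^ p) + real i ^ p" by simp
  finally show ?thesis using 1 by simp
qed

text \<open>The bounds share one constant and one threshold because later estimates use several of
  them together. The division by k - 1 comes from integrating x^(k-2).\<close>

lemma sum_drift_estimate:
  "\<exists>C>0. \<exists>N0>0. \<forall>N i. N0 \<le> N \<longrightarrow> 2 * i \<le> N \<longrightarrow>
     \<bar>(\<Sum>m<i. drift \<beta> N m) - excess / (real k - 1) * (real i * (real i / real N) ^ (k - 2))\<bar>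
        \<le> C * (real i * (real i / real N) ^ (k - 1) + real i / real N) \<and>
     (\<Sum>m<i. max 0 (drift \<beta> N m)) \<le> C * (real i * (real i / real N) ^ (k - 2) + real i / real N) \<and>
     \<bar>drift \<beta> N i\<bar> \<le> C * ((real i / real N) ^ (k - 2) + 1 / real N) \<and>
     real N * link_prob \<beta> N i \<le> C"
proof -
  obtain C1 N0 where C1: "0 < C1" "\<And>N i. N0 \<le> N \<Longrightarrow> 2 * i \<le> N \<Longrightarrow>
     \<bar>drift \<beta> N i - excess * (real i / real N) ^ (k - 2)\<bar> \<le>
         C1 * ((real i / real N) ^ (k - 1) + 1 / real N) \<and>
     real N * link_prob \<beta> N i \<le> C1"
    using drift_estimate by blast
  define C where "C = C1 + excess"
  show ?thesis
  proof (intro exI[of _ C] exI[of _ "Suc N0"] conjI allI impI)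
    show "0 < C" "0 < Suc N0" unfolding C_def using C1 excess_pos by auto
    fix N i :: nat assume N: "Suc N0 \<le> N" and i: "2 * i \<le> N"
    have N0: "0 < real N" using N by simp
    have est: "\<bar>drift \<beta> N m - excess * (real m / real N) ^ (k - 2)\<bar> \<le>
        C1 * ((real m / real N) ^ (k - 1) + 1 / real N)"
      "real N * link_prob \<beta> N m \<le> C1" if "m \<le> i" for m
      using C1(2)[of N m] that N i by auto
    have x: "0 \<le> real m / real N" "real m / real N \<le> real i / real N" "real m / real N \<le> 1" if "m \<le>
        i" for m
      using that N0 i by (auto simp: field_simps)
    have k12: "(real m / real N) ^ (k - 1) \<le> (real m / real N) ^ (k - 2)" if "m \<le> i" for m
      using x[OF that] by (intro power_decreasing) auto
    have ab: "\<bar>drift \<beta> N m\<bar> \<le> C * ((real m / real N) ^ (k - 2) + 1 / real N)" if "m \<le> i" for m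
    proof -
      have "0 \<le> excess * (real m / real N) ^ (k - 2)" using excess_pos x[OF that] by simp
      then have "\<bar>drift \<beta> N m\<bar> \<le>
          excess * (real m / real N) ^ (k - 2) + C1 * ((real m / real N) ^ (k - 1) + 1 / real N)"
        using est(1)[OF that] by linarith
      also have "\<dots> \<le> excess * ((real m / real N) ^ (k - 2) + 1 / real N) + C1 * ((real m / real N) ^ (k -
          2) + 1 / real N)"
        using k12[OF that] excess_pos C1(1) N0 by (intro add_mono mult_left_mono) auto
      finally show ?thesis by (simp add: C_def algebra_simps)
    qed
    show "\<bar>drift \<beta> N i\<bar> \<le> C * ((real i / real N) ^ (k - 2) + 1 / real N)" by (rule ab) simp
    show "real N * link_prob \<beta> N i \<le> C" using est(2)[of i] excess_pos by (simp add: C_def)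
    have "(\<Sum>m<i. max 0 (drift \<beta> N m)) \<le> (\<Sum>m<i. C * ((real i / real N) ^ (k - 2) + 1 / real N))"
    proof (rule sum_mono)
      fix m assume "m \<in> {..<i}"
      then have m: "m \<le> i" by simp
      have "max 0 (drift \<beta> N m) \<le> C * ((real m / real N) ^ (k - 2) + 1 / real N)"
          using ab[OF m] by linarith
      also have "\<dots> \<le> C * ((real i / real N) ^ (k - 2) + 1 / real N)"
        using x[OF m] C1(1) excess_pos unfolding C_def by (intro mult_left_mono add_mono power_mono) auto
      finally show "max 0 (drift \<beta> N m) \<le> C * ((real i / real N) ^ (k - 2) + 1 / real N)" .
    qed
    also have "\<dots> = C * (real i * (real i / real N) ^ (k - 2) + real i / real N)"
      by (simp add: algebra_simps)
    finally show "(\<Sum>m<i. max 0 (drift \<beta> N m)) \<le>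
        C * (real i * (real i / real N) ^ (k - 2) + real i / real N)" .
    have s1: "\<bar>(\<Sum>m<i. drift \<beta> N m) - (\<Sum>m<i. excess * (real m / real N) ^ (k - 2))\<bar> \<le>
        C1 * (real i * (real i / real N) ^ (k - 1) + real i / real N)"
    proof -
      have "\<bar>(\<Sum>m<i. drift \<beta> N m) - (\<Sum>m<i. excess * (real m / real N) ^ (k - 2))\<bar> \<le>
         (\<Sum>m<i. \<bar>drift \<beta> N m - excess * (real m / real N) ^ (k - 2)\<bar>)"
        by (simp add: sum_subtractf[symmetric] sum_abs)
      also have "\<dots> \<le> (\<Sum>m<i. C1 * ((real i / real N) ^ (k - 1) + 1 / real N))"
      proof (rule sum_mono)
        fix m assume "m \<in> {..<i}"
        then have m: "m \<le> i" by simp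
        have "\<bar>drift \<beta> N m - excess * (real m / real N) ^ (k - 2)\<bar> \<le>
            C1 * ((real m / real N) ^ (k - 1) + 1 / real N)"
          by (rule est(1)[OF m])
        also have "\<dots> \<le> C1 * ((real i / real N) ^ (k - 1) + 1 / real N)"
          using x[OF m] C1(1) by (intro mult_left_mono add_mono power_mono) auto
        finally show "\<bar>drift \<beta> N m - excess * (real m / real N) ^ (k - 2)\<bar> \<le>
            C1 * ((real i / real N) ^ (k - 1) + 1 / real N)" .
      qed
      finally show ?thesis by (simp add: algebra_simps)
    qed
    have s2: "\<bar>(\<Sum>m<i. excess * (real m / real N) ^ (k - 2)) - excess / (real k - 1) * (real i *
        (real i / real N) ^ (k - 2))\<bar>
        \<le> excess * (real i / real N)"
    proof -
      let ?p = "k - 2"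
      have kp: "real ?p + 1 = real k - 1" using k3 by (simp add: of_nat_diff)
      have "(\<Sum>m<i. excess * (real m / real N) ^ ?p) - excess / (real k - 1) * (real i *
          (real i / real N) ^ ?p) =
         excess / real N ^ ?p * ((\<Sum>m<i. real m ^ ?p) - real i ^ (?p + 1) / (real ?p + 1))"
      proof -
        have "(\<Sum>m<i. excess * (real m / real N) ^ ?p) = excess / real N ^ ?p * (\<Sum>m<i. real m ^ ?p)"
          by (simp add: power_divide sum_distrib_left)
        moreover have "excess / q * (real i * (real i / real N) ^ ?p) =
            excess / real N ^ ?p * (real i ^ (?p + 1) / q)" for q
          by (simp add: power_divide)
        ultimately show ?thesis unfolding kp by (simp only: right_diff_distrib)
      qed
      also have "\<bar>\<dots>\<bar> = excess / real N ^ ?p * \<bar>(\<Sum>m<i. real m ^ ?p) - real i ^ (?p + 1) / (real ?p + 1)\<bar>"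
        using excess_pos by (simp add: abs_mult)
      also have "\<dots> \<le> excess / real N ^ ?p * real i ^ ?p"
        using excess_pos by (intro mult_left_mono sum_power_approx) auto
      also have "\<dots> = excess * (real i / real N) ^ ?p" by (simp add: power_divide)
      \<comment> \<open>The exponent k - 2 is at least 1, so the rounding error of the power sum is
        already of order i/N.\<close>
      also have "\<dots> \<le> excess * (real i / real N) ^ 1"
        using x[of i] k3 excess_pos by (intro mult_left_mono power_decreasing) auto
      finally show ?thesis by simp
    qed
    have "0 \<le> excess * (real i * (real i / real N) ^ (k - 1))" using excess_pos by simp
    then show "\<bar>(\<Sum>m<i. drift \<beta> N m) - excess / (real k - 1) * (real i * (real i / real N) ^ (k - 2))\<bar>
        \<le> C * (real i * (real i / real N) ^ (k - 1) + real i / real N)"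
      using s1 s2 unfolding C_def distrib_right distrib_left by linarith
  qed
qed

end

section \<open>No late returns\<close>

text \<open>Conditioning on one trial; the moment formula, the transform and the comparison below
  are inductions on this identity.\<close>

lemma expectation_binomial_pmf_Suc:
  fixes f :: "nat \<Rightarrow> 'a :: {banach, second_countable_topology}"
  assumes "p \<in> {0..1}"
  shows "measure_pmf.expectation (binomial_pmf (Suc n) p) f =
    p *\<^sub>R measure_pmf.expectation (binomial_pmf n p) (\<lambda>c. f (Suc c)) +
    (1 - p) *\<^sub>R measure_pmf.expectation (binomial_pmf n p) f"
proof -
  have "binomial_pmf (Suc n) p =
      bind_pmf (bernoulli_pmf p) (\<lambda>b. map_pmf (\<lambda>c. if b then Suc c else c) (binomial_pmf n p))"
    using assms by (subst binomial_pmf_Suc) (auto simp: map_pmf_def intro!: bind_pmf_cong)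
  also have "measure_pmf.expectation \<dots> f =
     (\<Sum>b\<in>UNIV. pmf (bernoulli_pmf p) b *\<^sub>R
        measure_pmf.expectation (map_pmf (\<lambda>c. if b then Suc c else c) (binomial_pmf n p)) f)"
  proof (intro pmf_expectation_bind)
    show "finite (set_pmf (map_pmf (\<lambda>c. if b then Suc c else c) (binomial_pmf n p)))" for b
      using finite_set_pmf_binomial_pmf[OF assms, of n] by simp
  qed auto
  finally show ?thesis using assms by (simp add: UNIV_bool)
qed

text \<open>The shift a carries the induction, since a success moves it by 1, and later allows
  centring at the conditional mean.\<close>

lemma expectation_binomial_square:
  assumes "p \<in> {0..1}"
  shows "measure_pmf.expectation (binomial_pmf n p) (\<lambda>c. (real c + a)\<^sup>2) =
    (real n * p + a)\<^sup>2 + real n * p * (1 - p)"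
proof (induction n arbitrary: a)
  case 0
  then show ?case using assms by (simp add: binomial_pmf_0)
next
  case (Suc n)
  have e: "measure_pmf.expectation (binomial_pmf n p) (\<lambda>c. (real (Suc c) + a)\<^sup>2) =
     (real n * p + (1 + a))\<^sup>2 + real n * p * (1 - p)"
    using Suc[of "1 + a"] by (simp add: add_ac)
  show ?case
    unfolding expectation_binomial_pmf_Suc[OF assms] e Suc
    by (simp add: algebra_simps power2_eq_square)
qed

lemma expectation_binomial_iexp:
  assumes "p \<in> {0..1}"
  shows "measure_pmf.expectation (binomial_pmf n p) (\<lambda>c. iexp (t * real c)) =
    (1 + of_real p * (iexp t - 1)) ^ n"
proof (induction n)
  case 0
  then show ?case using assms by (simp add: binomial_pmf_0)
next
  case (Suc n)
  have "iexp (t * real (Suc c)) = iexp t * iexp (t * real c)" for c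
    by (simp add: algebra_simps flip: exp_add)
  then have "measure_pmf.expectation (binomial_pmf n p) (\<lambda>c. iexp (t * real (Suc c))) =
     iexp t * measure_pmf.expectation (binomial_pmf n p) (\<lambda>c. iexp (t * real c))"
    by simp
  then show ?case
    unfolding expectation_binomial_pmf_Suc[OF assms] Suc
    by (simp add: algebra_simps scaleR_conv_of_real)
qed

text \<open>One more trial can only raise the count, hence it lowers the mean of a decreasing
  function.\<close>

lemma expectation_binomial_antimono:
  assumes p: "p \<in> {0..1}" and f: "\<And>c. f (Suc c) \<le> (f c :: real)" and "m \<le> n"
  shows "measure_pmf.expectation (binomial_pmf n p) f \<le> measure_pmf.expectation (binomial_pmf m p) f"
  using \<open>m \<le> n\<close>
proof (induction rule: dec_induct)
  case (step n)
  let ?E = "measure_pmf.expectation (binomial_pmf n p)"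
  have "?E (\<lambda>c. f (Suc c)) \<le> ?E f"
    using p f by (intro expectation_pmf_mono) auto
  then have "p * ?E (\<lambda>c. f (Suc c)) + (1 - p) * ?E f \<le> p * ?E f + (1 - p) * ?E f"
    using p by (intro add_right_mono mult_left_mono) auto
  then show ?case
    using step unfolding expectation_binomial_pmf_Suc[OF p] by (simp add: algebra_simps)
qed simp

section \<open>A maximal inequality for the compensated walk\<close>

text \<open>Child counts minus their conditional means under \<open>child_kernel\<close>, hence a
  martingale of the chain.\<close>

primrec mart :: "(nat \<Rightarrow> real) \<Rightarrow> nat \<Rightarrow> nat list \<Rightarrow> real" where
  "mart \<beta> N [] = 0"
| "mart \<beta> N (c # cs) = mart \<beta> N cs + real c -
     real (N - Suc (length cs) - queue cs) * link_prob \<beta> N (length cs)"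

lemma sum_inverse_max_square:
  fixes A :: real
  assumes "0 < A"
  shows "(\<Sum>m\<in>{1..D}. 1 / (max (real m) A)\<^sup>2) \<le> 3 / A"
proof -
  \<comment> \<open>Strengthened so as to be inductive: linear growth up to A, afterwards 3/A - 1/D,
    whose increments dominate 1/(D + 1)^2.\<close>
  have "(\<Sum>m\<in>{1..D}. 1 / (max (real m) A)\<^sup>2) \<le> (if real D \<le> A then real D / A\<^sup>2 else 3 / A - 1 / real D)"
  proof (induction D)
    case 0
    then show ?case using assms by simp
  next
    case (Suc D)
    let ?d = "real D"
    consider "?d + 1 \<le> A" | "?d \<le> A" "A < ?d + 1" | "A < ?d" by linarith
    then show ?case
    proof cases
      case 1
      then show ?thesis using Suc by (simp add: add_divide_distrib)
    next
      case 2
      have "?d / A\<^sup>2 \<le> 1 / A" using 2 assms by (simp add: field_simps power2_eq_square)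
      moreover have "1 / (?d + 1)\<^sup>2 \<le> 1 / (?d + 1)"
        by (intro divide_left_mono) (auto simp: power2_eq_square)
      moreover have "1 / (?d + 1) \<le> 1 / A" using 2 assms by (intro divide_left_mono) auto
      ultimately have "?d / A\<^sup>2 + 1 / (?d + 1)\<^sup>2 \<le> 3 / A - 1 / (?d + 1)" by simp
      then show ?thesis using Suc 2 by (simp add: add.commute)
    next
      case 3
      then have d: "0 < ?d" using assms by linarith
      have "1 / (?d + 1)\<^sup>2 \<le> 1 / (?d * (?d + 1))"
        using d by (intro divide_left_mono) (auto simp: power2_eq_square)
      also have "\<dots> = 1 / ?d - 1 / (?d + 1)" using d by (simp add: field_simps)
      finally show ?thesis using Suc 3 by (simp add: add.commute)
    qed
  qed
  also have "\<dots> \<le> 3 / A" using assms by (auto simp: field_simps power2_eq_square)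
  finally show ?thesis .
qed

lemma sum_inverse_max_power:
  fixes A :: real
  assumes "0 < A" "2 \<le> q"
  shows "(\<Sum>m\<in>{1..D}. 1 / max (real m) A ^ q) \<le> 3 / A ^ (q - 1)"
proof -
  have "(\<Sum>m\<in>{1..D}. 1 / max (real m) A ^ q) \<le> (\<Sum>m\<in>{1..D}. 1 / A ^ (q - 2) * (1 / (max (real m) A)\<^sup>2))"
  proof (rule sum_mono)
    fix m
    have "max (real m) A ^ q = max (real m) A ^ (q - 2) * (max (real m) A)\<^sup>2"
      using assms(2) by (metis le_add_diff_inverse2 power_add)
    moreover have "A ^ (q - 2) \<le> max (real m) A ^ (q - 2)" using assms by (intro power_mono) auto
    then have "1 / max (real m) A ^ (q - 2) \<le> 1 / A ^ (q - 2)"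
      using assms by (intro divide_left_mono) (auto intro!: mult_pos_pos zero_less_power)
    then have "1 / max (real m) A ^ (q - 2) * (1 / (max (real m) A)\<^sup>2) \<le>
        1 / A ^ (q - 2) * (1 / (max (real m) A)\<^sup>2)"
      by (rule mult_right_mono) simp
    ultimately show "1 / max (real m) A ^ q \<le> 1 / A ^ (q - 2) * (1 / (max (real m) A)\<^sup>2)" by simp
  qed
  also have "\<dots> = 1 / A ^ (q - 2) * (\<Sum>m\<in>{1..D}. 1 / (max (real m) A)\<^sup>2)" by (simp add: sum_distrib_left)
  also have "\<dots> \<le> 1 / A ^ (q - 2) * (3 / A)"
    using assms by (intro mult_left_mono sum_inverse_max_square) auto
  also have "\<dots> = 3 / A ^ (q - 1)"
  proof -
    have "A ^ (q - 1) = A ^ (q - 2) * A" using assms(2)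
        by (simp flip: power_Suc2 add: Suc_diff_Suc numeral_2_eq_2)
    then show ?thesis by simp
  qed
  finally show ?thesis .
qed

context critical_weights
begin

lemma finite_child_kernel: "finite (set_pmf (child_kernel \<beta> N cs))"
  unfolding child_kernel_def using link_prob_in_01 by (intro finite_set_pmf_binomial_pmf)

text \<open>Hajek--Renyi: the weighted square of the compensated walk plus the weighted variance still to
  come is a supersolution.\<close>

lemma hit_mart_le:
  assumes b: "\<And>i. 0 < b i" "mono b" and v: "\<And>i. i < D \<Longrightarrow> real N * link_prob \<beta> N i \<le> v" "0 \<le> v"
  shows "hit (child_kernel \<beta> N) (\<lambda>cs. length cs \<le> D \<and> b (length cs) < \<bar>mart \<beta> N cs\<bar>) n [] \<le>
    (\<Sum>m\<in>{1..D}. v / (b m)\<^sup>2)"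
proof -
  let ?P = "\<lambda>cs. length cs \<le> D \<and> b (length cs) < \<bar>mart \<beta> N cs\<bar>"
  \<comment> \<open>Past time D the event is impossible, so the value 0 is allowed there and keeps
    \<open>f\<close> a supersolution.\<close>
  define f where "f = (\<lambda>cs. if length cs \<le> D then (mart \<beta> N cs)\<^sup>2 / (b (length cs))\<^sup>2 +
     (\<Sum>m\<in>{length cs<..D}. v / (b m)\<^sup>2) else 0)"
  have s0: "0 \<le> (\<Sum>m\<in>{i<..D}. v / (b m)\<^sup>2)" for i using v(2) by (intro sum_nonneg) auto
  have "hit (child_kernel \<beta> N) ?P n [] \<le> f []"
  proof (rule hit_le_supersolution[where L = n])
    fix ys :: "nat list" assume "length ys \<le> n"
    show "0 \<le> f ys" unfolding f_def using s0 by auto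
    assume "?P ys"
    then have "(b (length ys))\<^sup>2 \<le> (mart \<beta> N ys)\<^sup>2" using b(1)[of "length ys"]
        by (intro abs_le_square_iff[THEN iffD1]) auto
    then have "1 \<le> (mart \<beta> N ys)\<^sup>2 / (b (length ys))\<^sup>2" using b(1)[of "length ys"] by simp
    then show "1 \<le> f ys" unfolding f_def using s0[of "length ys"] \<open>?P ys\<close> by simp
  next
    show "finite (set_pmf (child_kernel \<beta> N ys))" for ys by (rule finite_child_kernel)
  next
    fix ys :: "nat list"
    let ?i = "length ys"
    let ?n = "N - Suc ?i - queue ys" and ?p = "link_prob \<beta> N (length ys)"
    let ?E = "measure_pmf.expectation (child_kernel \<beta> N ys)"
    show "?E (\<lambda>y. f (y # ys)) \<le> f ys"
    proof (cases "?i < D")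
      case False
      then show ?thesis unfolding f_def using s0 by simp
    next
      case True
      let ?S = "\<Sum>m\<in>{Suc ?i<..D}. v / (b m)\<^sup>2"
      have "?E (\<lambda>y. f (y # ys)) =
          ?E (\<lambda>y. (real y + (mart \<beta> N ys - real ?n * ?p))\<^sup>2 * (1 / (b (Suc ?i))\<^sup>2) + ?S)"
        unfolding f_def using True
            by (intro Bochner_Integration.integral_cong refl) (simp add: algebra_simps)
      also have "\<dots> = ?E (\<lambda>y. (real y + (mart \<beta> N ys - real ?n * ?p))\<^sup>2) * (1 / (b (Suc ?i))\<^sup>2) + ?S"
        using finite_child_kernel by (simp add: integrable_measure_pmf_finite)
      also have "?E (\<lambda>y. (real y + (mart \<beta> N ys - real ?n * ?p))\<^sup>2) =
          (mart \<beta> N ys)\<^sup>2 + real ?n * ?p * (1 - ?p)"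
        unfolding child_kernel_def by (subst expectation_binomial_square[OF link_prob_in_01]) simp
      also have "((mart \<beta> N ys)\<^sup>2 + real ?n * ?p * (1 - ?p)) * (1 / (b (Suc ?i))\<^sup>2) \<le>
          (mart \<beta> N ys)\<^sup>2 / (b ?i)\<^sup>2 + v / (b (Suc ?i))\<^sup>2"
      proof -
        have "real ?n * ?p * (1 - ?p) \<le> real N * ?p * 1"
          using link_prob_in_01[of N ?i] by (intro mult_mono) auto
        also have "\<dots> \<le> v" using v(1)[OF True] by simp
        finally have "real ?n * ?p * (1 - ?p) / (b (Suc ?i))\<^sup>2 \<le> v / (b (Suc ?i))\<^sup>2"
            by (rule divide_right_mono) simp
        \<comment> \<open>A growing weight divides the square by more, so the past counts no more
          than before and only the variance of the new step is added.\<close>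
        moreover have "(b ?i)\<^sup>2 \<le> (b (Suc ?i))\<^sup>2"
          using b(1)[of ?i] monoD[OF b(2), of ?i "Suc ?i"] by (intro power_mono) auto
        then have "(mart \<beta> N ys)\<^sup>2 / (b (Suc ?i))\<^sup>2 \<le> (mart \<beta> N ys)\<^sup>2 / (b ?i)\<^sup>2"
          using b(1)[of ?i] b(1)[of "Suc ?i"] by (intro divide_left_mono) auto
        ultimately show ?thesis by (simp add: add_divide_distrib)
      qed
      also have "(mart \<beta> N ys)\<^sup>2 / (b ?i)\<^sup>2 + v / (b (Suc ?i))\<^sup>2 + ?S = f ys"
      proof -
        have "{?i<..D} = insert (Suc ?i) {Suc ?i<..D}" using True by auto
        then show ?thesis unfolding f_def using True by simp
      qed
      finally show ?thesis by simp
    qed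
  qed simp
  also have "f [] = (\<Sum>m\<in>{1..D}. v / (b m)\<^sup>2)"
    unfolding f_def by (simp add: atLeastSucAtMost_greaterThanAtMost)
  finally show ?thesis .
qed

section \<open>Control of the queue and of the walk by the martingale\<close>

text \<open>The queue is a reflected walk. Away from 0 its increment is at most that of the
  martingale plus the positive part of the drift; when truncated it is 0, and the right-hand side
  stays nonnegative because the martingale never falls below -B.\<close>

lemma queue_le:
  assumes "\<And>j. j \<le> length cs \<Longrightarrow> \<bar>mart \<beta> N (drop j cs)\<bar> \<le> B"
  shows "real (queue cs) \<le> mart \<beta> N cs + B + (\<Sum>m<length cs. max 0 (drift \<beta> N m))"
  using assms
proof (induction cs)
  case Nil
  then show ?case using Nil[of 0] by simp
next
  case (Cons c cs)
  let ?i = "length cs" and ?p = "link_prob \<beta> N (length cs)"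
  have IH: "real (queue cs) \<le> mart \<beta> N cs + B + (\<Sum>m<length cs. max 0 (drift \<beta> N m))"
    using Cons.prems[of "Suc _"] by (intro Cons.IH) simp
  have "real (N - Suc ?i - queue cs) * ?p \<le> real (N - Suc ?i) * ?p"
    using link_prob_in_01[of N ?i] by (intro mult_right_mono) auto
  then have "real (N - Suc ?i - queue cs) * ?p \<le> max 0 (drift \<beta> N ?i) + 1"
      unfolding drift_def by linarith
  then have "real (queue cs) + real c - 1 \<le>
      mart \<beta> N (c # cs) + B + (\<Sum>m<length (c # cs). max 0 (drift \<beta> N m))"
    using IH by simp
  moreover have "0 \<le> mart \<beta> N (c # cs) + B + (\<Sum>m<length (c # cs). max 0 (drift \<beta> N m))"
  proof -
    have "0 \<le> (\<Sum>m<length (c # cs). max 0 (drift \<beta> N m))" by (intro sum_nonneg) auto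
    moreover have "\<bar>mart \<beta> N (c # cs)\<bar> \<le> B" using Cons.prems[of 0] by simp
    ultimately show ?thesis by linarith
  qed
  moreover have "real (queue (c # cs)) = max 0 (real (queue cs) + real c - 1)"
      by (auto simp: of_nat_diff max_def)
  ultimately show ?case by linarith
qed

lemma queue_le_sum:
  assumes "\<And>j. j \<le> length cs \<Longrightarrow> \<bar>mart \<beta> N (drop j cs)\<bar> \<le> B" and "j \<le> length cs"
  shows "real (queue (drop j cs)) \<le> 2 * B + (\<Sum>m<length cs. max 0 (drift \<beta> N m))"
proof -
  have "real (queue (drop j cs)) \<le>
      mart \<beta> N (drop j cs) + B + (\<Sum>m<length (drop j cs). max 0 (drift \<beta> N m))"
    using assms by (intro queue_le) (simp add: add.commute)
  also have "mart \<beta> N (drop j cs) \<le> B" using assms(1)[OF assms(2)] by simp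
  also have "(\<Sum>m<length (drop j cs). max 0 (drift \<beta> N m)) \<le> (\<Sum>m<length cs. max 0 (drift \<beta> N m))"
    by (intro sum_mono2) auto
  finally show ?thesis by simp
qed

text \<open>Each queued vertex removes one trial, hence at most \<open>link_prob\<close> from the
  mean step; a queue bounded by Q costs Q times the sum of these probabilities.\<close>

lemma net_ge:
  assumes "\<And>j. j \<le> length cs \<Longrightarrow> real (queue (drop j cs)) \<le> Q"
  shows "mart \<beta> N cs + (\<Sum>m<length cs. drift \<beta> N m) - Q * (\<Sum>m<length cs. link_prob \<beta> N m) \<le> net cs"
  using assms
proof (induction cs)
  case (Cons c cs)
  let ?i = "length cs" and ?p = "link_prob \<beta> N (length cs)"
  have IH: "mart \<beta> N cs + (\<Sum>m<length cs. drift \<beta> N m) - Q * (\<Sum>m<length cs. link_prob \<beta> N m) \<le> net cs"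
    using Cons.prems[of "Suc _"] by (intro Cons.IH) simp
  have p: "0 \<le> ?p" using link_prob_in_01[of N ?i] by simp
  have "(real (N - Suc ?i) - real (queue cs)) * ?p \<le> real (N - Suc ?i - queue cs) * ?p"
    using p by (intro mult_right_mono) auto
  moreover have "real (queue cs) * ?p \<le> Q * ?p" using Cons.prems[of 1] p by (intro mult_right_mono) auto
  ultimately have "drift \<beta> N ?i + 1 - Q * ?p \<le> real (N - Suc ?i - queue cs) * ?p"
    unfolding drift_def by (simp add: algebra_simps)
  then show ?case using IH by (simp add: algebra_simps)
qed simp

lemma powr_alpha_power: "0 < N \<Longrightarrow> (real N powr alpha k) ^ (2 * k - 3) = real N ^ (2 * k - 4)"
proof -
  assume N: "0 < N"
  have "(real N powr alpha k) ^ (2 * k - 3) = real N powr (alpha k * real (2 * k - 3))"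
    using N by (simp add: powr_realpow[symmetric] powr_powr)
  also have "alpha k * real (2 * k - 3) = real (2 * k - 4)"
    using k3 by (simp add: alpha_def of_nat_diff)
  also have "real N powr \<dots> = real N ^ (2 * k - 4)" using N by (simp add: powr_realpow)
  finally show ?thesis .
qed

lemma alpha_bounds: "2 / 3 \<le> alpha k" "alpha k < 1"
  using k3 by (auto simp: alpha_def field_simps of_nat_diff)

lemma alpha_eq: "1 + (alpha k - 1) * (real k - 2) = 1 - alpha k / 2"
proof -
  have "2 * real k - 3 > 0" using k3 by simp
  then show ?thesis by (simp add: alpha_def field_simps)
qed

text \<open>Put x = i/N and g = i x^(k-2), so that the accumulated drift is 4 eta g up to small
  errors. If the martingale has stayed within eta g, the queue is controlled too and the walk is
  positive; a late return therefore forces the martingale beyond its weight at some time.\<close>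

lemma late_return_bound:
  "\<exists>\<delta>>0. \<delta> \<le> 1 / 2 \<and> (\<exists>C>0. \<forall>T>0. \<forall>\<^sub>F N in sequentially.
     hit (child_kernel \<beta> N) (\<lambda>cs. real N powr alpha k * T \<le> real (length cs) \<and>
        real (length cs) \<le> real N * \<delta> \<and> net cs \<le> 0) N [] \<le> C / T ^ (2 * k - 3))"
proof -
  obtain C0 N0 where C0: "0 < C0" and N0: "\<And>N i. N0 \<le> N \<Longrightarrow> 2 * i \<le> N \<Longrightarrow>
     \<bar>(\<Sum>m<i. drift \<beta> N m) - excess / (real k - 1) * (real i * (real i / real N) ^ (k - 2))\<bar>
        \<le> C0 * (real i * (real i / real N) ^ (k - 1) + real i / real N) \<and>
     (\<Sum>m<i. max 0 (drift \<beta> N m)) \<le> C0 * (real i * (real i / real N) ^ (k - 2) + real i / real N) \<and>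
     \<bar>drift \<beta> N i\<bar> \<le> C0 * ((real i / real N) ^ (k - 2) + 1 / real N) \<and>
     real N * link_prob \<beta> N i \<le> C0"
    using sum_drift_estimate by blast
  \<comment> \<open>A quarter of the drift coefficient: one part pays for the martingale, one for
    the queue and the drift error, and two are left against the terms linear in x.\<close>
  define \<eta> where "\<eta> = excess / (real k - 1) / 4"
  have \<eta>: "0 < \<eta>" "excess / (real k - 1) = 4 * \<eta>" 
  proof -
    show "0 < \<eta>" unfolding \<eta>_def using excess_pos k3 by simp
    show "excess / (real k - 1) = 4 * \<eta>" unfolding \<eta>_def 
    proof -
      have "y = 4 * (y / 4)" for y :: real by simp
      then show "excess / (real k - 1) = 4 * (excess / (real k - 1) / 4)" .
    qed
  qed
  have Suc_k: "Suc (k - 2) = k - 1" using k3 by simp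
  \<comment> \<open>The coefficient of x g in the errors: \<open>C0\<close> from the drift, and
    \<open>C0\<close> times the coefficient 2 eta + \<open>C0\<close> of g in the queue
    bound.\<close>
  define K where "K = C0 + 2 * \<eta> * C0 + C0 * C0"
  have K: "0 < K" unfolding K_def using C0 \<eta> by (simp add: add_pos_pos)
  define \<delta> where "\<delta> = min (1 / 2) (\<eta> / K)"
  have \<delta>: "0 < \<delta>" "\<delta> \<le> 1 / 2" "K * \<delta> \<le> \<eta>" unfolding \<delta>_def using K \<eta> by (auto simp: min_def field_simps)
  define C where "C = 3 * C0 / \<eta>\<^sup>2"
  have "\<exists>C>0. \<forall>T>0. \<forall>\<^sub>F N in sequentially.
     hit (child_kernel \<beta> N) (\<lambda>cs. real N powr alpha k * T \<le> real (length cs) \<and>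
        real (length cs) \<le> real N * \<delta> \<and> net cs \<le> 0) N [] \<le> C / T ^ (2 * k - 3)"
  proof (intro exI[of _ C] conjI allI impI)
    show "0 < C" unfolding C_def using C0 \<eta> by simp
    fix T :: real assume T: "0 < T"
    \<comment> \<open>This is a lower bound for N x^(k-2) once i is at least T N^alpha, and so
      decides when g dominates the terms linear in x.\<close>
    have "filterlim (\<lambda>N::nat. T ^ (k - 2) * real N powr (1 - alpha k / 2)) at_top sequentially"
      using T alpha_bounds by real_asymp
    then have ev: "\<forall>\<^sub>F N in sequentially. (C0 + C0 * C0) / (2 * \<eta>) <
        T ^ (k - 2) * real N powr (1 - alpha k / 2)"
      unfolding filterlim_at_top_dense by blast
    show "\<forall>\<^sub>F N in sequentially. hit (child_kernel \<beta> N)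
        (\<lambda>cs. real N powr alpha k * T \<le> real (length cs) \<and>
        real (length cs) \<le> real N * \<delta> \<and> net cs \<le> 0) N [] \<le> C / T ^ (2 * k - 3)"
      using ev eventually_ge_at_top[of "max N0 1"]
    proof eventually_elim
      case (elim N)
      let ?P = "\<lambda>cs. real N powr alpha k * T \<le> real (length cs) \<and> real (length cs) \<le> real N * \<delta> \<and>
          net cs \<le> 0"
      have N: "0 < real N" "N0 \<le> N" using elim by auto
      define A where "A = real N powr alpha k * T"
      have A: "0 < A" unfolding A_def using N T by simp
      define b where "b = (\<lambda>i. \<eta> / real N ^ (k - 2) * max (real i) A ^ (k - 1))"
      have b: "0 < b i" for i unfolding b_def using \<eta> N A by (simp add: less_max_iff_disj)
      have mono: "mono b"
      proof (rule monoI)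
        fix x y :: nat assume "x \<le> y"
        then have "max (real x) A ^ (k - 1) \<le> max (real y) A ^ (k - 1)"
          using A by (intro power_mono) auto
        then show "b x \<le> b y" unfolding b_def using \<eta> by (intro mult_left_mono) auto
      qed
      define D where "D = nat \<lfloor>real N * \<delta>\<rfloor>"
      have D: "i \<le> D \<longleftrightarrow> real i \<le> real N * \<delta>" for i
        unfolding D_def using N \<delta> by (simp add: le_nat_floor le_nat_iff le_floor_iff)
      have half: "2 * i \<le> N" if "real i \<le> real N * \<delta>" for i
      proof -
        have "real N * \<delta> \<le> real N * (1 / 2)" using \<delta> N by (intro mult_left_mono) auto
        then show ?thesis using that by linarith
      qed
      let ?Q = "\<lambda>cs. length cs \<le> D \<and> b (length cs) < \<bar>mart \<beta> N cs\<bar>"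
      have "hit (child_kernel \<beta> N) ?P N [] \<le> hit (child_kernel \<beta> N) ?Q N []"
      proof (rule hit_mono_path)
        fix ys :: "nat list" assume P: "?P ys"
        let ?i = "length ys"
        show "\<exists>j\<le>length ys - length []. ?Q (drop j ys)"
        proof (rule ccontr)
          assume neg: "\<not> (\<exists>j\<le>length ys - length []. ?Q (drop j ys))"
          define x where "x = real ?i / real N"
          define g where "g = real ?i * x ^ (k - 2)"
          have iD: "?i \<le> D" using P D by simp
          have iA: "A \<le> real ?i" using P unfolding A_def by simp
          have x: "0 < x" "x \<le> \<delta>" unfolding x_def using iA A N P by (auto simp: field_simps)
          have g: "0 \<le> g" unfolding g_def using x by simp
          have bi: "b ?i = \<eta> * g"
          proof -
            have "real ?i ^ (k - 1) = real ?i * real ?i ^ (k - 2)"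
              unfolding power_Suc[symmetric] Suc_k ..
            then show ?thesis
              unfolding b_def g_def x_def using iA by (simp add: max_absorb1 power_divide)
          qed
          have "\<bar>mart \<beta> N (drop j ys)\<bar> \<le> b ?i" if "j \<le> ?i" for j
          proof -
            have "\<bar>mart \<beta> N (drop j ys)\<bar> \<le> b (length (drop j ys))" using neg that iD
                by (simp add: not_less)
            also have "\<dots> \<le> b ?i" by (intro monoD[OF mono]) simp
            finally show ?thesis .
          qed
          note M = this[unfolded bi]
          define Q where "Q = 2 * (\<eta> * g) + C0 * (g + x)"
          have est: "\<bar>(\<Sum>m<?i. drift \<beta> N m) - 4 * \<eta> * g\<bar> \<le> C0 * (g * x + x)"
            "(\<Sum>m<?i. max 0 (drift \<beta> N m)) \<le> C0 * (g + x)"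
          proof -
            have h: "2 * ?i \<le> N" using P half by blast
            have "x ^ (k - 1) = x ^ (k - 2) * x"
              unfolding power_Suc2[symmetric] Suc_k ..
            then show "\<bar>(\<Sum>m<?i. drift \<beta> N m) - 4 * \<eta> * g\<bar> \<le> C0 * (g * x + x)"
              "(\<Sum>m<?i. max 0 (drift \<beta> N m)) \<le> C0 * (g + x)"
              using N0[OF N(2) h] unfolding \<eta>(2) x_def[symmetric] g_def by (simp_all add: mult_ac)
          qed
          have Q: "real (queue (drop j ys)) \<le> Q" if "j \<le> ?i" for j
            using queue_le_sum[of ys N "\<eta> * g" j, OF M that] est(2) unfolding Q_def by simp
          have Q0: "0 \<le> Q" unfolding Q_def using \<eta> g C0 x by simp
          have sp: "(\<Sum>m<?i. link_prob \<beta> N m) \<le> C0 * x"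
          proof -
            have "(\<Sum>m<?i. link_prob \<beta> N m) \<le> (\<Sum>m<?i. C0 / real N)"
            proof (rule sum_mono)
              fix m assume "m \<in> {..<?i}"
              then have "2 * m \<le> N" using P half[of m] by (intro half) auto
              then show "link_prob \<beta> N m \<le> C0 / real N"
                using N0[OF N(2), of m] N(1) by (simp add: field_simps)
            qed
            then show ?thesis by (simp add: x_def mult.commute)
          qed
          have "mart \<beta> N ys + (\<Sum>m<?i. drift \<beta> N m) - Q * (\<Sum>m<?i. link_prob \<beta> N m) \<le> net ys"
            by (rule net_ge[OF Q])
          moreover have "Q * (\<Sum>m<?i. link_prob \<beta> N m) \<le> Q * (C0 * x)" using sp Q0
              by (rule mult_left_mono)
          moreover have "- (\<eta> * g) \<le> mart \<beta> N ys" using M[of 0] by simp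
          ultimately have "- (\<eta> * g) + (4 * \<eta> * g - C0 * (g * x + x)) - Q * (C0 * x) \<le> net ys"
            using est(1) by linarith
          moreover have "- (\<eta> * g) + (4 * \<eta> * g - C0 * (g * x + x)) - Q * (C0 * x) =
              3 * \<eta> * g - K * x * g - C0 * x - C0 * C0 * x * x"
            unfolding Q_def K_def by (simp add: algebra_simps)
          moreover have "K * x * g \<le> \<eta> * g"
          proof -
            have "K * x \<le> K * \<delta>" using x K by (intro mult_left_mono) auto
            then show ?thesis using \<delta>(3) g by (intro mult_right_mono) auto
          qed
          moreover have "C0 * C0 * x * x \<le> C0 * C0 * x * 1" using x \<delta> C0 by (intro mult_left_mono) auto
          \<comment> \<open>What is left of the drift wins because g/x = N x^(k-2), which is large
            at all times from T N^alpha on.\<close>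
          moreover have "0 < 2 * \<eta> * g - (C0 + C0 * C0) * x"
          proof -
            have xA: "T * real N powr (alpha k - 1) \<le> x"
            proof -
              have "T * real N powr (alpha k - 1) = A / real N" unfolding A_def using N
                  by (simp add: powr_diff)
              then show ?thesis unfolding x_def using iA N by (simp add: divide_right_mono)
            qed
            have "T ^ (k - 2) * real N powr (1 - alpha k / 2) =
                real N * (T * real N powr (alpha k - 1)) ^ (k - 2)"
            proof -
              have "(real N powr (alpha k - 1)) ^ (k - 2) = real N powr ((alpha k - 1) * (real k - 2))"
                using N k3 by (simp add: powr_realpow[symmetric] powr_powr of_nat_diff)
              then have "real N * (real N powr (alpha k - 1)) ^ (k - 2) = real N powr (1 - alpha k / 2)"
                unfolding alpha_eq[symmetric] using N by (simp add: powr_add)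
              then show ?thesis by (simp add: power_mult_distrib)
            qed
            also have "\<dots> \<le> real N * x ^ (k - 2)"
              using xA T N by (intro mult_left_mono power_mono) auto
            finally have "(C0 + C0 * C0) / (2 * \<eta>) < real N * x ^ (k - 2)" using elim(1) by linarith
            then have "C0 + C0 * C0 < 2 * \<eta> * (real N * x ^ (k - 2))" using \<eta> by (simp add: field_simps)
            then have "(C0 + C0 * C0) * x < 2 * \<eta> * (real N * x ^ (k - 2)) * x"
              using x by (intro mult_strict_right_mono) auto
            moreover have "real ?i = real N * x" unfolding x_def using N by simp
            ultimately show ?thesis unfolding g_def by (simp add: mult_ac)
          qed
          ultimately have "0 < net ys" by (simp add: algebra_simps)
          then show False using P by simp
        qed
      qed
      also have "\<dots> \<le> (\<Sum>m\<in>{1..D}. C0 / (b m)\<^sup>2)"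
      proof (rule hit_mart_le[OF b mono])
        fix i assume "i < D"
        then have "2 * i \<le> N" using D[of i] half by simp
        then show "real N * link_prob \<beta> N i \<le> C0" using N0[OF N(2)] by blast
      qed (use C0 in simp)
      also have "\<dots> = C0 * (real N ^ (k - 2) / \<eta>)\<^sup>2 * (\<Sum>m\<in>{1..D}. 1 / max (real m) A ^ (2 * k - 2))"
      proof -
        have "2 * k - 2 = (k - 1) * 2" by simp
        then show ?thesis
          unfolding b_def by (simp add: sum_distrib_left power_mult power_mult_distrib power_divide)
      qed
      also have "\<dots> \<le> C0 * (real N ^ (k - 2) / \<eta>)\<^sup>2 * (3 / A ^ (2 * k - 2 - 1))"
        using C0 k3 by (intro mult_left_mono sum_inverse_max_power A) auto
      \<comment> \<open>The factor N^(2k-4) from the weights cancels the one in A^(2k-3), because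
        alpha(k) (2k - 3) = 2k - 4.\<close>
      also have "\<dots> = C / T ^ (2 * k - 3)"
      proof -
        have "2 * k - 2 - 1 = 2 * k - 3" by simp
        then have "A ^ (2 * k - 2 - 1) = real N ^ (2 * k - 4) * T ^ (2 * k - 3)"
          unfolding A_def power_mult_distrib using powr_alpha_power N by simp
        moreover have "(real N ^ (k - 2) / \<eta>)\<^sup>2 = real N ^ (2 * k - 4) / \<eta>\<^sup>2"
        proof -
          have "(k - 2) * 2 = 2 * k - 4" by simp
          then show ?thesis by (simp add: power_divide flip: power_mult)
        qed
        ultimately show ?thesis unfolding C_def using N by simp
      qed
      finally show ?case .
    qed
  qed
  then show ?thesis using \<delta>(1,2) by blast
qed

end

section \<open>Walks with independent increments and their Gaussian limits\<close>

text \<open>Time and level are explicit arguments, not a history, so the walk can be restarted at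
  any grid time from any level.\<close>

primrec indep_hit :: "(nat \<Rightarrow> nat pmf) \<Rightarrow> (nat \<Rightarrow> real \<Rightarrow> bool) \<Rightarrow> nat \<Rightarrow> nat \<Rightarrow> real \<Rightarrow> real" where
  "indep_hit q B 0 i y = of_bool (B i y)"
| "indep_hit q B (Suc n) i y =
     (if B i y then 1 else measure_pmf.expectation (q i) (\<lambda>c. indep_hit q B n (Suc i) (y + real c - 1)))"

primrec increment_sum :: "(nat \<Rightarrow> nat pmf) \<Rightarrow> nat \<Rightarrow> nat \<Rightarrow> real pmf" where
  "increment_sum q 0 i = return_pmf 0"
| "increment_sum q (Suc n) i =
    bind_pmf (q i) (\<lambda>c. map_pmf (\<lambda>s. (real c - 1) + s) (increment_sum q n (Suc i)))"

lemma indep_hit_bounds: "0 \<le> indep_hit q B n i y" "indep_hit q B n i y \<le> 1"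
proof -
  have "0 \<le> indep_hit q B n i y \<and> indep_hit q B n i y \<le> 1"
    by (induction n arbitrary: i y) (auto simp: expectation_pmf_ge_0_le_1)
  then show "0 \<le> indep_hit q B n i y" "indep_hit q B n i y \<le> 1" by auto
qed

lemma indep_hit_eq_1: "B i y \<Longrightarrow> indep_hit q B n i y = 1"
  by (cases n) auto

lemma indep_hit_antimono:
  assumes "\<And>i y y'. y \<le> y' \<Longrightarrow> B i y' \<Longrightarrow> B i y"
  shows "y \<le> y' \<Longrightarrow> indep_hit q B n i y' \<le> indep_hit q B n i y"
proof (induction n arbitrary: i y y')
  case 0
  then show ?case using assms[of y y' i] by auto
next
  case (Suc n)
  show ?case
  proof (cases "B i y")
    case True
    then show ?thesis using indep_hit_bounds(2)[of q B "Suc n" i y'] by simp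
  next
    case False
    then have "\<not> B i y'" using assms Suc.prems by blast
    then show ?thesis
      using False Suc by (auto intro!: expectation_pmf_mono_bounded indep_hit_bounds)
  qed
qed

lemma indep_hit_mono_set:
  assumes "\<And>i y. B i y \<Longrightarrow> B' i y"
  shows "indep_hit q B n i y \<le> indep_hit q B' n i y"
proof (induction n arbitrary: i y)
  case 0
  then show ?case using assms[of i y] by auto
next
  case (Suc n)
  show ?case
  proof (cases "B' i y")
    case True
    then show ?thesis using indep_hit_bounds(2)[of q B "Suc n" i y] by simp
  next
    case False
    then have "\<not> B i y" using assms by blast
    then show ?thesis
      using False Suc by (auto intro!: expectation_pmf_mono_bounded indep_hit_bounds)
  qed
qed

lemma indep_hit_shift: "indep_hit q (\<lambda>i y. B i (y - a)) n i y = indep_hit q B n i (y - a)"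
proof (induction n arbitrary: i y)
  case (Suc n)
  have "y + real c - 1 - a = y - a + real c - 1" for c by simp
  then show ?case by (simp only: indep_hit.simps Suc)
qed simp

text \<open>Strong Markov property at the first visit to \<open>B\<close>: from there
  \<open>G\<close> is reached with probability at least 1 - kappa in the remaining time. The horizon
  L is fixed, so that L - i steps remain at time i.\<close>

lemma indep_hit_compare:
  assumes "0 \<le> \<kappa>" and "\<And>i y. i \<le> L \<Longrightarrow> B i y \<Longrightarrow> 1 - \<kappa> \<le> indep_hit q G (L - i) i y"
  shows "i + n = L \<Longrightarrow> indep_hit q B n i y \<le> indep_hit q G n i y + \<kappa>"
proof (induction n arbitrary: i y)
  case 0
  then show ?case using assms(1) assms(2)[of i y] by auto
next
  case (Suc n)
  show ?case
  proof (cases "B i y \<or> G i y")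
    case True
    then show ?thesis
    proof
      assume "B i y"
      then have "1 - \<kappa> \<le> indep_hit q G (Suc n) i y" using assms(2)[of i y] Suc.prems by auto
      then show ?thesis using indep_hit_bounds(2)[of q B "Suc n" i y] by linarith
    next
      assume "G i y"
      then show ?thesis using indep_hit_bounds(2)[of q B "Suc n" i y] assms(1) by simp
    qed
  next
    case False
    let ?E = "measure_pmf.expectation (q i)"
    have i: "integrable (q i) (\<lambda>c. indep_hit q B n (Suc i) (y + real c - 1))"
      "integrable (q i) (\<lambda>c. indep_hit q G n (Suc i) (y + real c - 1))"
      by (intro integrable_pmf_bounded[where B = 1]; simp add: abs_of_nonneg indep_hit_bounds)+
    have "?E (\<lambda>c. indep_hit q B n (Suc i) (y + real c - 1)) \<le>
        ?E (\<lambda>c. indep_hit q G n (Suc i) (y + real c - 1) + \<kappa>)"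
      using Suc i by (intro integral_mono) auto
    also have "\<dots> = ?E (\<lambda>c. indep_hit q G n (Suc i) (y + real c - 1)) + \<kappa>"
      using i by simp
    finally show ?thesis using False by simp
  qed
qed

text \<open>Being at most e at time t suffices, because \<open>G\<close> holds there; missing it
  costs no more than the second moment of the level at t divided by e^2. Binomial variances are
  bounded by the means.\<close>

lemma indep_hit_ge_chebyshev:
  fixes e :: real
  assumes q: "\<And>m. q m = binomial_pmf (nn m) (pp m)" and pp: "\<And>m. pp m \<in> {0..1}"
    and e: "0 < e" and G: "\<And>y. y \<le> e \<Longrightarrow> G t y"
  shows "i \<le> t \<Longrightarrow> t \<le> i + n \<Longrightarrow>
    1 - indep_hit q G n i y \<le> ((y + (\<Sum>m\<in>{i..<t}. real (nn m) * pp m - 1))\<^sup>2 + (\<Sum>m\<in>{i..<t}. real (nn m) *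
        pp m)) / e\<^sup>2"
proof (induction n arbitrary: i y)
  case 0
  then have t: "t = i" by simp
  show ?case
  proof (cases "y \<le> e")
    case True
    then show ?thesis using G t by (simp add: indep_hit_eq_1)
  next
    case False
    then have "1 \<le> y\<^sup>2 / e\<^sup>2" using e by (simp add: power_mono)
    then show ?thesis using t by simp
  qed
next
  case (Suc n)
  let ?a = "\<lambda>m. real (nn m) * pp m - 1" and ?v = "\<lambda>m. real (nn m) * pp m"
  have v0: "0 \<le> (\<Sum>m\<in>S. ?v m)" for S using pp by (intro sum_nonneg) auto
  consider "G i y" | "i = t" "\<not> G i y" | "i < t" "\<not> G i y" using Suc.prems by linarith
  then show ?case
  proof cases
    case 1
    then show ?thesis using v0 by simp
  next
    case 2
    then have "e < y" using G by (meson not_le)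
    then have "1 \<le> y\<^sup>2 / e\<^sup>2" using e by (simp add: power_mono)
    then show ?thesis using 2 indep_hit_bounds(1)[of q G "Suc n" i y] by (simp del: indep_hit.simps)
  next
    case 3
    let ?E = "measure_pmf.expectation (q i)"
    let ?A = "\<Sum>m\<in>{Suc i..<t}. ?a m" and ?V = "\<Sum>m\<in>{Suc i..<t}. ?v m"
    have fin: "finite (set_pmf (q i))" unfolding q using pp by (intro finite_set_pmf_binomial_pmf)
    have int: "integrable (q i) f" for f :: "nat \<Rightarrow> real" using fin
        by (rule integrable_measure_pmf_finite)
    have "1 - indep_hit q G (Suc n) i y = ?E (\<lambda>c. 1 - indep_hit q G n (Suc i) (y + real c - 1))"
      using 3 int by simp
    also have "\<dots> \<le> ?E (\<lambda>c. (((y + real c - 1) + ?A)\<^sup>2 + ?V) / e\<^sup>2)"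
      using Suc 3 fin by (intro expectation_pmf_mono) auto
    also have "\<dots> = (?E (\<lambda>c. (real c + (y - 1 + ?A))\<^sup>2) + ?V) / e\<^sup>2"
      using int by (simp add: algebra_simps)
    also have "?E (\<lambda>c. (real c + (y - 1 + ?A))\<^sup>2) =
        (real (nn i) * pp i + (y - 1 + ?A))\<^sup>2 + ?v i * (1 - pp i)"
      unfolding q by (rule expectation_binomial_square[OF pp])
    also have "((real (nn i) * pp i + (y - 1 + ?A))\<^sup>2 + ?v i * (1 - pp i) + ?V) / e\<^sup>2 \<le>
       ((y + (\<Sum>m\<in>{i..<t}. ?a m))\<^sup>2 + (\<Sum>m\<in>{i..<t}. ?v m)) / e\<^sup>2"
    proof (rule divide_right_mono)
      have v: "?v i * (1 - pp i) \<le> ?v i" using pp[of i] by (simp add: mult_left_le)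
      have S: "(\<Sum>m\<in>{i..<t}. ?a m) = ?a i + ?A" "(\<Sum>m\<in>{i..<t}. ?v m) = ?v i + ?V"
        using 3 by (simp_all add: sum.atLeast_Suc_lessThan)
      have y: "real (nn i) * pp i + (y - 1 + ?A) = y + (?a i + ?A)" by simp
      show "(real (nn i) * pp i + (y - 1 + ?A))\<^sup>2 + ?v i * (1 - pp i) + ?V \<le>
          (y + (\<Sum>m\<in>{i..<t}. ?a m))\<^sup>2 + (\<Sum>m\<in>{i..<t}. ?v m)"
        unfolding S y using v by linarith
    qed simp
    finally show ?thesis .
  qed
qed

lemma finite_set_increment_sum:
  assumes "\<And>m. finite (set_pmf (q m))"
  shows "finite (set_pmf (increment_sum q n i))"
  using assms by (induction n arbitrary: i) auto

lemma expectation_bind_pmf_finite: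
  fixes h :: "'b \<Rightarrow> 'c :: {banach, second_countable_topology}"
  assumes "finite (set_pmf p)" "\<And>x. finite (set_pmf (f x))"
  shows "measure_pmf.expectation (bind_pmf p f) h =
      measure_pmf.expectation p (\<lambda>x. measure_pmf.expectation (f x) h)"
proof -
  have "measure_pmf.expectation (bind_pmf p f) h =
      (\<Sum>a\<in>set_pmf p. pmf p a *\<^sub>R measure_pmf.expectation (f a) h)"
    using assms by (intro pmf_expectation_bind) auto
  also have "\<dots> = measure_pmf.expectation p (\<lambda>x. measure_pmf.expectation (f x) h)"
    using assms(1) by (subst integral_measure_pmf[where A = "set_pmf p"]) auto
  finally show ?thesis .
qed

text \<open>Between consecutive barrier times only the total increment matters. The end of the block
  is tested by the remaining walk, so an empty block needs no condition at its start.\<close>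

lemma indep_hit_block:
  assumes fin: "\<And>m. finite (set_pmf (q m))"
  shows "(n = 0 \<or> \<not> B i y) \<Longrightarrow> (\<And>j y. i < j \<Longrightarrow> j < i + n \<Longrightarrow> \<not> B j y) \<Longrightarrow>
    indep_hit q B (n + n') i y =
        measure_pmf.expectation (increment_sum q n i) (\<lambda>s. indep_hit q B n' (i + n) (y + s))"
proof (induction n arbitrary: i y)
  case (Suc n)
  let ?E = "measure_pmf.expectation"
  have "indep_hit q B (Suc n + n') i y = ?E (q i) (\<lambda>c. indep_hit q B (n + n') (Suc i) (y + real c - 1))"
    using Suc.prems(1) by simp
  also have "\<dots> = ?E (q i) (\<lambda>c. ?E (increment_sum q n (Suc i)) (\<lambda>s. indep_hit q B n' (i + Suc n) (y +
      ((real c - 1) + s))))"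
  proof (intro Bochner_Integration.integral_cong refl)
    fix c
    have "indep_hit q B (n + n') (Suc i) (y + real c - 1) =
       ?E (increment_sum q n (Suc i)) (\<lambda>s. indep_hit q B n' (Suc i + n) ((y + real c - 1) + s))"
    proof (rule Suc.IH)
      show "n = 0 \<or> \<not> B (Suc i) (y + real c - 1)" using Suc.prems(2)[of "Suc i"] by (cases n) auto
    qed (use Suc.prems(2) in auto)
    then show "indep_hit q B (n + n') (Suc i) (y + real c - 1) =
       ?E (increment_sum q n (Suc i)) (\<lambda>s. indep_hit q B n' (i + Suc n) (y + ((real c - 1) + s)))"
      by (simp add: algebra_simps)
  qed
  also have "\<dots> = ?E (increment_sum q (Suc n) i) (\<lambda>s. indep_hit q B n' (i + Suc n) (y + s))"
    using fin finite_set_increment_sum[OF fin] by (simp add: expectation_bind_pmf_finite)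
  finally show ?case .
qed simp

lemma indep_hit_eq_0: "(\<And>j y. i \<le> j \<Longrightarrow> \<not> B j y) \<Longrightarrow> indep_hit q B n i y = 0"
  by (induction n arbitrary: i y) auto

text \<open>Independence turns the transform of the sum into a product; the last factor collects the
  n deterministic steps of size -1.\<close>

lemma increment_sum_iexp:
  assumes q: "\<And>m. q m = binomial_pmf (nn m) (pp m)" and pp: "\<And>m. pp m \<in> {0..1}"
  shows "measure_pmf.expectation (increment_sum q n i) (\<lambda>s. iexp (t * s)) =
    (\<Prod>m\<in>{i..<i + n}. (1 + of_real (pp m) * (iexp t - 1)) ^ nn m) * iexp (- (real n * t))"
proof (induction n arbitrary: i)
  case (Suc n)
  let ?E = "measure_pmf.expectation"
  let ?g = "\<lambda>m. (1 + of_real (pp m) * (iexp t - 1)) ^ nn m"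
  have fin: "finite (set_pmf (q m))" for m unfolding q using pp by (intro finite_set_pmf_binomial_pmf)
  have "?E (increment_sum q (Suc n) i) (\<lambda>s. iexp (t * s)) =
      ?E (q i) (\<lambda>c. ?E (increment_sum q n (Suc i)) (\<lambda>s. iexp (t * ((real c - 1) + s))))"
    using fin finite_set_increment_sum[OF fin] by (simp add: expectation_bind_pmf_finite)
  also have "\<dots> = ?E (q i) (\<lambda>c. iexp (t * real c) * (iexp (- t) *
      ?E (increment_sum q n (Suc i)) (\<lambda>s. iexp (t * s))))"
  proof (intro Bochner_Integration.integral_cong refl)
    fix c
    have "iexp (t * ((real c - 1) + s)) = iexp (t * real c) * iexp (- t) * iexp (t * s)" for s
      by (simp add: algebra_simps flip: exp_add)
    then show "?E (increment_sum q n (Suc i)) (\<lambda>s. iexp (t * ((real c - 1) + s))) =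
       iexp (t * real c) * (iexp (- t) * ?E (increment_sum q n (Suc i)) (\<lambda>s. iexp (t * s)))" by simp
  qed
  also have "\<dots> = ?g i * (iexp (- t) * ?E (increment_sum q n (Suc i)) (\<lambda>s. iexp (t * s)))"
    unfolding q by (subst integral_mult_left_zero) (simp only: expectation_binomial_iexp[OF pp])
  also have "\<dots> = (?g i * (\<Prod>m\<in>{Suc i..<Suc i + n}. ?g m)) * (iexp (- t) * iexp (- (real n * t)))"
    unfolding Suc by (simp only: mult_ac)
  also have "?g i * (\<Prod>m\<in>{Suc i..<Suc i + n}. ?g m) = (\<Prod>m\<in>{i..<i + Suc n}. ?g m)"
    by (simp add: prod.atLeast_Suc_lessThan)
  also have "iexp (- t) * iexp (- (real n * t)) = iexp (- (real (Suc n) * t))"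
    by (simp add: algebra_simps flip: exp_add)
  finally show ?case .
qed simp

section \<open>Monotone functions under weak convergence\<close>

lemma antimono_borel_measurable: "antimono (f :: real \<Rightarrow> real) \<Longrightarrow> f \<in> borel_measurable borel"
proof -
  assume "antimono f"
  then have "mono (\<lambda>x. - f x)" by (auto simp: monotone_on_def)
  then have "(\<lambda>x. - f x) \<in> borel_measurable borel" by (rule borel_measurable_mono)
  then show ?thesis by simp
qed

text \<open>Monotonicity replaces uniformity: \<open>fN n (zN n)\<close> is squeezed between the
  values of \<open>fN n\<close> at two fixed points close to z, where pointwise convergence
  applies.\<close>

lemma antimono_converge_at_continuity:
  fixes f :: "real \<Rightarrow> real"
  assumes fN: "\<And>n. antimono (fN n)" and lim: "\<And>x. (\<lambda>n. fN n x) \<longlonglongrightarrow> f x"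
    and cont: "isCont f z" and z: "zN \<longlonglongrightarrow> z"
  shows "(\<lambda>n. fN n (zN n)) \<longlonglongrightarrow> f z"
proof (rule tendstoI)
  fix e :: real assume e: "0 < e"
  from cont obtain d where d: "0 < d" "\<And>x. dist x z < d \<Longrightarrow> dist (f x) (f z) < e / 2"
    unfolding continuous_at_eps_delta using e by (metis half_gt_zero)
  let ?a = "z - d / 2" and ?b = "z + d / 2"
  have ab: "dist (f ?a) (f z) < e / 2" "dist (f ?b) (f z) < e / 2"
    using d(1) by (intro d(2); simp add: dist_real_def)+
  have "\<forall>\<^sub>F n in sequentially. dist (fN n ?a) (f ?a) <
      e / 2" "\<forall>\<^sub>F n in sequentially. dist (fN n ?b) (f ?b) < e / 2"
    using lim e by (intro tendstoD; simp)+
  moreover have "\<forall>\<^sub>F n in sequentially. dist (zN n) z < d / 2" using z d(1) by (intro tendstoD) auto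
  ultimately show "\<forall>\<^sub>F n in sequentially. dist (fN n (zN n)) (f z) < e"
  proof eventually_elim
    case (elim n)
    have "?a \<le> zN n" "zN n \<le> ?b" using elim(3) unfolding dist_real_def by linarith+
    then have "fN n (zN n) \<le> fN n ?a" "fN n ?b \<le> fN n (zN n)" using fN[of n] by (auto dest: antimonoD)
    then show ?case using ab elim(1,2) unfolding dist_real_def by linarith
  qed
qed

text \<open>A monotone function has only countably many jumps, and the Gaussian law has a
  density.\<close>

lemma AE_std_normal_isCont_antimono:
  fixes f :: "real \<Rightarrow> real"
  assumes "antimono f"
  shows "AE x in std_normal_distribution. isCont f x"
proof -
  have "mono (\<lambda>x. - f x)" using assms by (auto simp: monotone_on_def)
  then have "countable {x. \<not> isCont (\<lambda>x. - f x) x}" by (rule mono_ctble_discont)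
  moreover have "isCont (\<lambda>x. - f x) x \<longleftrightarrow> isCont f x" for x
    using continuous_minus[of "at x" f] continuous_minus[of "at x" "\<lambda>x. - f x"] by auto
  ultimately have "countable {x. \<not> isCont f x}" by simp
  then have "{x. \<not> isCont f x} \<in> null_sets lborel" by (rule countable_imp_null_set_lborel)
  then have "AE x in lborel. isCont f x" using AE_not_in[of "{x. \<not> isCont f x}" lborel] by simp
  then show ?thesis by (subst AE_density) auto
qed

text \<open>Integrand and law vary together. Skorohod's representation makes the convergence in law
  pointwise, the functions then converge off the jumps of the limit, and dominated convergence
  applies since they are bounded by 1.\<close>

lemma weak_conv_integral_antimono:
  fixes f :: "real \<Rightarrow> real"
  assumes \<mu>: "\<And>n. real_distribution (\<mu> n)" and w: "weak_conv_m \<mu> std_normal_distribution"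
    and fN: "\<And>n. antimono (fN n)" "\<And>n x. 0 \<le> fN n x" "\<And>n x. fN n x \<le> 1"
    and f: "antimono f" and lim: "\<And>x. (\<lambda>n. fN n x) \<longlonglongrightarrow> f x"
  shows "(\<lambda>n. \<integral>x. fN n x \<partial>\<mu> n) \<longlonglongrightarrow> (\<integral>x. f x \<partial>std_normal_distribution)"
proof -
  obtain \<Omega> :: "real measure" and Yn Y where P: "prob_space \<Omega>"
    and Yn: "\<And>n. Yn n \<in> measurable \<Omega> borel" "\<And>n. distr \<Omega> borel (Yn n) = \<mu> n"
    and Y: "Y \<in> measurable \<Omega> lborel" "distr \<Omega> borel Y = std_normal_distribution"
    and conv: "\<And>x. x \<in> space \<Omega> \<Longrightarrow> (\<lambda>n. Yn n x) \<longlonglongrightarrow> Y x"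
    using Skorohod[OF \<mu> real_dist_normal_dist w] by blast
  have Y': "Y \<in> measurable \<Omega> borel" using Y(1) by simp
  interpret prob_space \<Omega> by (rule P)
  have m: "f \<in> borel_measurable borel" "\<And>n. fN n \<in> borel_measurable borel"
    using f fN(1) by (auto intro: antimono_borel_measurable)
  have "(\<lambda>n. \<integral>\<omega>. fN n (Yn n \<omega>) \<partial>\<Omega>) \<longlonglongrightarrow> (\<integral>\<omega>. f (Y \<omega>) \<partial>\<Omega>)"
  proof (rule integral_dominated_convergence[where w = "\<lambda>_. 1"])
    show "(\<lambda>\<omega>. f (Y \<omega>)) \<in> borel_measurable \<Omega>" by (rule measurable_compose[OF Y' m(1)])
    show "(\<lambda>\<omega>. fN n (Yn n \<omega>)) \<in> borel_measurable \<Omega>" for n by (rule measurable_compose[OF Yn(1) m(2)])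
    have "AE x in distr \<Omega> borel Y. isCont f x"
      unfolding Y(2) by (rule AE_std_normal_isCont_antimono[OF f])
    then have "AE \<omega> in \<Omega>. isCont f (Y \<omega>)" by (rule AE_distrD[OF Y'])
    then show "AE \<omega> in \<Omega>. (\<lambda>n. fN n (Yn n \<omega>)) \<longlonglongrightarrow> f (Y \<omega>)"
      using AE_space by eventually_elim (rule antimono_converge_at_continuity[OF fN(1) lim _ conv])
    show "AE \<omega> in \<Omega>. norm (fN n (Yn n \<omega>)) \<le> 1" for n using fN(2,3) by auto
  qed simp
  moreover have "(\<integral>\<omega>. fN n (Yn n \<omega>) \<partial>\<Omega>) = (\<integral>x. fN n x \<partial>\<mu> n)" for n
    unfolding Yn(2)[symmetric] by (rule integral_distr[OF Yn(1) m(2), symmetric])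
  moreover have "(\<integral>\<omega>. f (Y \<omega>) \<partial>\<Omega>) = (\<integral>x. f x \<partial>std_normal_distribution)"
    unfolding Y(2)[symmetric] by (rule integral_distr[OF Y' m(1), symmetric])
  ultimately show ?thesis by simp
qed

lemma integrable_std_normal_bounded:
  fixes u :: "real \<Rightarrow> real"
  assumes "u \<in> borel_measurable borel" "\<And>x. \<bar>u x\<bar> \<le> B"
  shows "integrable std_normal_distribution u"
proof -
  interpret real_distribution std_normal_distribution by (rule real_dist_normal_dist)
  show ?thesis by (rule integrable_const_bound[where B = B]) (use assms in auto)
qed

text \<open>The density of the standard normal law is at most 1, and a monotone function with values in
  the unit interval changes by at most \<open>\<delta>\<close> in \<open>L\<^sup>1\<close> under a translation by \<open>\<delta>\<close>.\<close>

lemma std_normal_shift_antimono_le: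
  fixes u :: "real \<Rightarrow> real"
  assumes u: "antimono u" "\<And>x. 0 \<le> u x" "\<And>x. u x \<le> 1" and \<delta>: "0 \<le> \<delta>"
  shows "(\<integral>x. u (x - \<delta>) \<partial>std_normal_distribution) - (\<integral>x. u x \<partial>std_normal_distribution) \<le> \<delta>"
proof -
  have mu [measurable]: "u \<in> borel_measurable borel" using u(1) by (rule antimono_borel_measurable)
  define w where "w = (\<lambda>x. u (x - \<delta>) - u x)"
  have w: "0 \<le> w x" "w x \<le> 1" for x
    unfolding w_def using antimonoD[OF u(1), of "x - \<delta>" x] \<delta> u(2)[of x] u(3)[of "x - \<delta>"] by auto
  have mw [measurable]: "w \<in> borel_measurable borel" unfolding w_def by measurable
  have "(\<integral>x. u (x - \<delta>) \<partial>std_normal_distribution) - (\<integral>x. u x \<partial>std_normal_distribution) =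
     (\<integral>x. w x \<partial>std_normal_distribution)"
    unfolding w_def using u
    by (intro Bochner_Integration.integral_diff[symmetric] integrable_std_normal_bounded[where B =
        1]; simp)
  also have "\<dots> = (\<integral>x. std_normal_density x * w x \<partial>lborel)"
    by (subst integral_density) auto
  finally have eq: "(\<integral>x. u (x - \<delta>) \<partial>std_normal_distribution) - (\<integral>x. u x \<partial>std_normal_distribution) =
     (\<integral>x. std_normal_density x * w x \<partial>lborel)" .
  have dens: "std_normal_density x \<le> 1" for x :: real
  proof -
    have "1 \<le> sqrt (2 * pi)" using pi_gt3 by (intro real_le_rsqrt) auto
    then have "1 / sqrt (2 * pi) \<le> 1" by simp
    moreover have "exp (- x\<^sup>2 / 2) \<le> 1" by simp
    ultimately have "1 / sqrt (2 * pi) * exp (- x\<^sup>2 / 2) \<le> 1 * 1" by (intro mult_mono) auto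
    then show ?thesis by (simp add: std_normal_density_def)
  qed
  \<comment> \<open>The function u need not be Lebesgue integrable, so the translation is carried
    out on bounded windows.\<close>
  let ?J = "\<lambda>n::nat. {- real n .. real n}"
  have "(\<lambda>n. \<integral>x. indicator (?J n) x * (std_normal_density x * w x) \<partial>lborel) \<longlonglongrightarrow>
      (\<integral>x. std_normal_density x * w x \<partial>lborel)"
  proof (rule integral_dominated_convergence[where w = std_normal_density])
    show "AE x in lborel. (\<lambda>n. indicator (?J n) x * (std_normal_density x * w x)) \<longlonglongrightarrow>
        std_normal_density x * w x"
    proof (rule AE_I2)
      fix x :: real
      obtain n0 :: nat where n0: "\<bar>x\<bar> \<le> real n0" using real_arch_simple by blast
      have "\<forall>\<^sub>F n in sequentially. indicator (?J n) x * (std_normal_density x * w x) =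
          std_normal_density x * w x"
        using eventually_ge_at_top[of n0] by eventually_elim (use n0 in \<open>auto simp: indicator_def\<close>)
      then show "(\<lambda>n. indicator (?J n) x * (std_normal_density x * w x)) \<longlonglongrightarrow> std_normal_density x * w x"
        by (rule tendsto_eventually)
    qed
    show "AE x in lborel. norm (indicator (?J n) x * (std_normal_density x * w x)) \<le>
        std_normal_density x" for n
      using w by (intro AE_I2) (auto simp: indicator_def mult_left_le)
  qed auto
  then show ?thesis
    unfolding eq
  proof (rule LIMSEQ_le_const2, intro exI[of _ 0] allI impI)
    fix n :: nat
    have int: "integrable lborel (\<lambda>x. indicator {a..b} x * v x)"
      if "v \<in> borel_measurable borel" "\<And>x. \<bar>v x\<bar> \<le> 1" for a b :: real and v :: "real \<Rightarrow> real"
    proof (rule Bochner_Integration.integrable_bound)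
      show "integrable lborel (indicator {a..b} :: real \<Rightarrow> real)"
        by (rule integrable_real_indicator) (auto simp: emeasure_lborel_Icc_eq)
      show "AE x in lborel. norm (indicator {a..b} x * v x) \<le> norm (indicator {a..b} x :: real)"
        using that(2) by (intro AE_I2) (auto simp: indicator_def)
    qed (use that in auto)
    have u1: "\<bar>u x\<bar> \<le> 1" "\<bar>w x\<bar> \<le> 1" for x using u w
        by (auto simp: abs_le_iff intro: order.trans[of _ 0])
    have "(\<integral>x. indicator (?J n) x * (std_normal_density x * w x) \<partial>lborel) \<le>
        (\<integral>x. indicator (?J n) x * w x \<partial>lborel)"
    proof (rule integral_mono)
      have "\<bar>std_normal_density x * w x\<bar> \<le> 1" for x
        using dens[of x] w[of x] by (simp add: abs_mult mult_le_one)
      then show "integrable lborel (\<lambda>x. indicator (?J n) x * (std_normal_density x * w x))"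
          by (intro int) auto
      show "integrable lborel (\<lambda>x. indicator (?J n) x * w x)" by (intro int u1) auto
      show "indicator (?J n) x * (std_normal_density x * w x) \<le> indicator (?J n) x * w x" for x
        using dens[of x] w[of x] by (auto simp: indicator_def mult_left_le_one_le)
    qed
    also have "(\<integral>x. indicator (?J n) x * w x \<partial>lborel) =
       (\<integral>x. indicator (?J n) x * u (x - \<delta>) \<partial>lborel) - (\<integral>x. indicator (?J n) x * u x \<partial>lborel)"
      unfolding w_def right_diff_distrib by (intro Bochner_Integration.integral_diff int) (auto simp: u1)
    also have "(\<integral>x. indicator (?J n) x * u (x - \<delta>) \<partial>lborel) =
        (\<integral>x. indicator {- real n - \<delta>..real n - \<delta>} x * u x \<partial>lborel)"
    proof -
      have "(\<integral>x. indicator (?J n) x * u (x - \<delta>) \<partial>lborel) =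
         (\<integral>x. indicator (?J n) (\<delta> + 1 * x) * u (\<delta> + 1 * x - \<delta>) \<partial>lborel)"
        by (subst lborel_integral_real_affine[where c = 1 and t = \<delta>]) auto
      also have "\<dots> = (\<integral>x. indicator {- real n - \<delta>..real n - \<delta>} x * u x \<partial>lborel)"
        by (intro Bochner_Integration.integral_cong refl) (auto simp: indicator_def)
      finally show ?thesis .
    qed
    also have "\<dots> - (\<integral>x. indicator (?J n) x * u x \<partial>lborel) =
       (\<integral>x. indicator {- real n - \<delta>..real n - \<delta>} x * u x - indicator (?J n) x * u x \<partial>lborel)"
      by (intro Bochner_Integration.integral_diff[symmetric] int) (auto simp: u1)
    \<comment> \<open>The two windows differ by an interval of length delta at each end; the left
      one contributes at most its length, and the right one enters with a minus sign.\<close>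
    also have "\<dots> \<le> (\<integral>x. indicator {- real n - \<delta>..- real n} x * 1 \<partial>lborel)"
    proof (rule integral_mono)
      show "indicator {- real n - \<delta>..real n - \<delta>} x * u x - indicator (?J n) x * u x \<le>
          indicator {- real n - \<delta>..- real n} x * 1" for x
        using u(2,3)[of x] \<delta> by (auto simp: indicator_def)
      show "integrable lborel (\<lambda>x. indicator {- real n - \<delta>..real n - \<delta>} x * u x - indicator (?J n) x *
          u x)"
        by (intro Bochner_Integration.integrable_diff int) (auto simp: u1)
      show "integrable lborel (\<lambda>x. indicator {- real n - \<delta>..- real n} x * 1 :: real)"
        by (intro int) auto
    qed
    also have "\<dots> = \<delta>" using \<delta> by simp
    finally show "(\<integral>x. indicator (?J n) x * (std_normal_density x * w x) \<partial>lborel) \<le> \<delta>" .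
  qed
qed

section \<open>Central limit theorem for blocks of binomial steps\<close>

lemma norm_iexp_minus_1: "cmod (iexp \<theta> - 1) \<le> \<bar>\<theta>\<bar>" "cmod (iexp \<theta> - 1) \<le> 2"
proof -
  show "cmod (iexp \<theta> - 1) \<le> \<bar>\<theta>\<bar>" using iexp_approx1[where x = \<theta> and n = 0] by simp
  show "cmod (iexp \<theta> - 1) \<le> 2" using norm_triangle_ineq4[of "iexp \<theta>" 1] by simp
qed

text \<open>Poissonisation of a single trial: with w = p (e^(i theta) - 1), the numbers 1 + w and
  exp w agree to first order, and both have modulus at most 1, so errors add up along products. The
  factor exp 2 comes from the Taylor remainder, as |w| is at most 2.\<close>

lemma binomial_char_vs_poisson_char:
  fixes p :: real
  assumes p: "p \<in> {0..1}"
  shows "cmod (1 + of_real p * (iexp \<theta> - 1)) \<le> 1" "cmod (exp (of_real p * (iexp \<theta> - 1))) \<le> 1"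
    "cmod ((1 + of_real p * (iexp \<theta> - 1)) - exp (of_real p * (iexp \<theta> - 1))) \<le> exp 2 * (p\<^sup>2 * \<theta>\<^sup>2)"
proof -
  let ?w = "of_real p * (iexp \<theta> - 1) :: complex"
  have "1 + ?w = of_real (1 - p) + of_real p * iexp \<theta>" by (simp add: algebra_simps)
  then have "cmod (1 + ?w) \<le> cmod (of_real (1 - p)) + cmod (of_real p * iexp \<theta>)"
      by (metis norm_triangle_ineq)
  also have "\<dots> = 1" using p by (simp add: norm_mult del: of_real_diff)
  finally show "cmod (1 + ?w) \<le> 1" .
  have re: "Re ?w = p * (cos \<theta> - 1)" by (simp add: Re_exp)
  have "Re ?w \<le> 0" unfolding re using p by (simp add: mult_nonneg_nonpos)
  then show "cmod (exp ?w) \<le> 1" by simp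
  have w1: "cmod ?w \<le> p * \<bar>\<theta>\<bar>" "cmod ?w \<le> 2"
  proof -
    show "cmod ?w \<le> p * \<bar>\<theta>\<bar>" using p norm_iexp_minus_1(1)[of \<theta>] by (simp add: norm_mult mult_left_mono)
    have "cmod ?w \<le> 1 * 2" using p norm_iexp_minus_1(2)[of \<theta>] unfolding norm_mult
        by (intro mult_mono) auto
    then show "cmod ?w \<le> 2" by simp
  qed
  have "cmod (exp ?w - (1 + ?w)) \<le> exp \<bar>Re ?w\<bar> * (cmod ?w)\<^sup>2"
    using Taylor_exp[of ?w 1] by (simp add: numeral_2_eq_2)
  also have "\<dots> \<le> exp 2 * (p * \<bar>\<theta>\<bar>)\<^sup>2"
    using w1 abs_Re_le_cmod[of ?w] by (intro mult_mono power_mono) auto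
  finally show "cmod ((1 + ?w) - exp ?w) \<le> exp 2 * (p\<^sup>2 * \<theta>\<^sup>2)"
    by (simp add: norm_minus_commute power_mult_distrib)
qed

text \<open>Under C the steps are nearly Poisson, so variances are close to means; by A the means
  add up to n + O(sigma), and B turns this into variance s^2 on the scale sigma. A also supplies the
  limiting mean d.\<close>

lemma binomial_block_clt:
  fixes nn :: "nat \<Rightarrow> nat \<Rightarrow> nat" and pp :: "nat \<Rightarrow> nat \<Rightarrow> real"
  assumes pp: "\<And>N m. pp N m \<in> {0..1}" and s: "0 < s" and \<sigma>: "filterlim \<sigma> at_top sequentially"
    and A: "(\<lambda>N. (\<Sum>m\<in>{i0 N..<i0 N + n N}. real (nn N m) * pp N m - 1) / \<sigma> N) \<longlonglongrightarrow> d"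
    and B: "(\<lambda>N. real (n N) / (\<sigma> N)\<^sup>2) \<longlonglongrightarrow> s\<^sup>2"
    and C: "(\<lambda>N. (\<Sum>m\<in>{i0 N..<i0 N + n N}. real (nn N m) * (pp N m)\<^sup>2) / (\<sigma> N)\<^sup>2) \<longlonglongrightarrow> 0"
  shows "weak_conv_m (\<lambda>N. distr (measure_pmf (increment_sum (\<lambda>m. binomial_pmf (nn N m) (pp N m)) (n N)
      (i0 N))) borel
     (\<lambda>x. (x / \<sigma> N - d) / s)) std_normal_distribution"
proof (rule levy_continuity)
  let ?q = "\<lambda>N m. binomial_pmf (nn N m) (pp N m)"
  let ?D = "\<lambda>N. distr (measure_pmf (increment_sum (?q N) (n N) (i0 N))) borel (\<lambda>x. (x / \<sigma> N - d) / s)"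
  show "real_distribution (?D N)" for N
    by (intro prob_space.real_distribution_distr[OF prob_space_measure_pmf]) simp
  show "real_distribution std_normal_distribution" by (rule real_dist_normal_dist)
  fix t :: real
  define I where "I = (\<lambda>N. {i0 N..<i0 N + n N})"
  define \<theta> where "\<theta> = (\<lambda>N. t / (s * \<sigma> N))"
  define M where "M = (\<lambda>N. \<Sum>m\<in>I N. real (nn N m) * pp N m)"
  define V where "V = (\<lambda>N. \<Sum>m\<in>I N. real (nn N m) * (pp N m)\<^sup>2)"
  \<comment> \<open>Logarithm of the transform, centring included, after every binomial step has
    been replaced by a Poisson step.\<close>
  define Z where "Z = (\<lambda>N. of_real (M N) * (iexp (\<theta> N) - 1) - \<i> * (real (n N) * \<theta> N) - \<i> * (t *
      d / s) :: complex)"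
  have inv: "(\<lambda>N. inverse (\<sigma> N)) \<longlonglongrightarrow> 0" using \<sigma> by (rule tendsto_inverse_0_at_top)
  have \<theta>0: "\<theta> \<longlonglongrightarrow> 0"
    using tendsto_mult_left[OF inv, of "t / s"] by (simp add: \<theta>_def divide_simps)
  have Mn: "(\<lambda>N. (M N - real (n N)) / \<sigma> N) \<longlonglongrightarrow> d"
    using A by (simp add: M_def I_def sum_subtractf)
  have V0: "(\<lambda>N. V N / (\<sigma> N)\<^sup>2) \<longlonglongrightarrow> 0" using C by (simp add: V_def I_def)
  \<comment> \<open>M differs from n by O(sigma), which is negligible against sigma^2.\<close>
  have M2: "(\<lambda>N. M N * (\<theta> N)\<^sup>2) \<longlonglongrightarrow> t\<^sup>2"
  proof -
    have "(\<lambda>N. (t / s)\<^sup>2 * (((M N - real (n N)) / \<sigma> N) * inverse (\<sigma> N) + real (n N) / (\<sigma> N)\<^sup>2)) \<longlonglongrightarrow>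
        (t / s)\<^sup>2 * (d * 0 + s\<^sup>2)"
      by (intro tendsto_intros Mn inv B)
    moreover have "(t / s)\<^sup>2 * (((M N - real (n N)) / \<sigma> N) * inverse (\<sigma> N) + real (n N) / (\<sigma> N)\<^sup>2) =
        M N * (\<theta> N)\<^sup>2" for N
    proof -
      have "((M N - real (n N)) / \<sigma> N) * inverse (\<sigma> N) + real (n N) / (\<sigma> N)\<^sup>2 = M N / (\<sigma> N)\<^sup>2"
        by (simp add: power2_eq_square divide_inverse algebra_simps)
      then show ?thesis by (simp add: \<theta>_def power_divide power_mult_distrib)
    qed
    ultimately show ?thesis using s by (simp add: power_divide)
  qed
  have ch: "char (?D N) t = (\<Prod>m\<in>I N. (1 + of_real (pp N m) * (iexp (\<theta> N) - 1)) ^ nn N m) *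
      (iexp (- (real (n N) * \<theta> N)) * iexp (- (t * d / s)))" for N
  proof -
    have "char (?D N) t = measure_pmf.expectation (increment_sum (?q N) (n N) (i0 N)) (\<lambda>x. iexp (t *
        ((x / \<sigma> N - d) / s)))"
      unfolding char_def by (subst integral_distr) auto
    also have "\<dots> = measure_pmf.expectation (increment_sum (?q N) (n N) (i0 N)) (\<lambda>x. iexp (\<theta> N * x) *
        iexp (- (t * d / s)))"
    proof (intro Bochner_Integration.integral_cong refl)
      fix x
      have "t * ((x / \<sigma> N - d) / s) = \<theta> N * x + - (t * d / s)"
        by (simp add: \<theta>_def divide_inverse algebra_simps)
      then show "iexp (t * ((x / \<sigma> N - d) / s)) = iexp (\<theta> N * x) * iexp (- (t * d / s))"
        by (simp only: of_real_add distrib_left exp_add)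
    qed
    also have "\<dots> = measure_pmf.expectation (increment_sum (?q N) (n N) (i0 N)) (\<lambda>x. iexp (\<theta> N * x)) *
        iexp (- (t * d / s))"
      by (rule integral_mult_left_zero)
    finally show ?thesis
      unfolding I_def increment_sum_iexp[of "?q N" "nn N" "pp N", OF refl pp] by (simp only: mult.assoc)
  qed
  have diff: "cmod (char (?D N) t - exp (Z N)) \<le> exp 2 * (V N * (\<theta> N)\<^sup>2)" for N
  proof -
    let ?a = "\<lambda>m. 1 + of_real (pp N m) * (iexp (\<theta> N) - 1) :: complex"
    let ?b = "\<lambda>m. exp (of_real (pp N m) * (iexp (\<theta> N) - 1)) :: complex"
    let ?r = "iexp (- (real (n N) * \<theta> N)) * iexp (- (t * d / s))"
    note bd = binomial_char_vs_poisson_char[OF pp[of N], where \<theta> = "\<theta> N"]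
    \<comment> \<open>The Poisson factors merge into one exponential, which depends on the block
      only through the total mean M.\<close>
    have "(\<Prod>m\<in>I N. ?b m ^ nn N m) =
        exp (\<Sum>m\<in>I N. of_nat (nn N m) * (of_real (pp N m) * (iexp (\<theta> N) - 1)))"
      by (simp add: I_def exp_sum exp_of_nat_mult)
    also have "(\<Sum>m\<in>I N. of_nat (nn N m) * (of_real (pp N m) * (iexp (\<theta> N) - 1))) =
        of_real (M N) * (iexp (\<theta> N) - 1)"
      by (simp add: M_def sum_distrib_right mult.assoc)
    finally have "exp (Z N) = (\<Prod>m\<in>I N. ?b m ^ nn N m) * ?r"
      unfolding Z_def by (simp add: exp_diff exp_minus divide_inverse mult.assoc)
    then have "char (?D N) t - exp (Z N) = ((\<Prod>m\<in>I N. ?a m ^ nn N m) - (\<Prod>m\<in>I N. ?b m ^ nn N m)) * ?r"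
      unfolding ch by (simp only: left_diff_distrib)
    moreover have "cmod ?r = 1" by (simp only: norm_mult norm_exp_i_times mult_1_left)
    ultimately have "cmod (char (?D N) t - exp (Z N)) =
        cmod ((\<Prod>m\<in>I N. ?a m ^ nn N m) - (\<Prod>m\<in>I N. ?b m ^ nn N m))"
      by (simp only: norm_mult mult_1_right)
    also have "\<dots> \<le> (\<Sum>m\<in>I N. cmod (?a m ^ nn N m - ?b m ^ nn N m))"
      using bd(1,2) by (intro norm_prod_diff) (auto simp: norm_power intro!: power_le_one)
    also have "\<dots> \<le> (\<Sum>m\<in>I N. exp 2 * (real (nn N m) * (pp N m)\<^sup>2) * (\<theta> N)\<^sup>2)"
    proof (rule sum_mono)
      fix m
      have "cmod (?a m ^ nn N m - ?b m ^ nn N m) \<le> real (nn N m) * cmod (?a m - ?b m)"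
        by (rule norm_power_diff[OF bd(1,2)])
      also have "\<dots> \<le> real (nn N m) * (exp 2 * ((pp N m)\<^sup>2 * (\<theta> N)\<^sup>2))"
        by (intro mult_left_mono bd(3)) auto
      finally show "cmod (?a m ^ nn N m - ?b m ^ nn N m) \<le>
          exp 2 * (real (nn N m) * (pp N m)\<^sup>2) * (\<theta> N)\<^sup>2"
        by (simp only: mult_ac)
    qed
    also have "\<dots> = exp 2 * (V N * (\<theta> N)\<^sup>2)"
      by (simp only: V_def sum_distrib_left sum_distrib_right mult.assoc)
    finally show ?thesis .
  qed
  have "(\<lambda>N. exp 2 * (V N * (\<theta> N)\<^sup>2)) \<longlonglongrightarrow> 0"
  proof -
    have "(\<lambda>N. exp 2 * ((t / s)\<^sup>2 * (V N / (\<sigma> N)\<^sup>2))) \<longlonglongrightarrow> exp 2 * ((t / s)\<^sup>2 * 0)"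
      by (intro tendsto_intros V0)
    moreover have "(t / s)\<^sup>2 * (V N / (\<sigma> N)\<^sup>2) = V N * (\<theta> N)\<^sup>2" for N
      by (simp add: \<theta>_def power_divide power_mult_distrib)
    ultimately show ?thesis by (simp only: mult_zero_right)
  qed
  then have d0: "(\<lambda>N. char (?D N) t - exp (Z N)) \<longlonglongrightarrow> 0"
    by (rule Lim_null_comparison[rotated]) (intro always_eventually allI diff)
  have Z: "Z \<longlonglongrightarrow> of_real (- t\<^sup>2 / 2)"
  proof -
    \<comment> \<open>Third-order Taylor remainder; the rest of Z is a linear term, which vanishes
      in the limit by \<open>Mn\<close>, and the quadratic term governed by
      \<open>M2\<close>.\<close>
    define E where "E = (\<lambda>N. of_real (M N) * (iexp (\<theta> N) - 1 - \<i> * of_real (\<theta> N) +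
        of_real ((\<theta> N)\<^sup>2 / 2)) :: complex)"
    have E0: "E \<longlonglongrightarrow> 0"
    proof (rule Lim_null_comparison)
      show "\<forall>\<^sub>F N in sequentially. cmod (E N) \<le> M N * (\<theta> N)\<^sup>2 * \<bar>\<theta> N\<bar>"
      proof (intro always_eventually allI)
        fix N
        have M0: "0 \<le> M N" unfolding M_def using pp by (intro sum_nonneg) auto
        have "iexp (\<theta> N) - 1 - \<i> * of_real (\<theta> N) + of_real ((\<theta> N)\<^sup>2 / 2) =
            iexp (\<theta> N) - (\<Sum>k\<le>(2::nat). (\<i> * of_real (\<theta> N)) ^ k / fact k)"
        proof -
          have "(\<Sum>k\<le>(2::nat). w ^ k / fact k) = 1 + w + w\<^sup>2 / 2" for w :: complex
            by (simp add: numeral_2_eq_2)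
          moreover have "(\<i> * of_real (\<theta> N))\<^sup>2 = - of_real ((\<theta> N)\<^sup>2)" by (simp add: power_mult_distrib)
          ultimately show ?thesis by simp
        qed
        then have "cmod (iexp (\<theta> N) - 1 - \<i> * of_real (\<theta> N) + of_real ((\<theta> N)\<^sup>2 / 2)) \<le>
            \<bar>\<theta> N\<bar> ^ Suc 2 / fact (Suc 2)"
          using iexp_approx1[where x = "\<theta> N" and n = 2] by (simp only:)
        also have "\<dots> \<le> \<bar>\<theta> N\<bar> ^ Suc 2 / 1"
          by (intro divide_left_mono) auto
        also have "\<dots> = (\<theta> N)\<^sup>2 * \<bar>\<theta> N\<bar>" by (simp only: power_Suc2 power2_abs div_by_1)
        finally have le: "cmod (iexp (\<theta> N) - 1 - \<i> * of_real (\<theta> N) + of_real ((\<theta> N)\<^sup>2 / 2)) \<le>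
            (\<theta> N)\<^sup>2 * \<bar>\<theta> N\<bar>" .
        have "cmod (E N) = M N * cmod (iexp (\<theta> N) - 1 - \<i> * of_real (\<theta> N) + of_real ((\<theta> N)\<^sup>2 / 2))"
          unfolding E_def norm_mult using M0 by (simp only: norm_of_real abs_of_nonneg)
        also have "\<dots> \<le> M N * ((\<theta> N)\<^sup>2 * \<bar>\<theta> N\<bar>)" by (rule mult_left_mono[OF le M0])
        finally show "cmod (E N) \<le> M N * (\<theta> N)\<^sup>2 * \<bar>\<theta> N\<bar>" by (simp only: mult.assoc)
      qed
      have "(\<lambda>N. M N * (\<theta> N)\<^sup>2 * \<bar>\<theta> N\<bar>) \<longlonglongrightarrow> t\<^sup>2 * \<bar>0\<bar>" by (intro tendsto_intros M2 \<theta>0)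
      then show "(\<lambda>N. M N * (\<theta> N)\<^sup>2 * \<bar>\<theta> N\<bar>) \<longlonglongrightarrow> 0" by simp
    qed
    have "(\<lambda>N. E N + \<i> * of_real (t / s * ((M N - real (n N)) / \<sigma> N) - t * d / s) - of_real (M N *
        (\<theta> N)\<^sup>2 / 2)) \<longlonglongrightarrow>
       0 + \<i> * of_real (t / s * d - t * d / s) - of_real (t\<^sup>2 / 2)"
      by (intro tendsto_intros E0 Mn M2) simp
    moreover have "E N + \<i> * of_real (t / s * ((M N - real (n N)) / \<sigma> N) - t * d / s) - of_real (M N *
        (\<theta> N)\<^sup>2 / 2) = Z N" for N
    proof -
      have e: "t / s * ((M N - real (n N)) / \<sigma> N) = \<theta> N * (M N - real (n N))"
        by (simp add: \<theta>_def)
      show ?thesis unfolding E_def Z_def e by (simp add: algebra_simps)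
    qed
    ultimately show ?thesis by simp
  qed
  have "(\<lambda>N. (char (?D N) t - exp (Z N)) + exp (Z N)) \<longlonglongrightarrow> 0 + exp (of_real (- t\<^sup>2 / 2))"
    by (intro tendsto_intros d0 Z)
  then show "(\<lambda>N. char (?D N) t) \<longlonglongrightarrow> char std_normal_distribution t"
    unfolding char_std_normal_distribution by (simp only: diff_add_cancel add_0_left exp_of_real)
qed

section \<open>Gaussian walks observed at finitely many times\<close>

text \<open>An entry holds the mean and the standard deviation of a block. The level is tested
  before each block and after the last one, so m blocks stand for m + 1 observation times.\<close>

primrec gauss_hit :: "(real \<times> real) list \<Rightarrow> real \<Rightarrow> real" where
  "gauss_hit [] y = of_bool (y \<le> 0)"
| "gauss_hit (b # bs) y =
     (if y \<le> 0 then 1 else \<integral>x. gauss_hit bs (y + fst b + snd b * x) \<partial>std_normal_distribution)"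

lemma gauss_hit_properties: "antimono (gauss_hit bs) \<and> (\<forall>y. 0 \<le> gauss_hit bs y \<and> gauss_hit bs y \<le> 1)"
proof (induction bs)
  case Nil
  then show ?case by (auto simp: monotone_on_def)
next
  case (Cons b bs)
  interpret real_distribution std_normal_distribution by (rule real_dist_normal_dist)
  have m [measurable]: "gauss_hit bs \<in> borel_measurable borel" using Cons
      by (intro antimono_borel_measurable) auto
  have i: "integrable std_normal_distribution (\<lambda>x. gauss_hit bs (y + fst b + snd b * x))" for y
    using Cons by (intro integrable_std_normal_bounded[where B = 1]) (auto simp: abs_of_nonneg)
  have b: "0 \<le> (\<integral>x. gauss_hit bs (y + fst b + snd b * x) \<partial>std_normal_distribution)"
    "(\<integral>x. gauss_hit bs (y + fst b + snd b * x) \<partial>std_normal_distribution) \<le> 1" for y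
  proof -
    show "0 \<le> (\<integral>x. gauss_hit bs (y + fst b + snd b * x) \<partial>std_normal_distribution)"
      using Cons by (intro integral_nonneg_AE) auto
    have "(\<integral>x. gauss_hit bs (y + fst b + snd b * x) \<partial>std_normal_distribution) \<le>
        (\<integral>x. 1 \<partial>std_normal_distribution)"
      using Cons i by (intro integral_mono) auto
    then show "(\<integral>x. gauss_hit bs (y + fst b + snd b * x) \<partial>std_normal_distribution) \<le> 1"
        using prob_space by simp
  qed
  have "antimono (gauss_hit (b # bs))"
  proof (rule antimonoI)
    fix y y' :: real assume y: "y \<le> y'"
    show "gauss_hit (b # bs) y' \<le> gauss_hit (b # bs) y"
    proof (cases "y \<le> 0")
      case True
      then show ?thesis using b(2) by simp
    next
      case False
      have "(\<integral>x. gauss_hit bs (y' + fst b + snd b * x) \<partial>std_normal_distribution) \<le>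
         (\<integral>x. gauss_hit bs (y + fst b + snd b * x) \<partial>std_normal_distribution)"
        using y by (intro integral_mono i antimonoD[OF conjunct1[OF Cons]]) simp
      then show ?thesis using False y by simp
    qed
  qed
  moreover have "0 \<le> gauss_hit (b # bs) y \<and> gauss_hit (b # bs) y \<le> 1" for y using b by simp
  ultimately show ?case by blast
qed

text \<open>One backward step of the limit: after the block the hitting probability converges at
  every level, the rescaled block increment converges in law, and integrating the first against the
  second gives the limit before the block.\<close>

lemma indep_hit_block_converges:
  fixes q :: "nat \<Rightarrow> nat \<Rightarrow> nat pmf"
  assumes fin: "\<And>N m. finite (set_pmf (q N m))" and s: "0 < s"
    and B: "\<And>N i y y'. y \<le> y' \<Longrightarrow> B N i y' \<Longrightarrow> B N i y"
    and f: "antimono f" "\<And>y. (\<lambda>N. indep_hit (q N) (B N) (L N - t' N) (t' N) (\<sigma> N * y)) \<longlonglongrightarrow> f y"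
    and clt: "weak_conv_m (\<lambda>N. distr (measure_pmf (increment_sum (q N) (t' N - t N) (t N))) borel
       (\<lambda>x. (x / \<sigma> N - d) / s)) std_normal_distribution"
    and ev: "\<forall>\<^sub>F N in sequentially. 0 < \<sigma> N \<and> t N < t' N \<and> t' N \<le> L N \<and>
       \<not> B N (t N) (\<sigma> N * y) \<and> (\<forall>i y. t N < i \<longrightarrow> i < t' N \<longrightarrow> \<not> B N i y)"
  shows "(\<lambda>N. indep_hit (q N) (B N) (L N - t N) (t N) (\<sigma> N * y)) \<longlonglongrightarrow>
    (\<integral>x. f (y + d + s * x) \<partial>std_normal_distribution)"
proof -
  let ?S = "\<lambda>N. measure_pmf (increment_sum (q N) (t' N - t N) (t N))"
  let ?D = "\<lambda>N. distr (?S N) borel (\<lambda>x. (x / \<sigma> N - d) / s)"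
  \<comment> \<open>The scale is positive only eventually; \<open>max 0\<close> makes
    \<open>g N\<close> monotone for every N and changes nothing in the limit.\<close>
  define g where "g = (\<lambda>N x. indep_hit (q N) (B N) (L N - t' N) (t' N) (max 0 (\<sigma> N) * (y + d + s * x)))"
  have g: "antimono (g N)" for N
    unfolding g_def using s B by (intro antimonoI indep_hit_antimono) (auto intro!: mult_left_mono)
  have "(\<lambda>N. \<integral>x. g N x \<partial>?D N) \<longlonglongrightarrow> (\<integral>x. f (y + d + s * x) \<partial>std_normal_distribution)"
  proof (rule weak_conv_integral_antimono[OF _ clt g])
    show "real_distribution (?D N)" for N
        by (intro prob_space.real_distribution_distr[OF prob_space_measure_pmf]) simp
    show "0 \<le> g N x" "g N x \<le> 1" for N x unfolding g_def by (rule indep_hit_bounds)+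
    show "antimono (\<lambda>x. f (y + d + s * x))"
      using f(1) s by (auto intro!: antimonoI antimonoD[OF f(1)])
    show "(\<lambda>N. g N x) \<longlonglongrightarrow> f (y + d + s * x)" for x
      by (rule Lim_transform_eventually[OF f(2)[of "y + d + s * x"]])
        (use ev in \<open>eventually_elim, simp add: g_def\<close>)
  qed
  moreover have "\<forall>\<^sub>F N in sequentially. (\<integral>x. g N x \<partial>?D N) =
      indep_hit (q N) (B N) (L N - t N) (t N) (\<sigma> N * y)"
    using ev
  proof eventually_elim
    case (elim N)
    have "indep_hit (q N) (B N) ((t' N - t N) + (L N - t' N)) (t N) (\<sigma> N * y) =
       (\<integral>x. indep_hit (q N) (B N) (L N - t' N) (t N + (t' N - t N)) (\<sigma> N * y + x) \<partial>?S N)"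
      using elim by (intro indep_hit_block fin) auto
    moreover have "(t' N - t N) + (L N - t' N) = L N - t N" "t N + (t' N - t N) = t' N"
        using elim by auto
    moreover have "(\<integral>x. g N x \<partial>?D N) = (\<integral>x. g N ((x / \<sigma> N - d) / s) \<partial>?S N)"
      by (intro integral_distr antimono_borel_measurable g) simp
    moreover have "g N ((x / \<sigma> N - d) / s) =
        indep_hit (q N) (B N) (L N - t' N) (t' N) (\<sigma> N * y + x)" for x
    proof -
      have "max 0 (\<sigma> N) * (y + d + s * ((x / \<sigma> N - d) / s)) = \<sigma> N * y + x"
        using elim s by (simp add: max_def field_simps)
      then show ?thesis unfolding g_def by simp
    qed
    ultimately show ?case by simp
  qed
  ultimately show ?thesis by (rule Lim_transform_eventually)
qed

section \<open>The diffusive window\<close>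

lemma nat_ceiling_bounds:
  fixes x :: real
  assumes "0 \<le> x"
  shows "x \<le> real (nat \<lceil>x\<rceil>)" "real (nat \<lceil>x\<rceil>) \<le> x + 1"
proof -
  have "real (nat \<lceil>x\<rceil>) = real_of_int \<lceil>x\<rceil>" using assms by simp
  then show "x \<le> real (nat \<lceil>x\<rceil>)" "real (nat \<lceil>x\<rceil>) \<le> x + 1" by linarith+
qed

lemma hit_eq_0: "(\<And>ys. length xs \<le> length ys \<Longrightarrow> \<not> P ys) \<Longrightarrow> hit K P n xs = 0"
proof (induction n arbitrary: xs)
  case (Suc n)
  have "hit K P n (x # xs) = 0" for x using Suc.prems by (intro Suc.IH) auto
  then show ?case using Suc.prems[of xs] by simp
qed simp

lemma hit_mono:
  assumes "\<And>ys. P ys \<Longrightarrow> Q ys"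
  shows "hit K P n xs \<le> hit K Q n xs"
  by (rule hit_mono_path) (metis assms drop0 le0)

context critical_weights
begin

section \<open>Sandwich between walks with independent increments\<close>

text \<open>A fixed number K of trials is withheld whatever the past, which makes the increments
  independent; K stands for an upper bound on the queue.\<close>

definition thin_step :: "nat \<Rightarrow> nat \<Rightarrow> nat \<Rightarrow> nat pmf" where
  "thin_step K N i = binomial_pmf (N - Suc i - K) (link_prob \<beta> N i)"

lemma finite_thin_step: "finite (set_pmf (thin_step K N i))"
  unfolding thin_step_def using link_prob_in_01 by (intro finite_set_pmf_binomial_pmf)

lemma expectation_thin_antimono:
  assumes B: "\<And>i y y'. y \<le> y' \<Longrightarrow> B i y' \<Longrightarrow> B i y" and "m \<le> n"
  shows "measure_pmf.expectation (binomial_pmf n (link_prob \<beta> N i)) (\<lambda>c. indep_hit q B l j (y + real c -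
      1)) \<le>
    measure_pmf.expectation (binomial_pmf m (link_prob \<beta> N i)) (\<lambda>c. indep_hit q B l j (y + real c - 1))"
proof (rule expectation_binomial_antimono[OF link_prob_in_01 _ assms(2)])
  show "indep_hit q B l j (y + real (Suc c) - 1) \<le> indep_hit q B l j (y + real c - 1)" for c
  proof (rule indep_hit_antimono)
    show "B i y" if "y \<le> y'" "B i y'" for i y y' using that by (rule B)
  qed simp
qed

text \<open>Binomial laws are stochastically monotone in the number of trials, so the true walk lies
  between the walks that ignore the queue and that overestimate it by a constant.\<close>

lemma hit_ge_indep_hit:
  assumes B: "\<And>i y y'. y \<le> y' \<Longrightarrow> B i y' \<Longrightarrow> B i y"
  shows "indep_hit (thin_step 0 N) B n (length cs) (net cs) \<le>
    hit (child_kernel \<beta> N) (\<lambda>cs. B (length cs) (net cs)) n cs"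
proof (induction n arbitrary: cs)
  case (Suc n)
  let ?P = "\<lambda>cs. B (length cs) (net cs)" and ?i = "length cs"
  show ?case
  proof (cases "?P cs")
    case False
    have "measure_pmf.expectation (thin_step 0 N ?i) (\<lambda>c. indep_hit (thin_step 0 N) B n (Suc ?i) (net cs
        + real c - 1)) \<le>
       measure_pmf.expectation (child_kernel \<beta> N cs) (\<lambda>c. indep_hit (thin_step 0 N) B n (Suc ?i) (net cs
           + real c - 1))"
      unfolding thin_step_def child_kernel_def by (rule expectation_thin_antimono[OF B]) auto
    also have "\<dots> \<le> measure_pmf.expectation (child_kernel \<beta> N cs) (\<lambda>c. hit (child_kernel \<beta> N) ?P n (c #
        cs))"
      using Suc[of "_ # cs"] by (intro expectation_pmf_mono finite_child_kernel) simp
    finally show ?thesis using False by simp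
  qed simp
qed simp

text \<open>While the queue is at most K the true step has at least as many trials as the thinned
  one, so the true walk comes down less easily. Paths whose queue exceeds K by time D are charged to
  the last term; after D nothing can be hit.\<close>

lemma hit_le_indep_hit:
  assumes B: "\<And>i y y'. y \<le> y' \<Longrightarrow> B i y' \<Longrightarrow> B i y" and D: "\<And>i y. B i y \<Longrightarrow> i \<le> D"
  shows "hit (child_kernel \<beta> N) (\<lambda>cs. B (length cs) (net cs)) n cs \<le>
    indep_hit (thin_step K N) B n (length cs) (net cs) +
    hit (child_kernel \<beta> N) (\<lambda>cs. length cs \<le> D \<and> K < queue cs) n cs"
proof (induction n arbitrary: cs)
  case 0
  then show ?case by simp
next
  case (Suc n)
  let ?P = "\<lambda>cs. B (length cs) (net cs)" and ?i = "length cs"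
  let ?Q = "\<lambda>cs. length cs \<le> D \<and> K < queue cs"
  let ?k = "child_kernel \<beta> N"
  consider "D < ?i" | "?i \<le> D" "K < queue cs" | "?i \<le> D" "queue cs \<le> K" by linarith
  then show ?case
  proof cases
    case 1
    then have "hit ?k ?P (Suc n) cs = 0" using D by (intro hit_eq_0) (metis leD order.trans)
    then show ?thesis
      using indep_hit_bounds(1)[of "thin_step K N" B "Suc n" ?i "net cs"] hit_bounds(1)[of ?k ?Q "Suc n"
          cs] by linarith
  next
    case 2
    then have "hit ?k ?Q (Suc n) cs = 1" by simp
    then show ?thesis
      using indep_hit_bounds(1)[of "thin_step K N" B "Suc n" ?i "net cs"] hit_bounds(2)[of ?k ?P "Suc n"
          cs] by linarith
  next
    case 3
    show ?thesis
    proof (cases "?P cs")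
      case True
      then have "indep_hit (thin_step K N) B (Suc n) ?i (net cs) = 1" by simp
      then show ?thesis using hit_bounds(1)[of ?k ?Q "Suc n" cs] hit_bounds(2)[of ?k ?P "Suc n" cs] by
          linarith
    next
      case False
      let ?E = "measure_pmf.expectation"
      have int: "integrable (?k cs) f" for f :: "nat \<Rightarrow> real"
        using finite_child_kernel by (rule integrable_measure_pmf_finite)
      have "hit ?k ?P (Suc n) cs = ?E (?k cs) (\<lambda>c. hit ?k ?P n (c # cs))" using False by simp
      also have "\<dots> \<le> ?E (?k cs) (\<lambda>c. indep_hit (thin_step K N) B n (Suc ?i) (net cs + real c - 1) +
          hit ?k ?Q n (c # cs))"
        using Suc[of "_ # cs"] by (intro expectation_pmf_mono finite_child_kernel) simp
      also have "\<dots> = ?E (?k cs) (\<lambda>c. indep_hit (thin_step K N) B n (Suc ?i) (net cs + real c - 1)) +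
          ?E (?k cs) (\<lambda>c. hit ?k ?Q n (c # cs))"
        by (intro Bochner_Integration.integral_add int)
      also have "?E (?k cs) (\<lambda>c. indep_hit (thin_step K N) B n (Suc ?i) (net cs + real c - 1)) \<le>
          ?E (thin_step K N ?i) (\<lambda>c. indep_hit (thin_step K N) B n (Suc ?i) (net cs + real c - 1))"
        unfolding thin_step_def child_kernel_def using 3 by (intro expectation_thin_antimono[OF B]) auto
      also have "\<dots> = indep_hit (thin_step K N) B (Suc n) ?i (net cs)" using False by simp
      also have "?E (?k cs) (\<lambda>c. hit ?k ?Q n (c # cs)) = hit ?k ?Q (Suc n) cs" using 3 by simp
      finally show ?thesis by simp
    qed
  qed
qed

section \<open>The scale of the walk and the size of the queue\<close>

definition walk_scale :: "nat \<Rightarrow> real" where "walk_scale N = real N powr (alpha k / 2)"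

lemma walk_scale_pos: "0 < N \<Longrightarrow> 0 < walk_scale N"
  by (simp add: walk_scale_def)

lemma walk_scale_square: "(walk_scale N)\<^sup>2 = real N powr alpha k"
proof -
  have "(walk_scale N)\<^sup>2 = real N powr (alpha k / 2) * real N powr (alpha k / 2)"
      by (simp add: walk_scale_def power2_eq_square)
  also have "\<dots> = real N powr alpha k" by (simp flip: powr_add)
  finally show ?thesis .
qed

text \<open>A drift (i/N)^(k-2) over i = \<open>(walk_scale N)\<^sup>2\<close> steps amounts to one
  unit of \<open>walk_scale\<close>; alpha(k) is the exponent for which this holds.\<close>

lemma walk_scale_balance: "0 < N \<Longrightarrow> ((walk_scale N)\<^sup>2 / real N) ^ (k - 2) * walk_scale N = 1"
proof -
  assume N: "0 < N"
  have "(walk_scale N)\<^sup>2 / real N = real N powr (alpha k - 1)"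
    unfolding walk_scale_square using N by (simp add: powr_diff)
  then have "((walk_scale N)\<^sup>2 / real N) ^ (k - 2) = real N powr ((alpha k - 1) * (real k - 2))"
    using N k3 by (simp add: powr_realpow[symmetric] powr_powr of_nat_diff)
  then have "((walk_scale N)\<^sup>2 / real N) ^ (k - 2) * walk_scale N =
      real N powr ((alpha k - 1) * (real k - 2) + alpha k / 2)"
    unfolding walk_scale_def by (simp flip: powr_add)
  also have "(alpha k - 1) * (real k - 2) + alpha k / 2 = 0" using alpha_eq by simp
  finally show ?thesis using N by simp
qed

text \<open>Everything rests on alpha lying strictly between 0 and 1. The limit containing the
  rounded square root says that thinning by sqrt N is admissible in the block limits.\<close>

lemma walk_scale_limits:
  "filterlim walk_scale at_top sequentially" "(\<lambda>N. 1 / (walk_scale N)\<^sup>2) \<longlonglongrightarrow> 0"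
  "(\<lambda>N. walk_scale N / real N) \<longlonglongrightarrow> 0" "(\<lambda>N. (walk_scale N)\<^sup>2 / real N) \<longlonglongrightarrow> 0"
  "(\<lambda>N. real (nat \<lceil>sqrt (real N)\<rceil>) * walk_scale N / real N) \<longlonglongrightarrow> 0"
  "(\<lambda>N. walk_scale N / sqrt (real N)) \<longlonglongrightarrow> 0"
proof -
  show "filterlim walk_scale at_top sequentially" unfolding walk_scale_def
      using alpha_bounds by real_asymp
  show "(\<lambda>N. 1 / (walk_scale N)\<^sup>2) \<longlonglongrightarrow> 0" unfolding walk_scale_square using alpha_bounds by real_asymp
  show "(\<lambda>N. walk_scale N / real N) \<longlonglongrightarrow> 0" unfolding walk_scale_def using alpha_bounds by real_asymp
  show "(\<lambda>N. (walk_scale N)\<^sup>2 / real N) \<longlonglongrightarrow> 0" unfolding walk_scale_square using alpha_bounds by real_asymp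
  show "(\<lambda>N. walk_scale N / sqrt (real N)) \<longlonglongrightarrow> 0" unfolding walk_scale_def using alpha_bounds by real_asymp
  show "(\<lambda>N. real (nat \<lceil>sqrt (real N)\<rceil>) * walk_scale N / real N) \<longlonglongrightarrow> 0"
  proof (rule Lim_null_comparison)
    show "\<forall>\<^sub>F N in sequentially. norm (real (nat \<lceil>sqrt (real N)\<rceil>) * walk_scale N / real N) \<le>
        (sqrt (real N) + 1) * walk_scale N / real N"
    proof (intro always_eventually allI)
      fix N
      have le: "real (nat \<lceil>sqrt (real N)\<rceil>) \<le> sqrt (real N) + 1" by (rule nat_ceiling_bounds) simp
      have s0: "0 \<le> walk_scale N" by (simp add: walk_scale_def)
      have "norm (real (nat \<lceil>sqrt (real N)\<rceil>) * walk_scale N / real N) =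
          real (nat \<lceil>sqrt (real N)\<rceil>) * walk_scale N / real N"
      proof -
        have "0 \<le> real (nat \<lceil>sqrt (real N)\<rceil>) * walk_scale N / real N"
          using s0 by (intro divide_nonneg_nonneg mult_nonneg_nonneg of_nat_0_le_iff)
        then show ?thesis by (simp only: real_norm_def abs_of_nonneg)
      qed
      also have "\<dots> \<le> (sqrt (real N) + 1) * walk_scale N / real N"
        using le s0 by (intro divide_right_mono mult_right_mono) auto
      finally show "norm (real (nat \<lceil>sqrt (real N)\<rceil>) * walk_scale N / real N) \<le>
          (sqrt (real N) + 1) * walk_scale N / real N" .
    qed
    show "(\<lambda>N. (sqrt (real N) + 1) * walk_scale N / real N) \<longlonglongrightarrow> 0"
      unfolding walk_scale_def using alpha_bounds by real_asymp
  qed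
qed

text \<open>sqrt N lies between two scales: far above \<open>walk_scale\<close>, the natural order
  of the queue, and far below N / \<open>walk_scale\<close>, the thinning that would alter the
  limit.\<close>

lemma queue_exceeds_sqrt_bound:
  assumes T: "0 < T" and e: "0 < e"
  shows "\<forall>\<^sub>F N in sequentially. \<forall>D. real D \<le> T * (walk_scale N)\<^sup>2 \<longrightarrow>
    hit (child_kernel \<beta> N) (\<lambda>cs. length cs \<le> D \<and> nat \<lceil>sqrt (real N)\<rceil> < queue cs) N [] \<le> e"
proof -
  obtain C0 N0 where C0: "0 < C0" and N0: "\<And>N i. N0 \<le> N \<Longrightarrow> 2 * i \<le> N \<Longrightarrow>
     (\<Sum>m<i. max 0 (drift \<beta> N m)) \<le> C0 * (real i * (real i / real N) ^ (k - 2) + real i / real N) \<and>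
     real N * link_prob \<beta> N i \<le> C0"
    using sum_drift_estimate by blast
  have "(\<lambda>N. C0 * (T ^ (k - 1) * (walk_scale N / sqrt (real N)) + 1 / sqrt (real N))) \<longlonglongrightarrow>
      C0 * (T ^ (k - 1) * 0 + 0)"
    by (intro tendsto_intros walk_scale_limits) real_asymp
  then have "\<forall>\<^sub>F N in sequentially. C0 * (T ^ (k - 1) * (walk_scale N / sqrt (real N)) +
      1 / sqrt (real N)) < 1 / 2"
    by (rule order_tendstoD) simp
  moreover have "(\<lambda>N. 16 * C0 * T * ((walk_scale N)\<^sup>2 / real N)) \<longlonglongrightarrow> 16 * C0 * T * 0"
    by (intro tendsto_intros walk_scale_limits)
  then have "\<forall>\<^sub>F N in sequentially. 16 * C0 * T * ((walk_scale N)\<^sup>2 / real N) < e"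
    using e by (intro order_tendstoD) simp_all
  moreover have "(\<lambda>N. T * ((walk_scale N)\<^sup>2 / real N)) \<longlonglongrightarrow> T * 0"
      by (intro tendsto_intros walk_scale_limits)
  then have "\<forall>\<^sub>F N in sequentially. T * ((walk_scale N)\<^sup>2 / real N) < 1 / 2"
      by (rule order_tendstoD) simp
  ultimately show ?thesis
    using eventually_ge_at_top[of "max N0 1"]
  proof eventually_elim
    case (elim N)
    have N: "0 < N" "N0 \<le> N" using elim by auto
    let ?s = "sqrt (real N)"
    have s: "0 < ?s" "?s * ?s = real N" using N by auto
    show ?case
    proof (intro allI impI)
      fix D assume D: "real D \<le> T * (walk_scale N)\<^sup>2"
      have half: "2 * i \<le> N" if "i \<le> D" for i
      proof -
        have "real i \<le> T * (walk_scale N)\<^sup>2" using that D by linarith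
        also have "\<dots> < real N / 2" using elim(3) N by (simp add: field_simps)
        finally show ?thesis by linarith
      qed
      let ?Q = "\<lambda>cs. length cs \<le> D \<and> nat \<lceil>?s\<rceil> < queue cs"
      \<comment> \<open>A constant weight suffices here: twice sqrt N / 4 covers the martingale part
        of the queue bound, and the other half of sqrt N covers the drift.\<close>
      let ?M = "\<lambda>cs. length cs \<le> D \<and> ?s / 4 < \<bar>mart \<beta> N cs\<bar>"
      have "hit (child_kernel \<beta> N) ?Q N [] \<le> hit (child_kernel \<beta> N) ?M N []"
      proof (rule hit_mono_path)
        fix ys :: "nat list" assume Q: "?Q ys"
        let ?i = "length ys"
        show "\<exists>j\<le>length ys - length []. ?M (drop j ys)"
        proof (rule ccontr)
          assume neg: "\<not> (\<exists>j\<le>length ys - length []. ?M (drop j ys))"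
          have "\<bar>mart \<beta> N (drop j ys)\<bar> \<le> ?s / 4" if "j \<le> ?i" for j
          proof -
            have "\<not> ?M (drop j ys)" using neg that by auto
            moreover have "length (drop j ys) \<le> D"
              by (rule order.trans[of _ "length ys"]) (use Q in auto)
            ultimately show ?thesis by linarith
          qed
          from queue_le_sum[OF this, of 0]
          have "real (queue ys) \<le> 2 * (?s / 4) + (\<Sum>m<?i. max 0 (drift \<beta> N m))" by simp
          also have "(\<Sum>m<?i. max 0 (drift \<beta> N m)) \<le>
              C0 * (real ?i * (real ?i / real N) ^ (k - 2) + real ?i / real N)"
            using N0[OF N(2) half[of ?i]] Q by simp
          also have "\<dots> \<le> C0 * (T ^ (k - 1) * walk_scale N + 1)"
          proof (intro mult_left_mono add_mono)
            have i: "real ?i \<le> T * (walk_scale N)\<^sup>2" using Q D by linarith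
            have "real ?i * (real ?i / real N) ^ (k - 2) \<le>
                T * (walk_scale N)\<^sup>2 * (T * (walk_scale N)\<^sup>2 / real N) ^ (k - 2)"
              using i T N by (intro mult_mono power_mono divide_right_mono) auto
            also have "\<dots> = T * T ^ (k - 2) * (((walk_scale N)\<^sup>2 / real N) ^ (k - 2) * walk_scale N) *
                walk_scale N"
              by (simp add: power_mult_distrib power_divide power2_eq_square)
            also have "\<dots> = T ^ (k - 1) * walk_scale N"
            proof -
              have "Suc (k - 2) = k - 1" using k3 by simp
              then have "T * T ^ (k - 2) = T ^ (k - 1)" by (simp only: power_Suc[symmetric])
              then show ?thesis unfolding walk_scale_balance[OF N(1)] by simp
            qed
            finally show "real ?i * (real ?i / real N) ^ (k - 2) \<le> T ^ (k - 1) * walk_scale N" .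
            show "real ?i / real N \<le> 1" using half[of ?i] Q N by simp
          qed (use C0 in simp)
          also have "\<dots> \<le> ?s / 2"
          proof -
            have "C0 * (T ^ (k - 1) * (walk_scale N / ?s) + 1 / ?s) * ?s < 1 / 2 * ?s"
              using elim(1) s by (intro mult_strict_right_mono) auto
            moreover have "C0 * (T ^ (k - 1) * (walk_scale N / ?s) + 1 / ?s) * ?s =
                C0 * (T ^ (k - 1) * walk_scale N + 1)"
              using s by (simp add: field_simps)
            ultimately show ?thesis by linarith
          qed
          finally have "real (queue ys) \<le> ?s" by simp
          then have "queue ys \<le> nat \<lceil>?s\<rceil>" by linarith
          then show False using Q by simp
        qed
      qed
      also have "\<dots> \<le> (\<Sum>m\<in>{1..D}. C0 / (?s / 4)\<^sup>2)"
        using s C0 N0[OF N(2) half] by (intro hit_mart_le) (auto simp: monotone_on_def)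
      also have "\<dots> = 16 * C0 * real D / real N"
        using s by (simp add: power2_eq_square)
      also have "\<dots> \<le> 16 * C0 * (T * (walk_scale N)\<^sup>2) / real N"
        using D C0 N by (intro divide_right_mono mult_left_mono) auto
      also have "\<dots> \<le> e" using elim(2) by (simp add: mult.assoc)
      finally show "hit (child_kernel \<beta> N) ?Q N [] \<le> e" .
    qed
  qed
qed

section \<open>Grid times and the limits of block increments\<close>

text \<open>Rounding up makes i at least \<open>grid_time N s\<close> equivalent to i at least s
  N^alpha, so events translate exactly.\<close>

definition grid_time :: "nat \<Rightarrow> real \<Rightarrow> nat" where "grid_time N s = nat \<lceil>(walk_scale N)\<^sup>2 * s\<rceil>"

lemma grid_time_bounds:
  assumes "0 \<le> s"
  shows "(walk_scale N)\<^sup>2 * s \<le> real (grid_time N s)" "real (grid_time N s) \<le> (walk_scale N)\<^sup>2 * s + 1"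
  unfolding grid_time_def by (rule nat_ceiling_bounds; simp add: assms)+

lemma grid_time_le_iff: "grid_time N s \<le> i \<longleftrightarrow> (walk_scale N)\<^sup>2 * s \<le> real i"
  by (simp add: grid_time_def ceiling_le_iff nat_le_iff)

lemma grid_time_mono: "s \<le> s' \<Longrightarrow> grid_time N s \<le> grid_time N s'"
  unfolding grid_time_def by (intro nat_mono ceiling_mono mult_left_mono) auto

lemma grid_time_ratio_limit:
  assumes "0 \<le> s"
  shows "(\<lambda>N. real (grid_time N s) / (walk_scale N)\<^sup>2) \<longlonglongrightarrow> s"
proof (rule tendsto_sandwich)
  show "\<forall>\<^sub>F N in sequentially. s \<le> real (grid_time N s) / (walk_scale N)\<^sup>2"
    using eventually_gt_at_top[of 0]
  proof eventually_elim
    case (elim N)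
    then show ?case using grid_time_bounds[OF assms, of N] walk_scale_pos[of N]
        by (simp add: field_simps)
  qed
  show "\<forall>\<^sub>F N in sequentially. real (grid_time N s) / (walk_scale N)\<^sup>2 \<le> s + 1 / (walk_scale N)\<^sup>2"
    using eventually_gt_at_top[of 0]
  proof eventually_elim
    case (elim N)
    then show ?case using grid_time_bounds[OF assms, of N] walk_scale_pos[of N]
        by (simp add: field_simps)
  qed
  have "(\<lambda>N. s + 1 / (walk_scale N)\<^sup>2) \<longlonglongrightarrow> s + 0" by (intro tendsto_intros walk_scale_limits)
  then show "(\<lambda>N. s + 1 / (walk_scale N)\<^sup>2) \<longlonglongrightarrow> s" by simp
qed simp

lemma grid_time_over_N_limit:
  assumes "0 \<le> s"
  shows "(\<lambda>N. real (grid_time N s) / real N) \<longlonglongrightarrow> 0"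
proof -
  have lim: "(\<lambda>N. real (grid_time N s) / (walk_scale N)\<^sup>2 * ((walk_scale N)\<^sup>2 / real N)) \<longlonglongrightarrow> s * 0"
    by (intro tendsto_intros grid_time_ratio_limit assms walk_scale_limits)
  have "\<forall>\<^sub>F N in sequentially. real (grid_time N s) / (walk_scale N)\<^sup>2 * ((walk_scale N)\<^sup>2 / real N) =
      real (grid_time N s) / real N"
    using eventually_gt_at_top[of 0]
  proof eventually_elim
    case (elim N)
    then have "walk_scale N \<noteq> 0" using walk_scale_pos[of N] by simp
    then show ?case by simp
  qed
  from Lim_transform_eventually[OF lim this] show ?thesis by simp
qed

lemma eventually_grid_time_small:
  assumes "0 \<le> s" "0 < \<delta>"
  shows "\<forall>\<^sub>F N in sequentially. real (grid_time N s) \<le> real N * \<delta>"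
proof -
  have "\<forall>\<^sub>F N in sequentially. real (grid_time N s) / real N < \<delta>"
    by (rule order_tendstoD(2)[OF grid_time_over_N_limit[OF assms(1)] assms(2)])
  then show ?thesis
    using eventually_gt_at_top[of 0] by eventually_elim (simp add: field_simps)
qed

text \<open>In rescaled time a, measured in units of \<open>walk_scale\<close> and up to constants,
  the accumulated drift is a^(k-1) and the drift per unit of rescaled time a^(k-2).\<close>

lemma grid_time_drift_scale:
  assumes "0 < N"
  shows "real i * (real i / real N) ^ (k - 2) / walk_scale N = (real i / (walk_scale N)\<^sup>2) ^ (k - 1)"
    "(real i / real N) ^ (k - 2) * walk_scale N = (real i / (walk_scale N)\<^sup>2) ^ (k - 2)"
proof -
  let ?a = "real i / (walk_scale N)\<^sup>2"
  have s: "0 < walk_scale N" using walk_scale_pos assms by simp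
  have i: "real i = ?a * (walk_scale N)\<^sup>2" "real i / real N = ?a * ((walk_scale N)\<^sup>2 / real N)"
      using s by simp_all
  show b: "(real i / real N) ^ (k - 2) * walk_scale N = ?a ^ (k - 2)"
    unfolding i(2) power_mult_distrib using walk_scale_balance[OF assms] by (simp add: mult.assoc)
  have "Suc (k - 2) = k - 1" using k3 by simp
  then have "?a ^ (k - 1) = ?a * ?a ^ (k - 2)" by (simp only: power_Suc[symmetric])
  also have "\<dots> = real i * ((real i / real N) ^ (k - 2) * walk_scale N) / (walk_scale N)\<^sup>2"
      unfolding b by simp
  also have "\<dots> = real i * (real i / real N) ^ (k - 2) / walk_scale N" using s
      by (simp add: power2_eq_square)
  finally show "real i * (real i / real N) ^ (k - 2) / walk_scale N = ?a ^ (k - 1)" by simp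
qed

definition speed :: real where "speed = excess / (real k - 1)"

lemma thin_drift_bound:
  "\<bar>(real (N - Suc m - K) * link_prob \<beta> N m - 1) - drift \<beta> N m\<bar> \<le> real K * link_prob \<beta> N m"
proof -
  have p: "0 \<le> link_prob \<beta> N m" using link_prob_in_01[of N m] by simp
  have "(real (N - Suc m - K) * link_prob \<beta> N m - 1) - drift \<beta> N m =
      (real (N - Suc m - K) - real (N - Suc m)) * link_prob \<beta> N m"
    by (simp add: drift_def algebra_simps)
  also have "\<bar>\<dots>\<bar> = \<bar>real (N - Suc m - K) - real (N - Suc m)\<bar> * link_prob \<beta> N m" using p
      by (simp add: abs_mult)
  also have "\<dots> \<le> real K * link_prob \<beta> N m" using p by (intro mult_right_mono) auto
  finally show ?thesis .
qed

lemma thin_drift_sum_limit: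
  assumes s: "0 \<le> s" and K: "(\<lambda>N. real (K N) * walk_scale N / real N) \<longlonglongrightarrow> 0"
  shows "(\<lambda>N. (\<Sum>m<grid_time N s. real (N - Suc m - K N) * link_prob \<beta> N m - 1) / walk_scale N) \<longlonglongrightarrow>
      speed * s ^ (k - 1)"
proof -
  obtain C0 N0 where C0: "0 < C0" and N0: "\<And>N i. N0 \<le> N \<Longrightarrow> 2 * i \<le> N \<Longrightarrow>
     \<bar>(\<Sum>m<i. drift \<beta> N m) - excess / (real k - 1) * (real i * (real i / real N) ^ (k - 2))\<bar>
        \<le> C0 * (real i * (real i / real N) ^ (k - 1) + real i / real N) \<and>
     real N * link_prob \<beta> N i \<le> C0"
    using sum_drift_estimate by blast
  define a where "a = (\<lambda>N. real (grid_time N s) / (walk_scale N)\<^sup>2)"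
  have a: "a \<longlonglongrightarrow> s" unfolding a_def by (rule grid_time_ratio_limit[OF s])
  define X where "X = (\<lambda>N. (\<Sum>m<grid_time N s. real (N - Suc m - K N) * link_prob \<beta> N m -
      1) / walk_scale N)"
  \<comment> \<open>Three errors: the next order of the drift, its O(1/N) part, and the thinning,
    which costs at most K \<open>link_prob\<close> per step.\<close>
  define err where "err = (\<lambda>N. C0 * (a N ^ (k - 1) * (real (grid_time N s) / real N) + a N *
      (walk_scale N / real N)) + C0 * (real (K N) * walk_scale N / real N) * a N)"
  have "err \<longlonglongrightarrow> C0 * (s ^ (k - 1) * 0 + s * 0) + C0 * 0 * s"
    unfolding err_def by (intro tendsto_intros a grid_time_over_N_limit s walk_scale_limits K)
  then have err: "err \<longlonglongrightarrow> 0" by simp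
  have "\<forall>\<^sub>F N in sequentially. norm (X N - speed * a N ^ (k - 1)) \<le> err N"
    using eventually_ge_at_top[of "max N0 1"] eventually_grid_time_small[OF s, of "1 / 2", OF
        half_gt_zero[OF zero_less_one]]
  proof eventually_elim
    case (elim N)
    let ?i = "grid_time N s"
    have N: "0 < N" "N0 \<le> N" using elim by auto
    have sg: "0 < walk_scale N" using walk_scale_pos N by simp
    have half: "2 * ?i \<le> N" using elim(2) by linarith
    have ia: "real ?i = a N * (walk_scale N)\<^sup>2" unfolding a_def using sg by simp
    let ?S = "\<Sum>m<?i. real (N - Suc m - K N) * link_prob \<beta> N m - 1" and ?D = "\<Sum>m<?i. drift \<beta> N m"
    have "\<bar>?S - ?D\<bar> \<le> (\<Sum>m<?i. \<bar>(real (N - Suc m - K N) * link_prob \<beta> N m - 1) - drift \<beta> N m\<bar>)"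
      by (simp only: sum_subtractf[symmetric] sum_abs)
    also have "\<dots> \<le> (\<Sum>m<?i. real (K N) * (C0 / real N))"
    proof (rule sum_mono)
      fix m assume "m \<in> {..<?i}"
      then have "2 * m \<le> N" using half by simp
      then have "link_prob \<beta> N m \<le> C0 / real N" using N0[OF N(2), of m] N by (simp add: field_simps)
      then have "real (K N) * link_prob \<beta> N m \<le> real (K N) * (C0 / real N)" by (rule mult_left_mono) simp
      then show "\<bar>(real (N - Suc m - K N) * link_prob \<beta> N m - 1) - drift \<beta> N m\<bar> \<le>
          real (K N) * (C0 / real N)"
        using thin_drift_bound[of N m "K N"] by linarith
    qed
    also have "\<dots> = real ?i * (real (K N) * (C0 / real N))" by simp
    finally have 1: "\<bar>?S - ?D\<bar> \<le> real ?i * (real (K N) * (C0 / real N))" .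
    have 2: "\<bar>?D - speed * (real ?i * (real ?i / real N) ^ (k - 2))\<bar> \<le>
        C0 * (real ?i * (real ?i / real N) ^ (k - 1) + real ?i / real N)"
      unfolding speed_def using N0[OF N(2) half] by blast
    have "\<bar>?S - speed * (real ?i * (real ?i / real N) ^ (k - 2))\<bar> \<le>
        C0 * (real ?i * (real ?i / real N) ^ (k - 1) + real ?i / real N) + real ?i * (real (K N) *
            (C0 / real N))"
      using 1 2 by linarith
    then have "\<bar>?S - speed * (real ?i * (real ?i / real N) ^ (k - 2))\<bar> / walk_scale N \<le>
        (C0 * (real ?i * (real ?i / real N) ^ (k - 1) + real ?i / real N) + real ?i * (real (K N) *
            (C0 / real N))) / walk_scale N"
      using sg by (intro divide_right_mono) auto
    moreover have "\<bar>?S - speed * (real ?i * (real ?i / real N) ^ (k - 2))\<bar> / walk_scale N =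
        norm (X N - speed * a N ^ (k - 1))"
    proof -
      have "a N ^ (k - 1) = real ?i * (real ?i / real N) ^ (k - 2) / walk_scale N"
        unfolding a_def using grid_time_drift_scale(1)[OF N(1), of ?i] by simp
      then have "X N - speed * a N ^ (k - 1) =
          (?S - speed * (real ?i * (real ?i / real N) ^ (k - 2))) / walk_scale N"
        unfolding X_def by (simp add: diff_divide_distrib)
      then show ?thesis using sg by simp
    qed
    moreover have "(C0 * (real ?i * (real ?i / real N) ^ (k - 1) + real ?i / real N) + real ?i *
        (real (K N) * (C0 / real N))) / walk_scale N = err N"
    proof -
      have "Suc (k - 2) = k - 1" using k3 by simp
      then have "(real ?i / real N) ^ (k - 1) = (real ?i / real N) ^ (k - 2) * (real ?i / real N)"
          by (simp only: power_Suc2[symmetric])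
      then have e1: "real ?i * (real ?i / real N) ^ (k - 1) / walk_scale N =
          a N ^ (k - 1) * (real ?i / real N)"
        unfolding a_def grid_time_drift_scale(1)[OF N(1), symmetric] by (simp add: mult_ac)
      have e2: "real ?i / real N / walk_scale N =
          a N * (walk_scale N / real N)" "real ?i / walk_scale N = walk_scale N * a N"
        unfolding ia using sg by (simp_all add: power2_eq_square)
      have g: "(C0 * (P + Q) + I * (R * (C0 / n))) / sg =
          C0 * (P / sg + Q / sg) + C0 * (R / n) * (I / sg)" for P Q I R n sg :: real
        by (simp add: add_divide_distrib algebra_simps)
      have "C0 * (real (K N) / real N) * (walk_scale N * a N) =
          C0 * (real (K N) * walk_scale N / real N) * a N"
        by simp
      then show ?thesis unfolding err_def e1[symmetric] e2(1)[symmetric] g e2(2) by (simp only:)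
    qed
    ultimately show ?case by simp
  qed
  then have "(\<lambda>N. X N - speed * a N ^ (k - 1)) \<longlonglongrightarrow> 0" using err by (rule Lim_null_comparison)
  then have "(\<lambda>N. (X N - speed * a N ^ (k - 1)) + speed * a N ^ (k - 1)) \<longlonglongrightarrow> 0 + speed * s ^ (k - 1)"
    by (intro tendsto_intros a)
  then show ?thesis unfolding X_def by simp
qed

text \<open>Steps are asymptotically Poisson of mean 1, minus 1, so the variance of a block is its
  rescaled length. The hypothesis on K makes the thinning o(\<open>walk_scale\<close>); hence both
  walks of the sandwich share this limit.\<close>

lemma block_clt:
  assumes u: "0 \<le> u" "u < v" and K: "(\<lambda>N. real (K N) * walk_scale N / real N) \<longlonglongrightarrow> 0"
  shows "weak_conv_m (\<lambda>N. distr (measure_pmf (increment_sum (thin_step (K N) N) (grid_time N v -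
      grid_time N u) (grid_time N u))) borel
     (\<lambda>x. (x / walk_scale N - speed * (v ^ (k - 1) - u ^ (k - 1))) / sqrt (v -
         u))) std_normal_distribution"
proof -
  obtain C0 N0 where C0: "0 < C0" and N0: "\<And>N i. N0 \<le> N \<Longrightarrow> 2 * i \<le> N \<Longrightarrow> real N * link_prob \<beta> N i \<le> C0"
    using sum_drift_estimate by blast
  let ?nn = "\<lambda>N m. N - Suc m - K N" and ?pp = "\<lambda>N m. link_prob \<beta> N m"
  let ?n = "\<lambda>N. grid_time N v - grid_time N u"
  have le: "grid_time N u \<le> grid_time N v" for N using u by (intro grid_time_mono) simp
  have I: "grid_time N u + ?n N = grid_time N v" for N using le[of N] by simp
  have "weak_conv_m (\<lambda>N. distr (measure_pmf (increment_sum (\<lambda>m. binomial_pmf (?nn N m) (?pp N m)) (?n N)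
      (grid_time N u))) borel
     (\<lambda>x. (x / walk_scale N - speed * (v ^ (k - 1) - u ^ (k - 1))) / sqrt (v -
         u))) std_normal_distribution"
  proof (rule binomial_block_clt)
    show "?pp N m \<in> {0..1}" for N m by (rule link_prob_in_01)
    show "0 < sqrt (v - u)" using u by simp
    show "filterlim walk_scale at_top sequentially" by (rule walk_scale_limits)
    have split: "(\<Sum>m\<in>{grid_time N u..<grid_time N v}. f m) =
        (\<Sum>m<grid_time N v. f m) - (\<Sum>m<grid_time N u. f m)" for f :: "nat \<Rightarrow> real" and N
    proof -
      have "{..<grid_time N v} = {..<grid_time N u} \<union> {grid_time N u..<grid_time N v}"
          using le[of N] by auto
      moreover have "{..<grid_time N u} \<inter> {grid_time N u..<grid_time N v} = {}" by auto
      ultimately show ?thesis by (simp add: sum.union_disjoint)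
    qed
    have "(\<lambda>N. (\<Sum>m<grid_time N v. real (?nn N m) * ?pp N m - 1) / walk_scale N -
        (\<Sum>m<grid_time N u. real (?nn N m) * ?pp N m - 1) / walk_scale N)
       \<longlonglongrightarrow> speed * v ^ (k - 1) - speed * u ^ (k - 1)"
      using u by (intro tendsto_intros thin_drift_sum_limit K) auto
    then show "(\<lambda>N. (\<Sum>m\<in>{grid_time N u..<grid_time N u + ?n N}. real (?nn N m) * ?pp N m -
        1) / walk_scale N) \<longlonglongrightarrow> speed * (v ^ (k - 1) - u ^ (k - 1))"
      unfolding I split by (simp only: diff_divide_distrib right_diff_distrib)
    have "(\<lambda>N. real (grid_time N v) / (walk_scale N)\<^sup>2 - real (grid_time N u) / (walk_scale N)\<^sup>2) \<longlonglongrightarrow>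
        v - u"
      using u by (intro tendsto_intros grid_time_ratio_limit) auto
    then show "(\<lambda>N. real (?n N) / (walk_scale N)\<^sup>2) \<longlonglongrightarrow> (sqrt (v - u))\<^sup>2"
      using u le by (simp add: of_nat_diff diff_divide_distrib)
    show "(\<lambda>N. (\<Sum>m\<in>{grid_time N u..<grid_time N u + ?n N}. real (?nn N m) *
        (?pp N m)\<^sup>2) / (walk_scale N)\<^sup>2) \<longlonglongrightarrow> 0"
    proof (rule Lim_null_comparison)
      have "(\<lambda>N. C0\<^sup>2 * (real (grid_time N v) / (walk_scale N)\<^sup>2) * (1 / real N)) \<longlonglongrightarrow> C0\<^sup>2 * v * 0"
        using u by (intro tendsto_intros grid_time_ratio_limit lim_1_over_n) auto
      then show "(\<lambda>N. C0\<^sup>2 * (real (grid_time N v) / (walk_scale N)\<^sup>2) * (1 / real N)) \<longlonglongrightarrow> 0" by simp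
      have v0: "0 \<le> v" using u by simp
      show "\<forall>\<^sub>F N in sequentially. norm ((\<Sum>m\<in>{grid_time N u..<grid_time N u + ?n N}. real (?nn N m) *
          (?pp N m)\<^sup>2) / (walk_scale N)\<^sup>2) \<le>
          C0\<^sup>2 * (real (grid_time N v) / (walk_scale N)\<^sup>2) * (1 / real N)"
        using eventually_ge_at_top[of "max N0 1"] eventually_grid_time_small[OF v0, of "1 / 2", OF
            half_gt_zero[OF zero_less_one]]
      proof eventually_elim
        case (elim N)
        have N: "0 < real N" "N0 \<le> N" using elim by auto
        have "(\<Sum>m\<in>{grid_time N u..<grid_time N v}. real (?nn N m) * (?pp N m)\<^sup>2) \<le>
            (\<Sum>m\<in>{grid_time N u..<grid_time N v}. C0\<^sup>2 / real N)"
        proof (rule sum_mono)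
          fix m assume m: "m \<in> {grid_time N u..<grid_time N v}"
          then have "real (2 * m) \<le> real N" using elim(2) by simp
          then have "2 * m \<le> N" by linarith
          then have p: "real N * ?pp N m \<le> C0" by (rule N0[OF N(2)])
          have p0: "0 \<le> ?pp N m" using link_prob_in_01[of N m] by simp
          have "real (?nn N m) * (?pp N m)\<^sup>2 \<le> real N * (?pp N m)\<^sup>2" by (intro mult_right_mono) auto
          also have "\<dots> = (real N * ?pp N m)\<^sup>2 / real N" using N by (simp add: power2_eq_square)
          also have "\<dots> \<le> C0\<^sup>2 / real N" using p p0 N by (intro divide_right_mono power_mono) auto
          finally show "real (?nn N m) * (?pp N m)\<^sup>2 \<le> C0\<^sup>2 / real N" .
        qed
        also have "\<dots> = real (?n N) * (C0\<^sup>2 / real N)" by simp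
        also have "\<dots> \<le> real (grid_time N v) * (C0\<^sup>2 / real N)" by (intro mult_right_mono) auto
        finally have le: "(\<Sum>m\<in>{grid_time N u..<grid_time N v}. real (?nn N m) * (?pp N m)\<^sup>2) \<le>
            real (grid_time N v) * (C0\<^sup>2 / real N)" .
        have "0 \<le> (\<Sum>m\<in>{grid_time N u..<grid_time N v}. real (?nn N m) * (?pp N m)\<^sup>2)"
            by (intro sum_nonneg) auto
        then have "norm ((\<Sum>m\<in>{grid_time N u..<grid_time N v}. real (?nn N m) *
            (?pp N m)\<^sup>2) / (walk_scale N)\<^sup>2) =
           (\<Sum>m\<in>{grid_time N u..<grid_time N v}. real (?nn N m) * (?pp N m)\<^sup>2) / (walk_scale N)\<^sup>2" by simp
        also have "\<dots> \<le> real (grid_time N v) * (C0\<^sup>2 / real N) / (walk_scale N)\<^sup>2" using le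
            by (rule divide_right_mono) simp
        finally show ?case unfolding I by (simp add: mult_ac)
      qed
    qed
  qed
  then show ?thesis unfolding thin_step_def .
qed

end

lemma gauss_hit_bounds: "0 \<le> gauss_hit bs y" "gauss_hit bs y \<le> 1"
  using gauss_hit_properties[of bs] by auto

lemma antimono_gauss_hit: "antimono (gauss_hit bs)"
  using gauss_hit_properties[of bs] by auto

text \<open>F may depend on e, so the limit exists without having been identified.\<close>

lemma convergent_if_approximable:
  fixes p :: "nat \<Rightarrow> real"
  assumes "\<And>e. 0 < e \<Longrightarrow> \<exists>F. \<forall>\<^sub>F n in sequentially. \<bar>p n - F\<bar> \<le> e"
  shows "convergent p"
proof -
  have "Cauchy p"
  proof (rule metric_CauchyI)
    fix e :: real assume "0 < e"
    then obtain F where "\<forall>\<^sub>F n in sequentially. \<bar>p n - F\<bar> \<le> e / 3" using assms[of "e / 3"] by auto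
    then obtain M where M: "\<And>n. M \<le> n \<Longrightarrow> \<bar>p n - F\<bar> \<le> e / 3" unfolding eventually_sequentially by blast
    have "dist (p m) (p n) < e" if "M \<le> m" "M \<le> n" for m n
      using M[OF that(1)] M[OF that(2)] \<open>0 < e\<close> unfolding dist_real_def by linarith
    then show "\<exists>M. \<forall>m\<ge>M. \<forall>n\<ge>M. dist (p m) (p n) < e" by blast
  qed
  then show ?thesis by (simp add: Cauchy_convergent_iff)
qed

context critical_weights
begin

section \<open>Hitting probabilities observed on a grid\<close>

definition grid :: "real \<Rightarrow> real \<Rightarrow> nat \<Rightarrow> nat \<Rightarrow> nat \<Rightarrow> real \<Rightarrow> bool" where
  "grid S h m N i y \<longleftrightarrow> (\<exists>j\<le>m. i = grid_time N (S + real j * h)) \<and> y \<le> 0"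

definition grid_blocks :: "real \<Rightarrow> real \<Rightarrow> nat \<Rightarrow> nat \<Rightarrow> (real \<times> real) list" where
  "grid_blocks S h m j = map (\<lambda>l. (speed * ((S + real (Suc l) * h) ^ (k - 1) - (S + real l * h) ^ (k -
      1)), sqrt h)) [j..<m]"

text \<open>The stretch from 0 to S precedes every test and therefore stands outside
  \<open>gauss_hit\<close>, which would test the level first.\<close>

definition grid_limit :: "real \<Rightarrow> real \<Rightarrow> nat \<Rightarrow> real \<Rightarrow> real" where
  "grid_limit S h m y =
     (\<integral>x. gauss_hit (grid_blocks S h m 0) (y + speed * S ^ (k - 1) + sqrt S *
         x) \<partial>std_normal_distribution)"

lemma walk_scale_square_eventually_ge:
  assumes "0 < c"
  shows "\<forall>\<^sub>F N in sequentially. C \<le> c * (walk_scale N)\<^sup>2"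
proof -
  define C' where "C' = max C 1"
  have "\<forall>\<^sub>F N in sequentially. 1 / (walk_scale N)\<^sup>2 < c / C'"
    using assms unfolding C'_def
        by (intro order_tendstoD(2)[OF walk_scale_limits(2)]) (auto simp: max_def)
  then show ?thesis
    using eventually_gt_at_top[of 0]
  proof eventually_elim
    case (elim N)
    have "0 < (walk_scale N)\<^sup>2" "0 < C'" using walk_scale_pos[OF elim(2)] unfolding C'_def by auto
    then have "C' < c * (walk_scale N)\<^sup>2" using elim(1) by (simp add: field_simps)
    then show ?case unfolding C'_def by simp
  qed
qed

text \<open>Backward induction over the grid: after the last grid time nothing can be hit, and each
  earlier block is one application of \<open>indep_hit_block_converges\<close>. The unguarded
  stretch up to S is a final application.\<close>

lemma grid_converges:
  assumes S: "0 < S" and h: "0 < h" and K: "(\<lambda>N. real (K N) * walk_scale N / real N) \<longlonglongrightarrow> 0"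
  shows "(\<lambda>N. indep_hit (thin_step (K N) N) (grid S h m N) N 0 (walk_scale N * y)) \<longlonglongrightarrow> grid_limit S h m y"
proof -
  let ?q = "\<lambda>N. thin_step (K N) N" and ?G = "\<lambda>N. grid S h m N" and ?s = "\<lambda>j. S + real j * h"
  have s0: "0 \<le> ?s j" for j using S h by simp
  have smono: "j \<le> l \<Longrightarrow> ?s j \<le> ?s l" for j l using h by (simp add: mult_right_mono)
  have down: "?G N i y" if "y \<le> y'" "?G N i y'" for N i y y' using that unfolding grid_def by auto
  \<comment> \<open>The bound 2 leaves room for rounding, which moves a grid time by at most 1, so
    consecutive grid times are distinct.\<close>
  have ev: "\<forall>\<^sub>F N in sequentially. 0 < N \<and> 2 \<le> h * (walk_scale N)\<^sup>2 \<and> 2 \<le> S * (walk_scale N)\<^sup>2 \<and>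
      grid_time N (?s m) \<le> N"
    using walk_scale_square_eventually_ge[OF h, of 2] walk_scale_square_eventually_ge[OF S, of 2]
      eventually_gt_at_top[of 0] eventually_grid_time_small[OF s0[of m] zero_less_one]
    by eventually_elim simp
  have tlt: "grid_time N u < grid_time N v" if "0 \<le> u" "2 \<le> (v - u) * (walk_scale N)\<^sup>2" for N u v
  proof -
    have "real (grid_time N u) \<le> (walk_scale N)\<^sup>2 * u + 1" by (rule grid_time_bounds(2)[OF that(1)])
    also have "\<dots> < (walk_scale N)\<^sup>2 * v" using that(2) by (simp add: algebra_simps)
    finally have "\<not> grid_time N v \<le> grid_time N u" unfolding grid_time_le_iff by simp
    then show ?thesis by simp
  qed
  have level: "(\<lambda>N. indep_hit (?q N) (?G N) (N - grid_time N (?s j)) (grid_time N (?s j)) (walk_scale N *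
      y)) \<longlonglongrightarrow> gauss_hit (grid_blocks S h m j) y"
    if "j \<le> m" for j y
    using that
  proof (induction arbitrary: y rule: inc_induct)
    case base
    have "\<forall>\<^sub>F N in sequentially. indep_hit (?q N) (?G N) (N -
        grid_time N (?s m)) (grid_time N (?s m)) (walk_scale N * y) = of_bool (y \<le> 0)"
      using ev
    proof eventually_elim
      case (elim N)
      have w: "0 < walk_scale N" using walk_scale_pos elim by simp
      show ?case
      proof (cases "y \<le> 0")
        case True
        then have "?G N (grid_time N (?s m)) (walk_scale N * y)" unfolding grid_def using w
            by (auto simp: mult_le_0_iff)
        then show ?thesis using True by (simp add: indep_hit_eq_1)
      next
        case False
        then have ng: "\<not> ?G N (grid_time N (?s m)) (walk_scale N * y)" unfolding grid_def using w
            by (simp add: not_le)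
        have z: "indep_hit (?q N) (?G N) n (Suc (grid_time N (?s m))) y' = 0" for n y'
        proof (rule indep_hit_eq_0)
          fix i y assume i: "Suc (grid_time N (?s m)) \<le> i"
          have "grid_time N (?s j) \<le> grid_time N (?s m)" if "j \<le> m" for j
              by (intro grid_time_mono smono that)
          then show "\<not> ?G N i y" unfolding grid_def using i by fastforce
        qed
        show ?thesis
        proof (cases "N - grid_time N (?s m)")
          case 0
          then show ?thesis using ng False by simp
        next
          case (Suc n)
          then show ?thesis using ng False z by simp
        qed
      qed
    qed
    then show ?case by (simp add: grid_blocks_def tendsto_eventually)
  next
    case (step j)
    have bl: "grid_blocks S h m j =
        (speed * (?s (Suc j) ^ (k - 1) - ?s j ^ (k - 1)), sqrt h) # grid_blocks S h m (Suc j)"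
      using step.hyps unfolding grid_blocks_def by (simp add: upt_conv_Cons)
    show ?case
    proof (cases "y \<le> 0")
      case True
      have "\<forall>\<^sub>F N in sequentially. indep_hit (?q N) (?G N) (N -
          grid_time N (?s j)) (grid_time N (?s j)) (walk_scale N * y) = 1"
        using ev
      proof eventually_elim
        case (elim N)
        then have "walk_scale N * y \<le> 0" using walk_scale_pos[of N] True by (simp add: mult_le_0_iff)
        moreover have "j \<le> m" using step.hyps by simp
        ultimately have "?G N (grid_time N (?s j)) (walk_scale N * y)" unfolding grid_def by blast
        then show ?case by (rule indep_hit_eq_1)
      qed
      then show ?thesis using True by (simp add: bl tendsto_eventually)
    next
      case False
      have "(\<lambda>N. indep_hit (?q N) (?G N) (N - grid_time N (?s j)) (grid_time N (?s j)) (walk_scale N *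
          y)) \<longlonglongrightarrow>
        (\<integral>x. gauss_hit (grid_blocks S h m (Suc j)) (y + speed * (?s (Suc j) ^ (k - 1) - ?s j ^ (k - 1)) +
            sqrt h * x) \<partial>std_normal_distribution)"
      proof (rule indep_hit_block_converges)
        show "finite (set_pmf (?q N i))" for N i by (rule finite_thin_step)
        show "0 < sqrt h" using h by simp
        show "?G N i y" if "y \<le> y'" "?G N i y'" for N i y y' using that by (rule down)
        show "antimono (gauss_hit (grid_blocks S h m (Suc j)))" by (rule antimono_gauss_hit)
        show "(\<lambda>N. indep_hit (?q N) (?G N) (N -
            grid_time N (?s (Suc j))) (grid_time N (?s (Suc j))) (walk_scale N * y)) \<longlonglongrightarrow>
                gauss_hit (grid_blocks S h m (Suc j)) y" for y
          by (rule step.IH)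
        have "?s j < ?s (Suc j)" "?s (Suc j) - ?s j = h" using h by (simp_all add: algebra_simps)
        then show "weak_conv_m (\<lambda>N. distr (measure_pmf (increment_sum (?q N) (grid_time N (?s (Suc j)) -
            grid_time N (?s j)) (grid_time N (?s j)))) borel
           (\<lambda>x. (x / walk_scale N - speed * (?s (Suc j) ^ (k - 1) - ?s j ^ (k -
               1))) / sqrt h)) std_normal_distribution"
          using block_clt[OF s0[of j] _ K, of "?s (Suc j)"] by simp
        show "\<forall>\<^sub>F N in sequentially. 0 < walk_scale N \<and> grid_time N (?s j) < grid_time N (?s (Suc j)) \<and>
            grid_time N (?s (Suc j)) \<le> N \<and>
          \<not> ?G N (grid_time N (?s j)) (walk_scale N * y) \<and>
              (\<forall>i y. grid_time N (?s j) < i \<longrightarrow> i < grid_time N (?s (Suc j)) \<longrightarrow> \<not> ?G N i y)"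
          using ev
        proof eventually_elim
          case (elim N)
          have w: "0 < walk_scale N" using walk_scale_pos elim by simp
          have "?s (Suc j) - ?s j = h" by (simp add: algebra_simps)
          then have t: "grid_time N (?s j) < grid_time N (?s (Suc j))" using elim s0
              by (intro tlt) simp_all
          have "grid_time N (?s (Suc j)) \<le> grid_time N (?s m)" using step.hyps
              by (intro grid_time_mono smono) simp
          then have tN: "grid_time N (?s (Suc j)) \<le> N" using elim by simp
          have ng: "\<not> ?G N (grid_time N (?s j)) (walk_scale N * y)" unfolding grid_def using w False
              by (simp add: not_le)
          have "\<not> ?G N i y" if i: "grid_time N (?s j) < i" "i < grid_time N (?s (Suc j))" for i y
          proof
            assume "?G N i y"
            then obtain l where l: "i = grid_time N (?s l)" unfolding grid_def by auto
            consider "l \<le> j" | "Suc j \<le> l" by linarith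
            then show False
            proof cases
              case 1
              then have "grid_time N (?s l) \<le> grid_time N (?s j)" by (intro grid_time_mono smono)
              then show ?thesis using i l by simp
            next
              case 2
              then have "grid_time N (?s (Suc j)) \<le> grid_time N (?s l)" by (intro grid_time_mono smono)
              then show ?thesis using i l by simp
            qed
          qed
          then show ?case using w t tN ng by blast
        qed
      qed
      then show ?thesis using False by (simp only: bl gauss_hit.simps fst_conv snd_conv if_False)
    qed
  qed
  have "(\<lambda>N. indep_hit (?q N) (?G N) (N - grid_time N 0) (grid_time N 0) (walk_scale N * y)) \<longlonglongrightarrow>
     (\<integral>x. gauss_hit (grid_blocks S h m 0) (y + speed * (S ^ (k - 1) - 0 ^ (k - 1)) + sqrt S *
         x) \<partial>std_normal_distribution)"
  proof (rule indep_hit_block_converges)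
    show "finite (set_pmf (?q N i))" for N i by (rule finite_thin_step)
    show "0 < sqrt S" using S by simp
    show "?G N i y" if "y \<le> y'" "?G N i y'" for N i y y' using that by (rule down)
    show "antimono (gauss_hit (grid_blocks S h m 0))" by (rule antimono_gauss_hit)
    show "(\<lambda>N. indep_hit (?q N) (?G N) (N - grid_time N S) (grid_time N S) (walk_scale N * y)) \<longlonglongrightarrow>
        gauss_hit (grid_blocks S h m 0) y" for y
      using level[of 0 y] by simp
    show "weak_conv_m (\<lambda>N. distr (measure_pmf (increment_sum (?q N) (grid_time N S -
        grid_time N 0) (grid_time N 0))) borel
       (\<lambda>x. (x / walk_scale N - speed * (S ^ (k - 1) - 0 ^ (k - 1))) / sqrt S)) std_normal_distribution"
      using block_clt[OF order_refl S K] by simp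
    show "\<forall>\<^sub>F N in sequentially. 0 < walk_scale N \<and> grid_time N 0 < grid_time N S \<and> grid_time N S \<le> N \<and>
      \<not> ?G N (grid_time N 0) (walk_scale N * y) \<and>
          (\<forall>i y. grid_time N 0 < i \<longrightarrow> i < grid_time N S \<longrightarrow> \<not> ?G N i y)"
      using ev
    proof eventually_elim
      case (elim N)
      have t: "grid_time N 0 < grid_time N S" using elim by (intro tlt) simp_all
      have ge: "grid_time N S \<le> grid_time N (?s l)" for l using smono[of 0 l]
          by (intro grid_time_mono) simp
      have "\<not> ?G N i y" if "i < grid_time N S" for i y
      proof
        assume "?G N i y"
        then obtain l where "i = grid_time N (?s l)" unfolding grid_def by auto
        then show False using ge[of l] that by simp
      qed
      moreover have "grid_time N S \<le> N" using ge[of m] elim by simp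
      ultimately show ?case using t walk_scale_pos elim by blast
    qed
  qed
  moreover have "grid_time N 0 = 0" for N by (simp add: grid_time_def)
  moreover have "(0::real) ^ (k - 1) = 0" using k3 by simp
  ultimately show ?thesis by (simp only: grid_limit_def diff_zero minus_nat.diff_0)
qed

text \<open>Lowering the start by e translates the first Gaussian variable by e / sqrt S. The bound
  involves neither h nor m, so the grid can be refined after e has been chosen.\<close>

lemma grid_limit_shift:
  assumes S: "0 < S" and e: "0 \<le> e"
  shows "grid_limit S h m (- e) - grid_limit S h m 0 \<le> e / sqrt S"
proof -
  let ?u = "\<lambda>x. gauss_hit (grid_blocks S h m 0) (speed * S ^ (k - 1) + sqrt S * x)"
  have "(\<integral>x. ?u (x - e / sqrt S) \<partial>std_normal_distribution) - (\<integral>x. ?u x \<partial>std_normal_distribution) \<le>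
      e / sqrt S"
  proof (rule std_normal_shift_antimono_le)
    show "antimono ?u" using S
        by (intro antimonoI antimonoD[OF antimono_gauss_hit]) (simp add: mult_left_mono)
    show "0 \<le> e / sqrt S" using S e by simp
  qed (rule gauss_hit_bounds)+
  moreover have "speed * S ^ (k - 1) + sqrt S * (x - e / sqrt S) =
      - e + speed * S ^ (k - 1) + sqrt S * x" for x
    using S by (simp add: algebra_simps)
  ultimately show ?thesis unfolding grid_limit_def by (simp only: add_0_left)
qed

text \<open>A walk found at or below 0 is, by Chebyshev's inequality, at most \<open>\<epsilon>\<close> above 0 (on its natural
  scale) at the next grid time; stopping at the first visit makes this a single estimate instead of
  one for each block.\<close>

lemma grid_dense:
  assumes ST: "0 < S" "S < T"
  shows "\<exists>C>0. \<forall>K m \<epsilon>. (\<lambda>N. real (K N) * walk_scale N / real N) \<longlonglongrightarrow> 0 \<longrightarrow> 0 < m \<longrightarrow> 0 < \<epsilon> \<longrightarrow>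
    (\<forall>\<^sub>F N in sequentially. \<forall>i y. grid_time N S \<le> i \<longrightarrow> i \<le> grid_time N T \<longrightarrow> y \<le> 0 \<longrightarrow>
      1 - (((T - S) / real m * C)\<^sup>2 + (T - S) / real m * C) / \<epsilon>\<^sup>2 \<le>
      indep_hit (thin_step (K N) N) (\<lambda>i y. grid S ((T - S) / real m) m N i (y - \<epsilon> * walk_scale N)) (N -
          i) i y)"
proof -
  obtain C0 N0 where C0: "0 < C0" and N0: "\<And>N i. N0 \<le> N \<Longrightarrow> 2 * i \<le> N \<Longrightarrow>
     \<bar>drift \<beta> N i\<bar> \<le> C0 * ((real i / real N) ^ (k - 2) + 1 / real N) \<and>
     real N * link_prob \<beta> N i \<le> C0"
    using sum_drift_estimate by blast
  \<comment> \<open>Bounds drift and variance per unit of rescaled time up to T; it is taken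
    strictly larger than both limiting rates so that the bounds hold eventually.\<close>
  define C where "C = C0 * T ^ (k - 2) + C0 + 1"
  have T: "0 \<le> T" using ST by simp
  have C: "0 < C" unfolding C_def using C0 T by (simp add: add_nonneg_pos)
  show ?thesis
  proof (intro exI[of _ C] conjI allI impI C)
    fix K :: "nat \<Rightarrow> nat" and m :: nat and \<epsilon> :: real
    assume K: "(\<lambda>N. real (K N) * walk_scale N / real N) \<longlonglongrightarrow> 0" and m: "0 < m" and \<epsilon>: "0 < \<epsilon>"
    define h where "h = (T - S) / real m"
    have h: "0 < h" unfolding h_def using ST m by simp
    have sm: "S + real m * h = T" unfolding h_def using m by simp
    define a where "a = (\<lambda>N. real (grid_time N T) / (walk_scale N)\<^sup>2)"
    have "(\<lambda>N. (h + 1 / (walk_scale N)\<^sup>2) * (C0 * (a N ^ (k - 2) + walk_scale N / real N + real (K N) *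
        walk_scale N / real N))) \<longlonglongrightarrow>
       (h + 0) * (C0 * (T ^ (k - 2) + 0 + 0))"
      unfolding a_def by (intro tendsto_intros walk_scale_limits grid_time_ratio_limit T K)
    moreover have "(h + 0) * (C0 * (T ^ (k - 2) + 0 + 0)) < h * C"
    proof -
      have "C0 * T ^ (k - 2) < C" unfolding C_def using C0 by linarith
      then show ?thesis using h by simp
    qed
    ultimately have ev1: "\<forall>\<^sub>F N in sequentially. (h + 1 / (walk_scale N)\<^sup>2) * (C0 * (a N ^ (k - 2) +
        walk_scale N / real N + real (K N) * walk_scale N / real N)) < h * C"
      by (rule order_tendstoD(2))
    have "(\<lambda>N. (h + 1 / (walk_scale N)\<^sup>2) * C0) \<longlonglongrightarrow> (h + 0) * C0"
      by (intro tendsto_intros walk_scale_limits)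
    moreover have "(h + 0) * C0 < h * C"
    proof -
      have "0 \<le> C0 * T ^ (k - 2)" using C0 T by simp
      then have "C0 < C" unfolding C_def by linarith
      then show ?thesis using h by simp
    qed
    ultimately have ev2: "\<forall>\<^sub>F N in sequentially. (h + 1 / (walk_scale N)\<^sup>2) * C0 < h * C"
      by (rule order_tendstoD(2))
    show "\<forall>\<^sub>F N in sequentially. \<forall>i y. grid_time N S \<le> i \<longrightarrow> i \<le> grid_time N T \<longrightarrow> y \<le> 0 \<longrightarrow>
      1 - (((T - S) / real m * C)\<^sup>2 + (T - S) / real m * C) / \<epsilon>\<^sup>2 \<le>
      indep_hit (thin_step (K N) N) (\<lambda>i y. grid S ((T - S) / real m) m N i (y - \<epsilon> * walk_scale N)) (N -
          i) i y"
      unfolding h_def[symmetric]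
      using ev1 ev2 eventually_ge_at_top[of "max N0 1"] eventually_grid_time_small[OF T, of "1 / 2", OF
          half_gt_zero[OF zero_less_one]]
    proof eventually_elim
      case (elim N)
      have N: "0 < N" "N0 \<le> N" using elim by auto
      have w: "0 < walk_scale N" by (rule walk_scale_pos[OF N(1)])
      let ?w = "walk_scale N" and ?s = "\<lambda>j. S + real j * h"
      let ?G = "\<lambda>i y. grid S h m N i (y - \<epsilon> * ?w)"
      let ?q = "thin_step (K N) N"
      let ?a = "\<lambda>l. real (N - Suc l - K N) * link_prob \<beta> N l - 1" and ?v =
          "\<lambda>l. real (N - Suc l - K N) * link_prob \<beta> N l"
      define b where "b = C0 * ((real (grid_time N T) / real N) ^ (k - 2) + 1 / real N +
          real (K N) / real N)"
      have half: "2 * l \<le> N" if "l \<le> grid_time N T" for l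
      proof -
        have "real l \<le> real (grid_time N T)" using that by simp
        then show ?thesis using elim(4) by linarith
      qed
      have b0: "0 \<le> b" unfolding b_def using C0 by simp
      have p: "0 \<le> link_prob \<beta> N l" for l using link_prob_in_01[of N l] by simp
      have ab: "\<bar>?a l\<bar> \<le> b" "?v l \<le> C0" if "l \<le> grid_time N T" for l
      proof -
        have e: "\<bar>drift \<beta> N l\<bar> \<le> C0 * ((real l / real N) ^ (k - 2) + 1 / real N)" "real N *
            link_prob \<beta> N l \<le> C0"
          using N0[OF N(2) half[OF that]] by auto
        have "real (K N) * link_prob \<beta> N l \<le> real (K N) * (C0 / real N)"
          using e(2) N by (intro mult_left_mono) (simp_all add: field_simps)
        moreover have "C0 * ((real l / real N) ^ (k - 2) + 1 / real N) \<le>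
            C0 * ((real (grid_time N T) / real N) ^ (k - 2) + 1 / real N)"
          using that C0 N by (intro mult_left_mono add_right_mono power_mono divide_right_mono) auto
        ultimately show "\<bar>?a l\<bar> \<le> b"
          using e(1) thin_drift_bound[of N l "K N"] unfolding b_def by (simp add: algebra_simps)
        have "?v l \<le> real N * link_prob \<beta> N l" using p by (intro mult_right_mono) auto
        then show "?v l \<le> C0" using e(2) by linarith
      qed
      show ?case
      proof (intro allI impI)
        fix i y assume i: "grid_time N S \<le> i" "i \<le> grid_time N T" and y: "y \<le> (0::real)"
        \<comment> \<open>The first grid point at or after i. Unless it is the very first one, its
          predecessor lies before i, so the waiting time is at most one mesh width plus 1 for
          rounding.\<close>
        define j where "j = (LEAST j. i \<le> grid_time N (?s j))"
        have ex: "i \<le> grid_time N (?s m)" using i(2) sm by simp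
        have j: "i \<le> grid_time N (?s j)" unfolding j_def by (rule LeastI[of _ m]) (rule ex)
        have jm: "j \<le> m" unfolding j_def by (rule Least_le) (rule ex)
        define t where "t = grid_time N (?s j)"
        have "?s j \<le> ?s m" using jm h by (simp add: mult_right_mono)
        then have tT: "t \<le> grid_time N T" unfolding t_def sm[symmetric] by (rule grid_time_mono)
        have len: "real (t - i) \<le> h * ?w\<^sup>2 + 1"
        proof (cases j)
          case 0
          then have "t \<le> i" unfolding t_def using i(1) by simp
          then show ?thesis using h by simp
        next
          case (Suc j')
          then have "\<not> i \<le> grid_time N (?s j')" unfolding j_def by (metis lessI not_less_Least)
          then have "real (grid_time N (?s j')) \<le> real i" by simp
          moreover have "?w\<^sup>2 * ?s j' \<le> real (grid_time N (?s j'))" using ST h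
              by (intro grid_time_bounds) simp
          moreover have "real t \<le> ?w\<^sup>2 * ?s j + 1" unfolding t_def using ST h
              by (intro grid_time_bounds) simp
          moreover have "?w\<^sup>2 * ?s j = ?w\<^sup>2 * ?s j' + h * ?w\<^sup>2" unfolding Suc
              by (simp add: algebra_simps)
          ultimately show ?thesis using j unfolding t_def[symmetric] by (simp add: of_nat_diff)
        qed
        let ?A = "\<Sum>l\<in>{i..<t}. ?a l" and ?V = "\<Sum>l\<in>{i..<t}. ?v l"
        have A: "\<bar>?A\<bar> \<le> (h * ?w\<^sup>2 + 1) * b"
        proof -
          have "\<bar>?A\<bar> \<le> (\<Sum>l\<in>{i..<t}. \<bar>?a l\<bar>)" by (rule sum_abs)
          also have "\<dots> \<le> (\<Sum>l\<in>{i..<t}. b)" using tT by (intro sum_mono ab) simp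
          also have "\<dots> = real (t - i) * b" by simp
          also have "\<dots> \<le> (h * ?w\<^sup>2 + 1) * b" using len b0 by (rule mult_right_mono)
          finally show ?thesis .
        qed
        have V: "?V \<le> (h * ?w\<^sup>2 + 1) * C0"
        proof -
          have "?V \<le> (\<Sum>l\<in>{i..<t}. C0)" using tT by (intro sum_mono ab) simp
          also have "\<dots> = real (t - i) * C0" by simp
          also have "\<dots> \<le> (h * ?w\<^sup>2 + 1) * C0" using len C0 by (intro mult_right_mono) auto
          finally show ?thesis .
        qed
        have A2: "\<bar>?A\<bar> \<le> h * C * ?w"
        proof -
          have "b * ?w = C0 * (a N ^ (k - 2) + ?w / real N + real (K N) * ?w / real N)"
            unfolding b_def a_def grid_time_drift_scale(2)[OF N(1), symmetric]
                by (simp add: algebra_simps)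
          then have "(h + 1 / ?w\<^sup>2) * (b * ?w) \<le> h * C" using elim(1) by simp
          then have "(h + 1 / ?w\<^sup>2) * (b * ?w) * ?w \<le> h * C * ?w" using w by (intro mult_right_mono) auto
          moreover have "(h + 1 / ?w\<^sup>2) * (b * ?w) * ?w = (h * ?w\<^sup>2 + 1) * b"
            using w by (simp add: power2_eq_square field_simps)
          ultimately show ?thesis using A by linarith
        qed
        have V2: "?V \<le> h * C * ?w\<^sup>2"
        proof -
          have "(h + 1 / ?w\<^sup>2) * C0 * ?w\<^sup>2 \<le> h * C * ?w\<^sup>2" using elim(2) by (intro mult_right_mono) auto
          moreover have "(h + 1 / ?w\<^sup>2) * C0 * ?w\<^sup>2 = (h * ?w\<^sup>2 + 1) * C0" using w
              by (simp add: field_simps)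
          ultimately show ?thesis using V by linarith
        qed
        \<comment> \<open>Level 0 is the worst starting level; lower ones follow by
          monotonicity.\<close>
        have "1 - indep_hit ?q ?G (N - i) i 0 \<le> ((0 + ?A)\<^sup>2 + ?V) / (\<epsilon> * ?w)\<^sup>2"
        proof (rule indep_hit_ge_chebyshev)
          show "?q l = binomial_pmf (N - Suc l - K N) (link_prob \<beta> N l)" for l by (rule thin_step_def)
          show "link_prob \<beta> N l \<in> {0..1}" for l by (rule link_prob_in_01)
          show "0 < \<epsilon> * ?w" using \<epsilon> w by simp
          show "?G t y" if "y \<le> \<epsilon> * ?w" for y unfolding grid_def t_def using that jm by auto
          show "i \<le> t" unfolding t_def by (rule j)
          show "t \<le> i + (N - i)" using half[OF tT] by simp
        qed
        also have "\<dots> \<le> ((h * C * ?w)\<^sup>2 + h * C * ?w\<^sup>2) / (\<epsilon> * ?w)\<^sup>2"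
        proof (rule divide_right_mono)
          have "?A\<^sup>2 \<le> (h * C * ?w)\<^sup>2" using power_mono[OF A2, of 2] by simp
          then show "(0 + ?A)\<^sup>2 + ?V \<le> (h * C * ?w)\<^sup>2 + h * C * ?w\<^sup>2" using V2 by simp
        qed simp
        also have "\<dots> = ((h * C)\<^sup>2 + h * C) / \<epsilon>\<^sup>2"
          using w by (simp add: power_mult_distrib flip: distrib_right)
        finally have "1 - ((h * C)\<^sup>2 + h * C) / \<epsilon>\<^sup>2 \<le> indep_hit ?q ?G (N - i) i 0" by linarith
        also have "\<dots> \<le> indep_hit ?q ?G (N - i) i y"
        proof (rule indep_hit_antimono[OF _ y])
          show "?G i y" if "y \<le> y'" "?G i y'" for i y y' using that unfolding grid_def by auto
        qed
        finally show "1 - ((h * C)\<^sup>2 + h * C) / \<epsilon>\<^sup>2 \<le> indep_hit ?q ?G (N - i) i y" .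
      qed
    qed
  qed
qed

section \<open>Convergence in the window and the final limit\<close>

text \<open>Lower bound: grid times belong to the window, and ignoring the queue raises the walk.
  Upper bound: overestimate the queue by sqrt N, replace the window by the grid with its target
  raised by epsilon, and undo this shift in the limit. Both grid walks have the same limit, which
  serves as F.\<close>

lemma window_hit_limit:
  assumes ST: "0 < S" "S < T" and e: "0 < e"
  shows "\<exists>F. \<forall>\<^sub>F N in sequentially.
    \<bar>hit (child_kernel \<beta> N) (\<lambda>cs. grid_time N S \<le> length cs \<and> length cs \<le> grid_time N T \<and>
        net cs \<le> 0) N [] - F\<bar> \<le> e"
proof -
  obtain C where C: "0 < C" "\<And>K m \<epsilon>. (\<lambda>N. real (K N) * walk_scale N / real N) \<longlonglongrightarrow> 0 \<Longrightarrow> 0 < m \<Longrightarrow> 0 < \<epsilon> \<Longrightarrow>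
    (\<forall>\<^sub>F N in sequentially. \<forall>i y. grid_time N S \<le> i \<longrightarrow> i \<le> grid_time N T \<longrightarrow> y \<le> 0 \<longrightarrow>
      1 - (((T - S) / real m * C)\<^sup>2 + (T - S) / real m * C) / \<epsilon>\<^sup>2 \<le>
      indep_hit (thin_step (K N) N) (\<lambda>i y. grid S ((T - S) / real m) m N i (y - \<epsilon> * walk_scale N)) (N -
          i) i y)"
    using grid_dense[OF ST] by blast
  \<comment> \<open>Undoing the shift then costs e / 4. Next m is taken so large that the Chebyshev
    error is below e / 4, which is possible because C depends on neither. The other quarters go to
    the queue and to the convergence of the grid walk.\<close>
  define \<epsilon> where "\<epsilon> = sqrt S * (e / 4)"
  have \<epsilon>: "0 < \<epsilon>" "\<epsilon> / sqrt S = e / 4" unfolding \<epsilon>_def using ST e by simp_all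
  define \<kappa> where "\<kappa> = (\<lambda>m. (((T - S) / real m * C)\<^sup>2 + (T - S) / real m * C) / \<epsilon>\<^sup>2)"
  have "(\<lambda>m. (T - S) / real m) \<longlonglongrightarrow> 0" by real_asymp
  then have "\<kappa> \<longlonglongrightarrow> ((0 * C)\<^sup>2 + 0 * C) / \<epsilon>\<^sup>2"
    unfolding \<kappa>_def using \<epsilon> by (intro tendsto_intros) simp_all
  then have \<kappa>0: "\<kappa> \<longlonglongrightarrow> 0" by simp
  have "\<forall>\<^sub>F m in sequentially. \<kappa> m < e / 4" using e by (intro order_tendstoD(2)[OF \<kappa>0]) simp
  then have "\<forall>\<^sub>F m in sequentially. \<kappa> m < e / 4 \<and> 0 < m"
    using eventually_gt_at_top[of 0] by eventually_elim simp
  then obtain m where m: "\<kappa> m < e / 4" "0 < m"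
    by (auto dest: eventually_happens)
  define h where "h = (T - S) / real m"
  have h: "0 < h" unfolding h_def using ST m by simp
  have sm: "S + real m * h = T" unfolding h_def using m by simp
  define K where "K = (\<lambda>N::nat. nat \<lceil>sqrt (real N)\<rceil>)"
  have K: "(\<lambda>N. real (K N) * walk_scale N / real N) \<longlonglongrightarrow> 0" unfolding K_def by (rule walk_scale_limits)
  have K0: "(\<lambda>N. real 0 * walk_scale N / real N) \<longlonglongrightarrow> 0" by simp
  let ?F = "grid_limit S h m 0"
  have T: "0 \<le> T" using ST by simp
  have "\<forall>\<^sub>F N in sequentially. ?F - e < indep_hit (thin_step 0 N) (grid S h m N) N 0 (walk_scale N * 0)"
    using e by (intro order_tendstoD(1)[OF grid_converges[OF ST(1) h K0]]) simp
  moreover have "\<forall>\<^sub>F N in sequentially. indep_hit (thin_step (K N) N) (grid S h m N) N 0 (walk_scale N *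
      (- \<epsilon>)) < grid_limit S h m (- \<epsilon>) + e / 4"
    using e by (intro order_tendstoD(2)[OF grid_converges[OF ST(1) h K]]) simp
  moreover have "0 < T + 1" "0 < e / 4" using T e by simp_all
  note queue_exceeds_sqrt_bound[OF this]
  moreover note C(2)[OF K m(2) \<epsilon>(1)]
  moreover have "\<forall>\<^sub>F N in sequentially. 1 \<le> 1 * (walk_scale N)\<^sup>2"
      by (rule walk_scale_square_eventually_ge) simp
  ultimately have "\<forall>\<^sub>F N in sequentially.
    \<bar>hit (child_kernel \<beta> N) (\<lambda>cs. grid_time N S \<le> length cs \<and> length cs \<le> grid_time N T \<and>
        net cs \<le> 0) N [] - ?F\<bar> \<le> e"
  proof eventually_elim
    case (elim N)
    define B where "B = (\<lambda>i (y::real). grid_time N S \<le> i \<and> i \<le> grid_time N T \<and> y \<le> 0)"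
    let ?hit = "hit (child_kernel \<beta> N) (\<lambda>cs. B (length cs) (net cs)) N []"
    let ?G = "grid S h m N"
    have down: "B i y" if "y \<le> y'" "B i y'" for i y y' using that unfolding B_def by auto
    have "indep_hit (thin_step 0 N) ?G N 0 0 \<le> indep_hit (thin_step 0 N) B N 0 0"
    proof (rule indep_hit_mono_set)
      fix i y assume "?G i y"
      then obtain j where j: "j \<le> m" "i = grid_time N (S + real j * h)" "y \<le> 0"
          unfolding grid_def by auto
      have "S \<le> S + real j * h" "S + real j * h \<le> S + real m * h" using j(1) h
          by (simp_all add: mult_right_mono)
      then show "B i y" unfolding B_def using j(2,3) sm by (auto intro!: grid_time_mono)
    qed
    also have "\<dots> \<le> ?hit"
    proof (rule hit_ge_indep_hit[where cs = "[]", unfolded list.size(3) net.simps(1)])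
      show "B i y" if "y \<le> y'" "B i y'" for i y y' using that by (rule down)
    qed
    finally have lower: "?F - e < ?hit" using elim(1) by simp
    have "?hit \<le> indep_hit (thin_step (K N) N) B N 0 0 + hit (child_kernel \<beta> N) (\<lambda>cs. length cs \<le>
        grid_time N T \<and> K N < queue cs) N []"
    proof (rule hit_le_indep_hit[where cs = "[]", unfolded list.size(3) net.simps(1)])
      show "B i y" if "y \<le> y'" "B i y'" for i y y' using that by (rule down)
      show "i \<le> grid_time N T" if "B i y" for i y using that unfolding B_def by simp
    qed
    also have "hit (child_kernel \<beta> N) (\<lambda>cs. length cs \<le> grid_time N T \<and> K N < queue cs) N [] \<le> e / 4"
    proof -
      have "real (grid_time N T) \<le> (walk_scale N)\<^sup>2 * T + 1" by (rule grid_time_bounds(2)[OF T])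
      also have "\<dots> \<le> (T + 1) * (walk_scale N)\<^sup>2" using elim(5) by (simp add: algebra_simps)
      finally show ?thesis using elim(3) unfolding K_def by blast
    qed
    also have "indep_hit (thin_step (K N) N) B N 0 0 \<le>
        indep_hit (thin_step (K N) N) (\<lambda>i y. ?G i (y - \<epsilon> * walk_scale N)) N 0 0 + \<kappa> m"
    proof (rule indep_hit_compare)
      show "0 \<le> \<kappa> m" unfolding \<kappa>_def h_def[symmetric] using h C(1) by simp
      show "1 - \<kappa> m \<le> indep_hit (thin_step (K N) N) (\<lambda>i y. ?G i (y - \<epsilon> * walk_scale N)) (N -
          i) i y" if "B i y" for i y
        using elim(4) that unfolding B_def \<kappa>_def h_def by blast
    qed simp
    also have "indep_hit (thin_step (K N) N) (\<lambda>i y. ?G i (y - \<epsilon> * walk_scale N)) N 0 0 =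
        indep_hit (thin_step (K N) N) ?G N 0 (walk_scale N * (- \<epsilon>))"
      by (subst indep_hit_shift) (simp add: mult.commute)
    also have "\<dots> \<le> ?F + e / 4 + e / 4"
      using elim(2) grid_limit_shift[OF ST(1), of \<epsilon> h m] \<epsilon> by linarith
    finally have "?hit \<le> ?F + e / 4 + e / 4 + \<kappa> m + e / 4" by simp
    then have "?hit \<le> ?F + e" using m(1) by linarith
    then show ?case using lower unfolding B_def by linarith
  qed
  then show ?thesis by blast
qed

text \<open>For fixed R the event splits into a window up to T N^alpha and a late part of
  probability at most C / T^(2k-3); a large T makes the probabilities Cauchy in N. The same bound at
  T = R^2 sends the limit to 0.\<close>

lemma return_probability_limit:
  "\<exists>\<delta>>0. \<exists>L :: real \<Rightarrow> real.
     (\<forall>R>0. ((\<lambda>N. hit (child_kernel \<beta> N) (\<lambda>cs. real N powr alpha k * R\<^sup>2 \<le> real (length cs) \<and>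
        real (length cs) \<le> real N * \<delta> \<and> net cs \<le> 0) N []) \<longlongrightarrow> L R) sequentially) \<and> (L \<longlongrightarrow> 0) at_top"
proof -
  obtain \<delta> C where \<delta>: "0 < \<delta>" and C: "0 < C" and late: "\<And>T. 0 < T \<Longrightarrow> \<forall>\<^sub>F N in sequentially.
     hit (child_kernel \<beta> N) (\<lambda>cs. real N powr alpha k * T \<le> real (length cs) \<and>
        real (length cs) \<le> real N * \<delta> \<and> net cs \<le> 0) N [] \<le> C / T ^ (2 * k - 3)"
    using late_return_bound by blast
  define E where "E = (\<lambda>N T cs. real N powr alpha k * T \<le> real (length cs) \<and>
      real (length cs) \<le> real N * \<delta> \<and> net cs \<le> 0)"
  define p where "p = (\<lambda>T N. hit (child_kernel \<beta> N) (E N T) N [])"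
  have late': "\<forall>\<^sub>F N in sequentially. p T N \<le> C / T ^ (2 * k - 3)" if "0 < T" for T
    using late[OF that] unfolding p_def E_def .
  have vanish: "((\<lambda>T. C / T ^ (2 * k - 3)) \<longlongrightarrow> 0) at_top"
  proof -
    have "filterlim (\<lambda>T::real. T ^ (2 * k - 3)) at_top at_top"
      using k3 by (intro filterlim_pow_at_top filterlim_ident) simp
    then show ?thesis by (rule real_tendsto_divide_at_top[OF tendsto_const])
  qed
  have conv: "convergent (p S)" if S: "0 < S" for S
  proof (rule convergent_if_approximable)
    fix e :: real assume e: "0 < e"
    have "\<forall>\<^sub>F T in at_top. C / T ^ (2 * k - 3) < e / 2" using e
        by (intro order_tendstoD(2)[OF vanish]) simp
    then have "\<forall>\<^sub>F T in at_top. C / T ^ (2 * k - 3) < e / 2 \<and> S < T"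
      using eventually_gt_at_top[of S] by eventually_elim simp
    then obtain T where T: "C / T ^ (2 * k - 3) < e / 2" "S < T"
      by (auto dest: eventually_happens)
    have T0: "0 < T" using S T by simp
    define W where "W = (\<lambda>N cs. grid_time N S \<le> length cs \<and> length cs \<le> grid_time N T \<and> net cs \<le> 0)"
    have e2: "0 < e / 2" using e by simp
    obtain F where F: "\<forall>\<^sub>F N in sequentially. \<bar>hit (child_kernel \<beta> N) (W N) N [] - F\<bar> \<le> e / 2"
      using window_hit_limit[OF S T(2) e2] unfolding W_def by blast
    have "\<forall>\<^sub>F N in sequentially. \<bar>p S N - F\<bar> \<le> e"
      using F late'[OF T0] eventually_grid_time_small[OF less_imp_le[OF T0] \<delta>]
    proof eventually_elim
      case (elim N)
      have iff: "real N powr alpha k * s \<le> real i \<longleftrightarrow> grid_time N s \<le> i" for s i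
        unfolding grid_time_le_iff walk_scale_square ..
      have "hit (child_kernel \<beta> N) (W N) N [] \<le> p S N"
        unfolding p_def
      proof (rule hit_mono)
        fix cs assume W: "W N cs"
        then have "real (length cs) \<le> real (grid_time N T)" unfolding W_def by simp
        then show "E N S cs" using W elim(3) unfolding E_def W_def iff by linarith
      qed
      moreover have "p S N \<le> hit (child_kernel \<beta> N) (\<lambda>cs. W N cs \<or> E N T cs) N []"
        unfolding p_def by (rule hit_mono) (auto simp: E_def W_def iff)
      then have "p S N \<le> hit (child_kernel \<beta> N) (W N) N [] + p T N"
        using hit_disj_le[of "child_kernel \<beta> N" "W N" "E N T" N "[]"] unfolding p_def by linarith
      ultimately show ?case using elim(1,2) T(1) by linarith
    qed
    then show "\<exists>F. \<forall>\<^sub>F N in sequentially. \<bar>p S N - F\<bar> \<le> e" by blast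
  qed
  define L where "L = (\<lambda>R. lim (p (R\<^sup>2)))"
  have L: "p (R\<^sup>2) \<longlonglongrightarrow> L R" if "0 < R" for R
    unfolding L_def using conv[of "R\<^sup>2"] that by (simp add: convergent_LIMSEQ_iff)
  have "(L \<longlongrightarrow> 0) at_top"
  proof (rule tendsto_sandwich)
    show "\<forall>\<^sub>F R in at_top. 0 \<le> L R"
      using eventually_gt_at_top[of 0]
    proof eventually_elim
      case (elim R)
      show ?case by (rule LIMSEQ_le_const[OF L[OF elim]]) (auto simp: p_def hit_bounds)
    qed
    show "\<forall>\<^sub>F R in at_top. L R \<le> C / (R\<^sup>2) ^ (2 * k - 3)"
      using eventually_gt_at_top[of 0]
    proof eventually_elim
      case (elim R)
      then have "\<forall>\<^sub>F N in sequentially. p (R\<^sup>2) N \<le> C / (R\<^sup>2) ^ (2 * k - 3)" by (intro late') simp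
      then show ?case by (rule tendsto_upperbound[OF L[OF elim] _ trivial_limit_sequentially])
    qed
    have "filterlim (\<lambda>R::real. R\<^sup>2) at_top at_top" by (intro filterlim_pow_at_top filterlim_ident) simp
    then show "((\<lambda>R. C / (R\<^sup>2) ^ (2 * k - 3)) \<longlongrightarrow> 0) at_top" by (rule filterlim_compose[OF vanish])
  qed simp
  then show ?thesis using \<delta> L unfolding p_def E_def by blast
qed

end

theorem theorem5p2:
  fixes k :: nat and \<beta> :: "nat \<Rightarrow> real"
  assumes "3 \<le> k"
    and "\<And>j. 2 \<le> j \<Longrightarrow> 0 \<le> \<beta> j"
    and "summable (\<lambda>j. real j * \<beta> j)"
    and "\<And>j. 2 \<le> j \<Longrightarrow> j \<le> k - 1 \<Longrightarrow> \<beta> j = 1 / (real j * (real j - 1))"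
    and "\<beta> k > 1 / (real k * (real k - 1))"
  shows "\<exists>\<delta>>0. \<exists>L :: real \<Rightarrow> real.
           (\<forall>R>0. ((\<lambda>N. measure_pmf.prob (hyp_pmf \<beta> N)
                       {H. bfw_S k H N R \<le> ereal (real N * \<delta>)}) \<longlongrightarrow> L R) sequentially)
         \<and> (L \<longlongrightarrow> 0) at_top"
proof -
  interpret critical_weights k \<beta> by unfold_locales (use assms in auto)
  have "measure_pmf.prob (hyp_pmf \<beta> N) {H. bfw_S k H N R \<le> ereal x} =
    hit (child_kernel \<beta> N)
      (\<lambda>cs. real N powr alpha k * R\<^sup>2 \<le> real (length cs) \<and> real (length cs) \<le> x \<and> net cs \<le> 0) N []"
    for N R x
    by (rule prob_bfw_S_eq_hit) (rule nonneg)
  then show ?thesis using return_probability_limit by simp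
qed

end
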